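(* Let $A$ be a unital $C^*$-algebra equipped with a strongly continuous action $\sigma$ of the unit circle $S^1\subseteq\mathbb C$ by $*$-automorphisms. Let $\mathcal A\subseteq A$ be a norm-dense unital $*$-subalgebra, let $B$ be a unital $C^*$-algebra and let $\beta_i:\mathcal A\to B$ be a unital algebra homomorphism (not assumed to preserve the involution); put $\beta_{-i}(a):=\beta_i(a^* )^*$ for $a\in\mathcal A$. Let $L,L_\beta:\mathcal A\to[0,\infty)$ be slip-norms. Suppose that: (1) $\sigma_\lambda(\mathcal A)\subseteq\mathcal A$ for all $\lambda\in S^1$ and $\mathcal A\subseteq \operatorname{Lip}_{S^1}(A)$; (2) $P_0(\mathcal A)\subseteq\mathcal A$ and there exist finitely many elements $\zeta_1^R,\dots,\zeta_k^R\in\mathcal A\cap A_1$ and $\zeta_1^L,\dots,\zeta_m^L\in\mathcal A\cap A_1$ such that $\sum_{j=1}^k\zeta_j^R(\zeta_j^R)^*=1=\sum_{j=1}^m(\zeta_j^L)^*\zeta_j^L$; (3) there exists a constant $C\ge 0$ such that $L_\ell(a)\le C\cdot L(a)$ and $L_\beta(a)\le C\cdot L(a)$ for all $a\in\mathcal A$; (4) $L_\beta(ab)\le L_\beta(a)\,\|\beta_i(b)\|+\|\beta_{-i}(a)\|\,L_\beta(b)$ for all $a,b\in\mathcal A$, and the restriction of $\beta_i$ to $\mathcal A\cap A_0$ extends to a unital $*$-homomorphism $A_0\to B$; (5) $L_\beta$ is lower semicontinuous and $L_\beta(\sigma_\lambda(a))=L_\beta(a)$ for all $a\in\mathcal A$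 and $\lambda\in S^1$; (6) $(\mathcal A\cap A_0,L_\beta)$ is a compact quantum metric space. Then $(\mathcal A,L)$ is a compact quantum metric space.
   Context: For $n\in\mathbb Z$, $A_n:=\{a\in A:\sigma_\lambda(a)=\lambda^n a\ \forall\lambda\in S^1\}$ is the spectral subspace and $P_n(a):=\frac1{2\pi}\int_0^{2\pi}e^{-itn}\sigma_{e^{it}}(a)\,dt$ the spectral projection onto $A_n$; $A_0$ is the fixed point algebra. Let $\ell:S^1\to[0,\pi]$, $\ell(e^{it})=|t|$ for $t\in(-\pi,\pi]$. $\operatorname{Lip}_{S^1}(A)$ is the set of $a\in A$ for which $L_\ell(a):=\sup_{\lambda\in S^1\setminus\{1\}}\|\sigma_\lambda(a)-a\|/\ell(\lambda)<\infty$. An operator system is a subspace $\mathcal E$ of a unital $C^*$-algebra with $1\in\mathcal E$ and $\mathcal E^*=\mathcal E$. A slip-norm on $\mathcal E$ is a seminorm $L$ with $L(1)=0$ and $L(x^* )=L(x)$; it is lower semicontinuous if $\{x\in\mathcal E: L(x)>y\}$ is norm-open for every $y\ge0$. $(\mathcal E,L)$ is a compact quantum metric space if the (extended) metric $d_L(\mu,\nu):=\sup\{|\mu(x)-\nu(x)|:L(x)\le1\}$ on the state space of $\mathcal E$ (unital positive functionals) induces the weak$^*$ topology. *)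

theory Defs
  imports "HOL-Analysis.Analysis"
begin

class cstar_algebra = real_normed_algebra_1 + banach +
  fixes scaleC :: "complex \<Rightarrow> 'a \<Rightarrow> 'a" (infixr \<open>*\<^sub>C\<close> 75)
    and adj :: "'a \<Rightarrow> 'a"
  assumes scaleC_of_real: "scaleC (complex_of_real r) x = r *\<^sub>R x"
    and scaleC_add_left: "scaleC (a + b) x = scaleC a x + scaleC b x"
    and scaleC_add_right: "scaleC a (x + y) = scaleC a x + scaleC a y"
    and scaleC_scaleC: "scaleC a (scaleC b x) = scaleC (a * b) x"
    and scaleC_left_mult: "scaleC a x * y = scaleC a (x * y)"
    and scaleC_right_mult: "x * scaleC a y = scaleC a (x * y)"
    and norm_scaleC: "norm (scaleC a x) = cmod a * norm x"
    and adj_add: "adj (x + y) = adj x + adj y"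
    and adj_scaleC: "adj (scaleC a x) = scaleC (cnj a) (adj x)"
    and adj_mult: "adj (x * y) = adj y * adj x"
    and adj_adj: "adj (adj x) = x"
    and cstar_identity: "norm (adj x * x) = (norm x)\<^sup>2"

definition star_hom_on :: "'a::cstar_algebra set \<Rightarrow> ('a \<Rightarrow> 'b::cstar_algebra) \<Rightarrow> bool" where
  "star_hom_on S f \<longleftrightarrow>
     (\<forall>x\<in>S. \<forall>y\<in>S. f (x + y) = f x + f y \<and> f (x * y) = f x * f y) \<and>
     (\<forall>c. \<forall>x\<in>S. f (c *\<^sub>C x) = c *\<^sub>C f x) \<and>
     f 1 = 1 \<and> (\<forall>x\<in>S. f (adj x) = adj (f x))"
  \<comment> \<open>unital *-homomorphism on the set S (S assumed a unital *-subalgebra)\<close>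

definition unital_alg_hom_on :: "'a::cstar_algebra set \<Rightarrow> ('a \<Rightarrow> 'b::cstar_algebra) \<Rightarrow> bool" where
  "unital_alg_hom_on S f \<longleftrightarrow>
     (\<forall>x\<in>S. \<forall>y\<in>S. f (x + y) = f x + f y \<and> f (x * y) = f x * f y) \<and>
     (\<forall>c. \<forall>x\<in>S. f (c *\<^sub>C x) = c *\<^sub>C f x) \<and> f 1 = 1"

definition star_automorphism :: "('a::cstar_algebra \<Rightarrow> 'a) \<Rightarrow> bool" where
  "star_automorphism f \<longleftrightarrow> bij f \<and> star_hom_on UNIV f"

definition unital_star_subalgebra :: "'a::cstar_algebra set \<Rightarrow> bool" where
  "unital_star_subalgebra S \<longleftrightarrow> 1 \<in> S \<and>
     (\<forall>x\<in>S. \<forall>y\<in>S. x + y \<in> S \<and> x * y \<in> S) \<and>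
     (\<forall>c. \<forall>x\<in>S. c *\<^sub>C x \<in> S) \<and> (\<forall>x\<in>S. adj x \<in> S)"

abbreviation circle :: "complex set" where "circle \<equiv> sphere 0 1"

definition strongly_cont_circle_action :: "(complex \<Rightarrow> 'a::cstar_algebra \<Rightarrow> 'a) \<Rightarrow> bool" where
  "strongly_cont_circle_action \<sigma> \<longleftrightarrow>
     (\<forall>z\<in>circle. star_automorphism (\<sigma> z)) \<and> \<sigma> 1 = id \<and>
     (\<forall>z\<in>circle. \<forall>w\<in>circle. \<sigma> (z * w) = \<sigma> z \<circ> \<sigma> w) \<and>
     (\<forall>a. continuous_on circle (\<lambda>z. \<sigma> z a))"

definition spectral_subspace :: "(complex \<Rightarrow> 'a::cstar_algebra \<Rightarrow> 'a) \<Rightarrow> int \<Rightarrow> 'a set" where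
  "spectral_subspace \<sigma> n = {a. \<forall>z\<in>circle. \<sigma> z a = (z powi n) *\<^sub>C a}"

definition spectral_proj :: "(complex \<Rightarrow> 'a::cstar_algebra \<Rightarrow> 'a) \<Rightarrow> int \<Rightarrow> 'a \<Rightarrow> 'a" where
  "spectral_proj \<sigma> n a =
     (1 / (2 * pi)) *\<^sub>R integral {0..2*pi} (\<lambda>t. cis (- (t * real_of_int n)) *\<^sub>C \<sigma> (cis t) a)"

definition ell :: "complex \<Rightarrow> real" where
  "ell z = \<bar>Arg z\<bar>"   \<comment> \<open>Arg z \<in> (-pi, pi]\<close>

definition lip_quotients :: "(complex \<Rightarrow> 'a::cstar_algebra \<Rightarrow> 'a) \<Rightarrow> 'a \<Rightarrow> real set" where
  "lip_quotients \<sigma> a = {norm (\<sigma> z a - a) / ell z | z. z \<in> circle - {1}}"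

definition Lip_S1 :: "(complex \<Rightarrow> 'a::cstar_algebra \<Rightarrow> 'a) \<Rightarrow> 'a set" where
  "Lip_S1 \<sigma> = {a. bdd_above (lip_quotients \<sigma> a)}"

definition L_ell :: "(complex \<Rightarrow> 'a::cstar_algebra \<Rightarrow> 'a) \<Rightarrow> 'a \<Rightarrow> real" where
  "L_ell \<sigma> a = Sup (lip_quotients \<sigma> a)"

definition slip_norm :: "'a::cstar_algebra set \<Rightarrow> ('a \<Rightarrow> real) \<Rightarrow> bool" where
  "slip_norm E L \<longleftrightarrow> (\<forall>x\<in>E. 0 \<le> L x) \<and>
     (\<forall>x\<in>E. \<forall>y\<in>E. L (x + y) \<le> L x + L y) \<and>
     (\<forall>c. \<forall>x\<in>E. L (c *\<^sub>C x) = cmod c * L x) \<and>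
     L 1 = 0 \<and> (\<forall>x\<in>E. L (adj x) = L x)"

definition lsc_on :: "'a::cstar_algebra set \<Rightarrow> ('a \<Rightarrow> real) \<Rightarrow> bool" where
  "lsc_on E L \<longleftrightarrow> (\<forall>y\<ge>0. openin (top_of_set E) {x\<in>E. L x > y})"

definition positive_elt :: "'a::cstar_algebra \<Rightarrow> bool" where
  "positive_elt x \<longleftrightarrow> (\<exists>y. x = adj y * y)"

definition state_space :: "'a::cstar_algebra set \<Rightarrow> ('a \<Rightarrow> complex) set" where
  "state_space E = {\<mu>. \<mu> \<in> extensional E \<and>
     (\<forall>x\<in>E. \<forall>y\<in>E. \<mu> (x + y) = \<mu> x + \<mu> y) \<and>
     (\<forall>c. \<forall>x\<in>E. \<mu> (c *\<^sub>C x) = c * \<mu> x) \<and>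
     (\<forall>x\<in>E. positive_elt x \<longrightarrow> \<mu> x \<in> \<real> \<and> 0 \<le> Re (\<mu> x)) \<and>
     \<mu> 1 = 1}"

definition dist_L :: "'a::cstar_algebra set \<Rightarrow> ('a \<Rightarrow> real) \<Rightarrow> ('a \<Rightarrow> complex) \<Rightarrow> ('a \<Rightarrow> complex) \<Rightarrow> ereal" where
  "dist_L E L \<mu> \<nu> = Sup {ereal (cmod (\<mu> x - \<nu> x)) | x. x \<in> E \<and> L x \<le> 1}"

definition weak_star_topology :: "'a::cstar_algebra set \<Rightarrow> ('a \<Rightarrow> complex) topology" where
  "weak_star_topology E = subtopology (product_topology (\<lambda>_. euclidean) E) (state_space E)"

definition dist_L_open :: "'a::cstar_algebra set \<Rightarrow> ('a \<Rightarrow> real) \<Rightarrow> ('a \<Rightarrow> complex) set \<Rightarrow> bool" where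
  "dist_L_open E L U \<longleftrightarrow> U \<subseteq> state_space E \<and>
     (\<forall>\<mu>\<in>U. \<exists>r>0. \<forall>\<nu>\<in>state_space E. dist_L E L \<mu> \<nu> < ereal r \<longrightarrow> \<nu> \<in> U)"

definition compact_qms :: "'a::cstar_algebra set \<Rightarrow> ('a \<Rightarrow> real) \<Rightarrow> bool" where
  "compact_qms E L \<longleftrightarrow>
     (\<forall>U. openin (weak_star_topology E) U \<longleftrightarrow> dist_L_open E L U)"

end

theory Submission
  imports Defs
begin

text \<open>For an operator system, \<open>(E, L)\<close> is a compact quantum metric space iff \<open>{L \<le> 1}\<close> is totally
  bounded modulo the scalars; the forward direction rests on the fact that states norm the selfadjoint
  elements. By (3) it therefore suffices to treat the set \<open>X\<close> on which \<open>L_ell\<close> and \<open>L\<beta>\<close> are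
  at most \<open>C\<close>. The Fejer means of \<open>a\<close> approximate \<open>a\<close> uniformly on \<open>X\<close>, so each
  \<open>P\<^sub>n(X)\<close> has to be shown totally bounded modulo the scalars. Averaging over the circle does not
  increase \<open>L\<beta>\<close>, which settles \<open>n = 0\<close> by (6). For \<open>n > 0\<close> the products \<open>w\<close> of \<open>n\<close> of the left
  generators satisfy \<open>\<Sum> w\<^sup>* w = 1\<close>, so \<open>P\<^sub>n(a) = \<Sum> (P\<^sub>n(a) w\<^sup>*) w\<close> with \<open>P\<^sub>n(a) w\<^sup>*\<close> in
  \<open>A\<^sub>0\<close>, bounded in norm and in \<open>L\<beta>\<close>. Taking adjoints gives \<open>n < 0\<close>.\<close>

text \<open>Multiplication by \<open>w\<close> does not preserve the scalars, so for
  \<open>n > 0\<close> total boundedness modulo scalars is too weak to be pushed through the frame.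
  The Lipschitz bound removes the scalars: for \<open>n \<noteq> 0\<close> the \<open>n\<close>-th
  Fourier coefficient ignores constants, so \<open>L_ell\<close> bounds the \<open>n\<close>-th
  component in norm, and a norm-bounded set that is totally bounded modulo scalars is totally
  bounded outright. A further obstacle is that hypothesis (2) speaks of the projection onto the
  fixed points alone; the other projections preserve the subalgebra because of the frame and the
  identity \<open>?P n a * adj w = ?P 0 (a * adj w)\<close>, and only then do
  \<open>L\<beta>\<close> and the Leibniz rule apply to the components. The facts about states are
  obtained without spectra: positivity is a norm inequality, and an iteration run inside a commutant
  takes the place of functional calculus. The constants 2, 4 and 8 comparing norms with states are
  not sharp; only their finiteness matters.\<close>

section \<open>Complex scalars and the involution\<close>

lemma scaleC_one [simp]: "1 *\<^sub>C x = (x::'a::cstar_algebra)"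
  using scaleC_of_real[of 1 x] by simp

lemma scaleC_zero_left [simp]: "0 *\<^sub>C x = (0::'a::cstar_algebra)"
  using scaleC_of_real[of 0 x] by simp

lemma bounded_linear_scaleC: "bounded_linear (\<lambda>x::'a::cstar_algebra. c *\<^sub>C x)"
proof (rule bounded_linear_intro)
  show "c *\<^sub>C (r *\<^sub>R x) = r *\<^sub>R (c *\<^sub>C x)" for r and x :: 'a
    by (simp only: scaleC_of_real[symmetric] scaleC_scaleC mult.commute)
  show "norm (c *\<^sub>C x) \<le> norm x * cmod c" for x :: 'a
    by (simp add: norm_scaleC)
qed (rule scaleC_add_right)

lemma scaleC_minus_left: "(- c) *\<^sub>C x = - (c *\<^sub>C (x::'a::cstar_algebra))"
  using scaleC_add_left[of "-c" c x] by (simp add: eq_neg_iff_add_eq_0)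

lemma scaleC_diff_left: "(c - d) *\<^sub>C x = c *\<^sub>C (x::'a::cstar_algebra) - d *\<^sub>C x"
  using scaleC_add_left[of c "-d" x] by (simp add: scaleC_minus_left)

lemmas scaleC_zero_right [simp] = linear_0[OF bounded_linear.linear[OF bounded_linear_scaleC]]
lemmas scaleC_minus_right = linear_neg[OF bounded_linear.linear[OF bounded_linear_scaleC]]
lemmas scaleC_diff_right = linear_diff[OF bounded_linear.linear[OF bounded_linear_scaleC]]
lemmas scaleC_scaleR = linear_scale[OF bounded_linear.linear[OF bounded_linear_scaleC]]

lemma scaleC_of_real_one: "complex_of_real r *\<^sub>C (1::'a::cstar_algebra) = of_real r"
  unfolding scaleC_of_real by (simp add: of_real_def)

text \<open>Reduces complex scaling to real scaling, from which joint continuity and the behaviour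
  of real-linear functionals follow.\<close>

lemma scaleC_Re_Im: "c *\<^sub>C x = Re c *\<^sub>R x + Im c *\<^sub>R (\<i> *\<^sub>C (x::'a::cstar_algebra))"
proof -
  have "c *\<^sub>C x = (complex_of_real (Re c) + complex_of_real (Im c) * \<i>) *\<^sub>C x"
    using complex_eq[of c] by (simp only: mult.commute)
  then show ?thesis
    unfolding scaleC_add_left scaleC_scaleC[symmetric] scaleC_of_real .
qed

lemma continuous_on_scaleC [continuous_intros]:
  fixes g :: "'b::topological_space \<Rightarrow> 'a::cstar_algebra"
  assumes "continuous_on S f" "continuous_on S g"
  shows "continuous_on S (\<lambda>t. f t *\<^sub>C g t)"
proof -
  have "continuous_on S (\<lambda>t. \<i> *\<^sub>C g t)"
    by (rule bounded_linear.continuous_on[OF bounded_linear_scaleC assms(2)])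
  then have "continuous_on S (\<lambda>t. Re (f t) *\<^sub>R g t + Im (f t) *\<^sub>R (\<i> *\<^sub>C g t))"
    by (intro continuous_intros assms)
  then show ?thesis by (simp only: scaleC_Re_Im[symmetric])
qed

lemma bounded_linear_scaleC_left: "bounded_linear (\<lambda>c. c *\<^sub>C (x::'a::cstar_algebra))"
proof (rule bounded_linear_intro)
  show "(r *\<^sub>R c) *\<^sub>C x = r *\<^sub>R (c *\<^sub>C x)" for r c
    by (simp add: scaleR_conv_of_real scaleC_of_real flip: scaleC_scaleC)
  show "norm (c *\<^sub>C x) \<le> norm c * norm x" for c by (simp add: norm_scaleC)
qed (rule scaleC_add_left)

lemma adj_one [simp]: "adj (1::'a::cstar_algebra) = 1"
  by (metis adj_adj adj_mult mult.right_neutral)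

lemma adj_scaleR: "adj (r *\<^sub>R x) = r *\<^sub>R adj (x::'a::cstar_algebra)"
  by (metis adj_scaleC complex_cnj_complex_of_real scaleC_of_real)

lemma norm_adj [simp]: "norm (adj x) = norm (x::'a::cstar_algebra)"
proof -
  have le: "norm y \<le> norm (adj y)" for y :: 'a
  proof (cases "y = 0")
    case False
    have "norm y * norm y \<le> norm (adj y) * norm y"
      using norm_mult_ineq[of "adj y" y] by (simp add: cstar_identity power2_eq_square)
    with False show ?thesis by simp
  qed simp
  show ?thesis using le[of x] le[of "adj x"] by (simp add: adj_adj)
qed

lemma bounded_linear_adj: "bounded_linear (adj :: 'a::cstar_algebra \<Rightarrow> 'a)"
  by (rule bounded_linear_intro[where K=1]) (simp_all add: adj_add adj_scaleR)

lemmas adj_zero [simp] = linear_0[OF bounded_linear.linear[OF bounded_linear_adj]]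
lemmas adj_minus = linear_neg[OF bounded_linear.linear[OF bounded_linear_adj]]
lemmas adj_diff = linear_diff[OF bounded_linear.linear[OF bounded_linear_adj]]

lemma adj_of_real [simp]: "adj (of_real r) = (of_real r :: 'a::cstar_algebra)"
  by (simp add: of_real_def adj_scaleR)

lemma continuous_on_adj: "continuous_on S (adj :: 'a::cstar_algebra \<Rightarrow> 'a)"
  by (simp add: bounded_linear_adj linear_continuous_on)

lemma norm_selfadj_square: "adj x = x \<Longrightarrow> norm (x * x) = (norm (x::'a::cstar_algebra))\<^sup>2"
  using cstar_identity[of x] by simp

text \<open>The explicit formulas for \<open>a\<close> and \<open>b\<close> are exported so that
  both can be placed in any operator system containing \<open>x\<close>.\<close>

lemma cartesian_decomposition:
  fixes x :: "'a::cstar_algebra"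
  obtains a b where "adj a = a" "adj b = b" "x = a + \<i> *\<^sub>C b" "norm a \<le> norm x" "norm b \<le> norm x"
    "a = (1/2) *\<^sub>R (x + adj x)" "b = (1/2) *\<^sub>R (- (\<i> *\<^sub>C (x - adj x)))"
proof
  let ?a = "(1/2) *\<^sub>R (x + adj x)" and ?b = "(1/2) *\<^sub>R (- (\<i> *\<^sub>C (x - adj x)))"
  show "adj ?a = ?a" by (simp add: adj_scaleR adj_add adj_adj add.commute)
  show "adj ?b = ?b"
    by (simp add: adj_scaleR adj_minus adj_diff adj_adj adj_scaleC scaleC_minus_left scaleC_diff_right)
  have "\<i> *\<^sub>C ?b = (1/2) *\<^sub>R (x - adj x)"
    by (simp add: scaleC_scaleR scaleC_minus_right scaleC_scaleC scaleC_minus_left)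
      (metis minus_diff_eq scaleR_minus_right)
  then show "x = ?a + \<i> *\<^sub>C ?b"
    unfolding \<open>\<i> *\<^sub>C ?b = _\<close> by (simp flip: scaleR_right_distrib)
  have "norm (x + adj x) \<le> norm x + norm (adj x)" by (rule norm_triangle_ineq)
  then show "norm ?a \<le> norm x" unfolding norm_scaleR by simp
  have "norm (\<i> *\<^sub>C (x - adj x)) \<le> norm x + norm (adj x)"
    unfolding norm_scaleC using norm_triangle_ineq4[of x "adj x"] by simp
  then show "norm ?b \<le> norm x" unfolding norm_scaleR norm_minus_cancel by simp
qed (rule refl)+

section \<open>Positivity in a C*-algebra\<close>

text \<open>A description of positivity that avoids spectra and is visibly closed under addition.\<close>

definition metric_pos :: "'a::cstar_algebra \<Rightarrow> bool" where
  "metric_pos x \<longleftrightarrow> adj x = x \<and> (\<exists>t. norm (of_real t - x) \<le> t)"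

text \<open>No closure under \<open>adj\<close>, so that the commutant of an arbitrary element
  qualifies.\<close>

definition closed_subalgebra :: "'a::cstar_algebra set \<Rightarrow> bool" where
  "closed_subalgebra S \<longleftrightarrow> closed S \<and> 1 \<in> S \<and>
     (\<forall>x\<in>S. \<forall>y\<in>S. x + y \<in> S \<and> x * y \<in> S) \<and> (\<forall>r. \<forall>x\<in>S. r *\<^sub>R x \<in> S)"

lemma closed_subalgebra_commutant: "closed_subalgebra {x. x * z = z * (x::'a::cstar_algebra)}"
  unfolding closed_subalgebra_def
proof (intro conjI)
  show "closed {x. x * z = z * x}"
    by (intro closed_Collect_eq continuous_intros)
qed (auto simp: distrib_left distrib_right, metis mult.assoc)

lemma closed_subalgebra_of_real: "closed_subalgebra S \<Longrightarrow> of_real r \<in> S"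
  by (simp add: closed_subalgebra_def of_real_def)

lemma closed_subalgebra_diff:
  assumes "closed_subalgebra S" "x \<in> S" "y \<in> S"
  shows "x - y \<in> S"
proof -
  have "x + (-1) *\<^sub>R y \<in> S" using assms unfolding closed_subalgebra_def by blast
  then show ?thesis by simp
qed

text \<open>The fixed point \<open>s\<close> of Visser's iteration makes \<open>1 - s\<close> a square root of \<open>1 - y\<close>.\<close>

lemma visser_iteration:
  fixes y :: "'a::{real_normed_algebra_1,banach}"
  assumes y: "norm y \<le> 1" and S: "closed S" "0 \<in> S"
    and step: "\<And>u. u \<in> S \<Longrightarrow> (1/2) *\<^sub>R (y + u * u) \<in> S"
  obtains s where "s \<in> S" "norm s \<le> 1" "s = (1/2) *\<^sub>R (y + s * s)"
proof -
  define F where "F u = (1/2) *\<^sub>R (y + u * u)" for u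
  \<comment> \<open>Scalar iteration for the worst case \<open>norm y = 1\<close>, where no
    contraction estimate is available. It increases and stays below 1, so its telescoping increments
    give a summable majorant for those of \<open>s\<close>.\<close>
  define G where "G r = (1 + r * r) / 2" for r :: real
  define s where "s n = (F ^^ n) 0" for n
  define r where "r n = (G ^^ n) 0" for n
  have s0: "s 0 = 0" and sS: "s (Suc n) = F (s n)" for n by (simp_all add: s_def)
  have r0: "r 0 = 0" and rS: "r (Suc n) = G (r n)" for n by (simp_all add: r_def)
  have r: "0 \<le> r n \<and> r n \<le> 1" for n
    by (induction n) (auto simp: r0 rS G_def intro: mult_le_one)
  have s_le: "norm (s n) \<le> r n" for n
  proof (induction n)
    case (Suc n)
    have "norm (y + s n * s n) \<le> norm y + norm (s n * s n)" by (rule norm_triangle_ineq)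
    also have "\<dots> \<le> 1 + r n * r n"
      using y Suc r[of n] by (intro add_mono order_trans[OF norm_mult_ineq] mult_mono) auto
    finally show ?case by (simp add: sS F_def rS G_def)
  qed (simp add: s0 r0)
  have diff: "norm (s (Suc n) - s n) \<le> r (Suc n) - r n" for n
  proof (induction n)
    case 0
    show ?case using y by (simp add: s0 r0 sS rS F_def G_def)
  next
    case (Suc n)
    let ?d = "s (Suc n) - s n"
    have F_diff: "F u - F v = (1/2) *\<^sub>R (u * u - v * v)" for u v
      by (simp add: F_def flip: scaleR_diff_right)
    have "s (Suc (Suc n)) - s (Suc n) = (1/2) *\<^sub>R (s (Suc n) * s (Suc n) - s n * s n)"
      unfolding sS[of "Suc n"] by (subst (2) sS) (rule F_diff)
    \<comment> \<open>This splitting of a difference of squares is valid without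
      commutativity.\<close>
    also have "s (Suc n) * s (Suc n) - s n * s n = s (Suc n) * ?d + ?d * s n"
      by (simp add: algebra_simps)
    finally have "norm (s (Suc (Suc n)) - s (Suc n)) \<le> (norm (s (Suc n) * ?d) + norm (?d * s n)) / 2"
      using norm_triangle_ineq by auto
    also have "\<dots> \<le> (r (Suc n) * (r (Suc n) - r n) + (r (Suc n) - r n) * r n) / 2"
      using Suc s_le r order_trans[OF norm_ge_zero Suc]
      by (intro divide_right_mono add_mono order_trans[OF norm_mult_ineq] mult_mono) auto
    also have "\<dots> = r (Suc (Suc n)) - r (Suc n)"
      by (simp add: rS G_def field_simps)
    finally show ?case .
  qed
  have rmono: "incseq r"
    using order_trans[OF norm_ge_zero diff] by (intro incseq_SucI) simp
  have "convergent r"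
    by (rule Bseq_mono_convergent[OF BseqI'[of r 1]]) (use r rmono in \<open>auto simp: incseq_def\<close>)
  then have "summable (\<lambda>n. r (Suc n) - r n)"
    using telescope_summable by (auto simp: convergent_def)
  then have "summable (\<lambda>n. s (Suc n) - s n)"
    by (rule summable_comparison_test'[where N=0]) (use diff in auto)
  then have "convergent (\<lambda>n. \<Sum>i<n. s (Suc i) - s i)"
    by (simp add: summable_iff_convergent)
  then obtain l where l: "s \<longlonglongrightarrow> l"
    by (auto simp: convergent_def sum_lessThan_telescope s0)
  have "(\<lambda>n. F (s n)) \<longlonglongrightarrow> F l"
    unfolding F_def by (intro tendsto_intros l)
  moreover have "(\<lambda>n. F (s n)) \<longlonglongrightarrow> l"
    using l by (simp flip: sS add: LIMSEQ_Suc)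
  ultimately have "F l = l" by (rule LIMSEQ_unique)
  moreover have "s n \<in> S" for n
    by (induction n) (use S step in \<open>auto simp: s0 sS F_def\<close>)
  then have "l \<in> S" using S(1) l closed_sequentially by blast
  moreover have "norm l \<le> 1"
    by (rule LIMSEQ_le_const2[OF tendsto_norm[OF l]]) (use s_le r order_trans in blast)
  ultimately show thesis using that[of l] by (simp add: F_def)
qed

text \<open>Rescaling by \<open>t\<close> turns the defining inequality into
  \<open>norm y \<le> 1\<close> for \<open>y = 1 - a / t\<close>, where the iteration applies within
  the selfadjoint part of \<open>S\<close>. The bound \<open>norm s \<le> 1\<close> on its limit
  makes the root \<open>metric_pos\<close> again, with witness \<open>sqrt t\<close>.\<close>

lemma metric_pos_sqrt:
  fixes a :: "'a::cstar_algebra"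
  assumes a: "metric_pos a" and S: "closed_subalgebra S" "a \<in> S"
  obtains h where "h \<in> S" "metric_pos h" "h * h = a"
proof -
  from a obtain t where sa: "adj a = a" and t: "norm (of_real t - a) \<le> t"
    unfolding metric_pos_def by blast
  show thesis
  proof (cases "t = 0")
    case True
    with t have "a = 0" by simp
    with S that[of 0] show ?thesis by (auto simp: metric_pos_def intro!: exI[of _ 0])
  next
    case False
    then have tpos: "t > 0" using t norm_ge_zero[of "of_real t - a"] by linarith
    define y where "y = 1 - (1/t) *\<^sub>R a"
    have "y = (1/t) *\<^sub>R (of_real t - a)"
      using tpos by (simp add: y_def of_real_def scaleR_diff_right)
    then have "norm y = (1/t) * norm (of_real t - a)" using tpos by simp
    then have "norm y \<le> 1" using t tpos by (simp add: divide_le_eq_1_pos)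
    have yS: "y \<in> S" unfolding y_def
      by (rule closed_subalgebra_diff[OF S(1)]) (use S in \<open>auto simp: closed_subalgebra_def\<close>)
    have ysa: "adj y = y" by (simp add: y_def adj_diff adj_scaleR sa)
    let ?T = "S \<inter> {x. adj x = x}"
    have "0 \<in> S" using closed_subalgebra_of_real[OF S(1), of 0] by simp
    have "closed {x::'a. adj x = x}"
      by (intro closed_Collect_eq continuous_on_adj continuous_intros)
    with S have "closed ?T" by (auto simp: closed_subalgebra_def)
    moreover have "(1/2) *\<^sub>R (y + u * u) \<in> ?T" if "u \<in> ?T" for u
      using that S yS ysa by (auto simp: closed_subalgebra_def adj_scaleR adj_add adj_mult)
    ultimately obtain s where s: "s \<in> ?T" "norm s \<le> 1" "s = (1/2) *\<^sub>R (y + s * s)"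
      using visser_iteration[OF \<open>norm y \<le> 1\<close>, of ?T] \<open>0 \<in> S\<close> by auto
    define h where "h = sqrt t *\<^sub>R (1 - s)"
    have "2 *\<^sub>R s = y + s * s" by (subst s(3)) simp
    then have "(1 - s) * (1 - s) = 1 - y" by (simp add: algebra_simps scaleR_2)
    then have "h * h = a" using tpos by (simp add: h_def y_def)
    moreover have "h \<in> S" unfolding h_def using S(1) s closed_subalgebra_diff[OF S(1), of 1 s]
      by (auto simp: closed_subalgebra_def)
    moreover have "of_real (sqrt t) - h = sqrt t *\<^sub>R s"
      by (simp add: h_def of_real_def algebra_simps)
    then have "metric_pos h"
      unfolding metric_pos_def using s tpos
      by (intro conjI exI[of _ "sqrt t"]) (auto simp: h_def adj_scaleR adj_diff mult_left_le)
    ultimately show ?thesis using that by blast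
  qed
qed

text \<open>Taking \<open>S\<close> to be the commutant of \<open>z\<close> gives a root commuting
  with \<open>z\<close>, the substitute for functional calculus below.\<close>

lemma metric_pos_sqrt_commuting:
  fixes a :: "'a::cstar_algebra"
  assumes "metric_pos a" "a * z = z * a"
  obtains h where "h * z = z * h" "metric_pos h" "h * h = a"
  using metric_pos_sqrt[OF assms(1) closed_subalgebra_commutant[of z]] assms(2) by blast

text \<open>Since \<open>h\<close> and \<open>k\<close> commute, \<open>u = h + \<i> k\<close> has
  \<open>adj u * u = h h + k k\<close>, of norm \<open>\<bar>s\<bar>\<close>. The C*-identity bounds
  \<open>u\<close>, and its real part \<open>h\<close> is no larger than \<open>u\<close>.\<close>

lemma commuting_square_sum_norm:
  fixes h k :: "'a::cstar_algebra"
  assumes "adj h = h" "adj k = k" "h * k = k * h" "h * h + k * k = of_real s"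
  shows "norm (h * h) \<le> \<bar>s\<bar>"
proof -
  define u where "u = h + \<i> *\<^sub>C k"
  have au: "adj u = h - \<i> *\<^sub>C k"
    by (simp add: u_def adj_add adj_scaleC assms scaleC_minus_left)
  have "adj u * u = h * h + k * k"
    unfolding au by (simp add: u_def algebra_simps scaleC_left_mult scaleC_right_mult scaleC_scaleC
        scaleC_minus_left scaleC_diff_right scaleC_add_right assms(3))
  then have u2: "(norm u)\<^sup>2 = \<bar>s\<bar>" using cstar_identity[of u] assms(4) by simp
  have "2 *\<^sub>R h = u + adj u" unfolding au by (simp add: u_def scaleR_2)
  then have "2 * norm h \<le> norm u + norm (adj u)" by (metis norm_scaleR abs_numeral norm_triangle_ineq)
  then have "norm h \<le> norm u" by simp
  then have "(norm h)\<^sup>2 \<le> (norm u)\<^sup>2" by (simp add: power_mono)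
  then show ?thesis using norm_selfadj_square[OF assms(1)] u2 by simp
qed

lemma metric_pos_of_norm_le:
  fixes a :: "'a::cstar_algebra"
  assumes "adj a = a" "norm a \<le> t"
  shows "metric_pos (of_real t - a)"
  unfolding metric_pos_def using assms by (auto simp: adj_diff intro!: exI[of _ t])

text \<open>With \<open>t\<close> the square of \<open>norm h\<close> and \<open>k\<close> a root of
  \<open>t - h h\<close> commuting with \<open>h\<close>, the distance from \<open>t\<close> to
  \<open>h h\<close> is \<open>norm (k * k)\<close>, and \<open>h h + k k = t\<close> bounds it by
  \<open>t\<close>.\<close>

lemma metric_pos_square:
  fixes h :: "'a::cstar_algebra"
  assumes h: "adj h = h"
  shows "metric_pos (h * h)"
proof -
  define t where "t = (norm h)\<^sup>2"
  have sa: "adj (h * h) = h * h" by (simp add: adj_mult h)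
  have "metric_pos (of_real t - h * h)"
    by (rule metric_pos_of_norm_le[OF sa]) (simp add: t_def norm_selfadj_square h)
  moreover have "(of_real t - h * h) * h = h * (of_real t - h * h)"
    by (simp add: algebra_simps of_real_def)
  ultimately obtain k where k: "k * h = h * k" "metric_pos k" "k * k = of_real t - h * h"
    by (rule metric_pos_sqrt_commuting)
  have "norm (k * k) \<le> \<bar>t\<bar>"
    by (rule commuting_square_sum_norm[of k h]) (use k h in \<open>auto simp: metric_pos_def\<close>)
  then show ?thesis
    unfolding metric_pos_def using sa k by (intro conjI exI[of _ t]) (auto simp: t_def)
qed

lemma metric_pos_add: "metric_pos a \<Longrightarrow> metric_pos b \<Longrightarrow> metric_pos (a + b)"
  unfolding metric_pos_def
proof (elim conjE exE, intro conjI)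
  fix s t assume "norm (of_real s - a) \<le> s" "norm (of_real t - b) \<le> t"
  moreover have "of_real (s + t) - (a + b) = (of_real s - a) + (of_real t - b)" by simp
  ultimately show "\<exists>t. norm (of_real t - (a + b)) \<le> t"
    by (intro exI[of _ "s + t"]) (metis add_mono norm_triangle_mono)
qed (simp add: adj_add)

text \<open>\<open>a\<close> and \<open>s - a\<close> receive commuting roots: \<open>k\<close> is
  chosen to commute with \<open>a\<close>, so \<open>a\<close> has a root \<open>h\<close> commuting
  with \<open>k\<close>. The absolute value spares a proof that \<open>s\<close> is
  nonnegative.\<close>

lemma metric_pos_bounded:
  fixes a :: "'a::cstar_algebra"
  assumes a: "metric_pos a" and b: "metric_pos (of_real s - a)"
  shows "norm a \<le> \<bar>s\<bar>"
proof -
  have "(of_real s - a) * a = a * (of_real s - a)" by (simp add: algebra_simps of_real_def)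
  with b obtain k where k: "k * a = a * k" "metric_pos k" "k * k = of_real s - a"
    by (rule metric_pos_sqrt_commuting)
  have "a * k = k * a" using k by simp
  with a obtain h where h: "h * k = k * h" "metric_pos h" "h * h = a"
    by (rule metric_pos_sqrt_commuting)
  then show ?thesis
    using commuting_square_sum_norm[of h k s] k by (auto simp: metric_pos_def)
qed

lemma metric_pos_antisym: "metric_pos a \<Longrightarrow> metric_pos (- a) \<Longrightarrow> a = 0"
  using metric_pos_bounded[of a 0] by simp

text \<open>In terms of real and imaginary parts the cross terms cancel, leaving twice a sum of two
  squares.\<close>

lemma metric_pos_adj_mult_add:
  fixes v :: "'a::cstar_algebra"
  shows "metric_pos (adj v * v + v * adj v)"
proof -
  obtain a b where ab: "adj a = a" "adj b = b" "v = a + \<i> *\<^sub>C b"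
    by (rule cartesian_decomposition)
  then have av: "adj v = a - \<i> *\<^sub>C b" by (simp add: adj_add adj_scaleC scaleC_minus_left)
  have "adj v * v + v * adj v = (a * a + a * a) + (b * b + b * b)"
    unfolding av unfolding ab(3)
    by (simp add: algebra_simps scaleC_left_mult scaleC_right_mult scaleC_scaleC scaleC_minus_left
        scaleC_diff_right scaleC_add_right)
  then show ?thesis using ab by (simp add: metric_pos_add metric_pos_square)
qed

text \<open>Kaplansky's theorem. If \<open>n\<close> is the negative part of \<open>x\<close> and \<open>z = y n\<close>, then \<open>z\<^sup>* z = - n\<^sup>3\<close>. With
  \<open>g\<^sup>2 = n\<^sup>3\<close> and \<open>v = z g\<close> both \<open>v\<^sup>* v\<close> and \<open>v v\<^sup>*\<close> are negatives of squares, while their sum is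
  positive; this forces \<open>g = 0\<close> without any appeal to spectra.\<close>

lemma metric_pos_adj_mult:
  fixes y :: "'a::cstar_algebra"
  shows "metric_pos (adj y * y)"
proof -
  define x where "x = adj y * y"
  have xsa: "adj x = x" by (simp add: x_def adj_mult adj_adj)
  \<comment> \<open>\<open>m\<close> is the absolute value of \<open>x\<close>. The identity
    \<open>m n = n n\<close> derived below expresses that the positive and negative parts are
    orthogonal.\<close>
  obtain m where m: "m * x = x * m" "metric_pos m" "m * m = x * x"
    using metric_pos_sqrt_commuting[OF metric_pos_square[OF xsa], of x] by (auto simp: mult.assoc)
  then have msa: "adj m = m" by (simp add: metric_pos_def)
  define n where "n = (1/2) *\<^sub>R (m - x)"
  have nsa: "adj n = n" by (simp add: n_def adj_scaleR adj_diff msa xsa)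
  define d where "d = m - x"
  have n: "n = (1/2) *\<^sub>R d" by (simp add: n_def d_def)
  have dd: "d * d = m * d + m * d" and md: "d * m = m * d" and xd: "x * d = - (m * d)"
    using m by (simp_all add: d_def algebra_simps)
  have nn: "n * n = (1/2) *\<^sub>R (m * d)"
    by (simp add: n dd scaleR_2[symmetric])
  have mn: "m * n = n * n" and xn: "x * n = - (n * n)" and nm: "n * m = m * n"
    unfolding nn by (simp_all add: n md xd)
  \<comment> \<open>\<open>n\<close> is not yet known to be positive, so \<open>g\<close> is built
    from a root of \<open>m\<close>; then \<open>g g = m n n = n n n\<close>.\<close>
  obtain r where r: "r * n = n * r" "metric_pos r" "r * r = m"
    using metric_pos_sqrt_commuting[OF m(2), of n] nm by auto
  then have rsa: "adj r = r" by (simp add: metric_pos_def)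
  define g where "g = r * n"
  have gsa: "adj g = g" by (simp add: g_def adj_mult rsa nsa r)
  have gg: "g * g = n * n * n"
    by (metis g_def mn mult.assoc r(1) r(3))
  define z where "z = y * n"
  have zz: "adj z * z = - (g * g)"
  proof -
    have "adj z * z = n * (x * n)" by (simp add: z_def adj_mult nsa x_def mult.assoc)
    then show ?thesis by (simp add: xn gg mult.assoc)
  qed
  define v where "v = z * g"
  have vv1: "adj v * v = - ((g * g) * (g * g))"
  proof -
    have "adj v * v = g * (adj z * z) * g" by (simp add: v_def adj_mult gsa mult.assoc)
    then show ?thesis by (simp add: zz mult.assoc)
  qed
  have vv2: "v * adj v = - ((z * adj z) * (z * adj z))"
  proof -
    have "v * adj v = z * (g * g) * adj z" by (simp add: v_def adj_mult gsa mult.assoc)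
    also have "g * g = - (adj z * z)" by (simp add: zz)
    finally show ?thesis by (simp add: mult.assoc)
  qed
  \<comment> \<open>The added square cancels \<open>v * adj v\<close> exactly, so the negative of a
    square remains and is \<open>metric_pos\<close>.\<close>
  have "metric_pos ((adj v * v + v * adj v) + (z * adj z) * (z * adj z))"
    by (intro metric_pos_add metric_pos_adj_mult_add metric_pos_square) (simp add: adj_mult adj_adj)
  then have "metric_pos (- ((g * g) * (g * g)))" by (simp add: vv1 vv2)
  moreover have ggsa: "adj (g * g) = g * g" by (simp add: adj_mult gsa)
  ultimately have "(g * g) * (g * g) = 0" using metric_pos_antisym metric_pos_square by blast
  then have "g * g = 0" using norm_selfadj_square[OF ggsa] by simp
  then have "(n * n) * (n * n) = 0" by (simp add: gg flip: mult.assoc)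
  moreover have "adj (n * n) = n * n" by (simp add: adj_mult nsa)
  ultimately have "n * n = 0" using norm_selfadj_square[of "n * n"] by simp
  then have "n = 0" using norm_selfadj_square[OF nsa] by simp
  then have "m = x" by (simp add: n_def)
  with m show ?thesis by (simp add: x_def)
qed

text \<open>\<open>f\<close> is a homomorphism on \<open>S\<close> only, as will be the case on the
  fixed point algebra. For \<open>a = adj x * x\<close> there is \<open>h\<close> in
  \<open>S\<close> commuting with \<open>a\<close> such that \<open>a a + h h\<close> is the scalar
  \<open>norm a\<close> squared. Applying \<open>f\<close> and
  \<open>commuting_square_sum_norm\<close> bounds \<open>f a\<close>; the C*-identity passes to
  \<open>x\<close>.\<close>

lemma star_hom_contractive:
  fixes f :: "'a::cstar_algebra \<Rightarrow> 'b::cstar_algebra"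
  assumes f: "star_hom_on S f" and S: "closed_subalgebra S" and Sadj: "\<And>x. x \<in> S \<Longrightarrow> adj x \<in> S"
    and x: "x \<in> S"
  shows "norm (f x) \<le> norm x"
proof -
  have f_add: "f (u + v) = f u + f v" and f_mult: "f (u * v) = f u * f v" if "u \<in> S" "v \<in> S" for u v
    using f that by (auto simp: star_hom_on_def)
  have f_adj: "f (adj u) = adj (f u)" and f_scale: "f (c *\<^sub>C u) = c *\<^sub>C f u" if "u \<in> S" for u c
    using f that by (auto simp: star_hom_on_def)
  have S_mult: "u * v \<in> S" if "u \<in> S" "v \<in> S" for u v
    using S that by (auto simp: closed_subalgebra_def)
  have fof: "f (of_real r) = of_real r" for r
    using f_scale[of 1 "complex_of_real r"] f S
    by (simp add: scaleC_of_real_one star_hom_on_def closed_subalgebra_def)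
  define a where "a = adj x * x"
  have aS: "a \<in> S" using x S_mult Sadj by (simp add: a_def)
  have asa: "adj a = a" by (simp add: a_def adj_mult adj_adj)
  then have aasa: "adj (a * a) = a * a" by (simp add: adj_mult)
  define t where "t = (norm a)\<^sup>2"
  let ?T = "S \<inter> {u. u * a = a * u}"
  have "metric_pos (of_real t - a * a)"
    by (rule metric_pos_of_norm_le[OF aasa]) (simp add: t_def norm_selfadj_square asa)
  moreover have "closed_subalgebra ?T"
    using S closed_subalgebra_commutant[of a] by (auto simp: closed_subalgebra_def)
  moreover have "of_real t - a * a \<in> S"
    using S aS by (intro closed_subalgebra_diff closed_subalgebra_of_real S_mult)
  then have "of_real t - a * a \<in> ?T"
    by (simp add: algebra_simps of_real_def)
  ultimately obtain h where h: "h \<in> ?T" "metric_pos h" "h * h = of_real t - a * a"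
    using metric_pos_sqrt[of "of_real t - a * a" ?T] by blast
  have fsa: "adj (f u) = f u" if "u \<in> S" "adj u = u" for u
    using f_adj[OF that(1)] that(2) by simp
  have "norm (f a * f a) \<le> \<bar>t\<bar>"
  proof (rule commuting_square_sum_norm)
    have hh: "h \<in> S" "adj h = h" using h by (auto simp: metric_pos_def)
    then show "adj (f h) = f h" "adj (f a) = f a" using fsa aS asa by auto
    show "f a * f h = f h * f a" using f_mult[of a h] f_mult[of h a] aS hh h by simp
    have "f (a * a + h * h) = f a * f a + f h * f h"
      using aS hh by (simp add: f_add f_mult S_mult)
    then show "f a * f a + f h * f h = of_real t" by (simp add: h fof)
  qed
  then have "(norm (f a))\<^sup>2 \<le> (norm a)\<^sup>2"
    using norm_selfadj_square[OF fsa[OF aS asa]] by (simp add: t_def)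
  then have "norm (f a) \<le> norm a" by (simp add: power2_le_iff_abs_le)
  moreover have "f a = adj (f x) * f x" using x Sadj by (simp add: a_def f_mult f_adj)
  ultimately have "(norm (f x))\<^sup>2 \<le> (norm x)\<^sup>2" by (simp add: a_def cstar_identity)
  then show ?thesis by (simp add: power2_le_iff_abs_le)
qed

section \<open>States norm the selfadjoint elements\<close>

definition sublinear :: "('a::real_vector \<Rightarrow> real) \<Rightarrow> bool" where
  "sublinear p \<longleftrightarrow> (\<forall>x y. p (x + y) \<le> p x + p y) \<and> (\<forall>t>0. \<forall>x. p (t *\<^sub>R x) \<le> t * p x)"

lemma sublinear_add: "sublinear p \<Longrightarrow> p (x + y) \<le> p x + p y"
  by (simp add: sublinear_def)

lemma sublinear_zero: "sublinear p \<Longrightarrow> p 0 = 0"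
proof -
  assume p: "sublinear p"
  then have "p (t *\<^sub>R 0) \<le> t * p 0" if "t > 0" for t
    using that by (simp only: sublinear_def)
  from this[of 2] this[of "1/2"] show ?thesis by simp
qed

lemma sublinear_scale:
  assumes p: "sublinear p" and t: "0 \<le> t"
  shows "p (t *\<^sub>R x) = t * p x"
proof (cases "t = 0")
  case False
  then have t: "t > 0" using t by simp
  have "p (inverse t *\<^sub>R (t *\<^sub>R x)) \<le> inverse t * p (t *\<^sub>R x)"
    using p t unfolding sublinear_def by (metis positive_imp_inverse_positive)
  then have "t * p x \<le> p (t *\<^sub>R x)" using t by (simp add: field_simps)
  moreover have "p (t *\<^sub>R x) \<le> t * p x" using p t by (simp add: sublinear_def)
  ultimately show ?thesis by simp
qed (simp add: sublinear_zero[OF p])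

lemma sublinear_minus: "sublinear p \<Longrightarrow> - p (- x) \<le> p x"
  using sublinear_add[of p x "-x"] sublinear_zero[of p] by simp

text \<open>Covers three infima: the tangent functional, the lower bound of a chain in Zorn's lemma,
  and the derivative of the norm. The index \<open>u\<close> may depend on those already given:
  \<open>s + t\<close> in the parametric cases, the smaller functional in the chain.\<close>

lemma sublinear_INF:
  fixes g :: "'i \<Rightarrow> 'a::real_vector \<Rightarrow> real"
  assumes I: "I \<noteq> {}" and bdd: "\<And>x. bdd_below ((\<lambda>s. g s x) ` I)"
    and add: "\<And>s t x y. s \<in> I \<Longrightarrow> t \<in> I \<Longrightarrow> \<exists>u\<in>I. g u (x + y) \<le> g s x + g t y"
    and scale: "\<And>s c x. s \<in> I \<Longrightarrow> 0 < c \<Longrightarrow> \<exists>u\<in>I. g u (c *\<^sub>R x) \<le> c * g s x"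
  shows "sublinear (\<lambda>x. INF s\<in>I. g s x)"
  unfolding sublinear_def
proof (intro conjI allI impI)
  let ?q = "\<lambda>x. INF s\<in>I. g s x"
  have low: "?q x \<le> g s x" if "s \<in> I" for s x by (rule cINF_lower[OF bdd that])
  show "?q (x + y) \<le> ?q x + ?q y" for x y
  proof -
    have "?q (x + y) - g s x \<le> ?q y" if s: "s \<in> I" for s
    proof (rule cINF_greatest[OF I])
      fix t assume "t \<in> I"
      then obtain u where "u \<in> I" "g u (x + y) \<le> g s x + g t y" using add s by blast
      then show "?q (x + y) - g s x \<le> g t y" using low[of u "x + y"] by linarith
    qed
    then have "?q (x + y) - ?q y \<le> ?q x"
      by (intro cINF_greatest[OF I]) (simp add: algebra_simps)
    then show ?thesis by simp
  qed
  show "?q (c *\<^sub>R x) \<le> c * ?q x" if c: "0 < c" for c x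
  proof -
    have "?q (c *\<^sub>R x) / c \<le> ?q x"
    proof (rule cINF_greatest[OF I])
      fix s assume "s \<in> I"
      then obtain u where "u \<in> I" "g u (c *\<^sub>R x) \<le> c * g s x" using scale c by blast
      then have "?q (c *\<^sub>R x) \<le> c * g s x" using low[of u "c *\<^sub>R x"] by linarith
      then show "?q (c *\<^sub>R x) / c \<le> g s x" using c by (simp add: field_simps)
    qed
    then show ?thesis using c by (simp add: field_simps)
  qed
qed

text \<open>Here \<open>q\<close> is the directional derivative of \<open>p\<close> at \<open>y\<close>.\<close>

lemma sublinear_tangent:
  fixes p :: "'a::real_vector \<Rightarrow> real"
  assumes p: "sublinear p"
  obtains q where "sublinear q" "\<And>x. q x \<le> p x" "\<And>x. q x \<le> p (x + y) - p y"
proof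
  define g where "g t x = p (x + t *\<^sub>R y) - t * p y" for t x
  let ?q = "\<lambda>x. INF t\<in>{0..}. g t x"
  have bdd: "bdd_below ((\<lambda>t. g t x) ` {0..})" for x
  proof (rule bdd_belowI2)
    fix t :: real assume "t \<in> {0..}"
    then show "- p (- x) \<le> g t x"
      using sublinear_add[OF p, of "x + t *\<^sub>R y" "- x"] sublinear_scale[OF p, of t y]
      by (simp add: g_def)
  qed
  show "sublinear ?q"
  proof (rule sublinear_INF[OF _ bdd])
    fix s t :: real and x z assume st: "s \<in> {0..}" "t \<in> {0..}"
    have "g (s + t) (x + z) \<le> g s x + g t z"
      using sublinear_add[OF p, of "x + s *\<^sub>R y" "z + t *\<^sub>R y"] by (simp add: g_def algebra_simps)
    then show "\<exists>u\<in>{0..}. g u (x + z) \<le> g s x + g t z" using st by (intro bexI[of _ "s + t"]) auto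
  next
    fix s c :: real and x assume sc: "s \<in> {0..}" "0 < c"
    have "g (c * s) (c *\<^sub>R x) = c * g s x"
      using sublinear_scale[OF p, of c "x + s *\<^sub>R y"] sc by (simp add: g_def algebra_simps)
    then show "\<exists>u\<in>{0..}. g u (c *\<^sub>R x) \<le> c * g s x" using sc by (intro bexI[of _ "c * s"]) auto
  qed auto
  show "?q x \<le> p x" for x
    using cINF_lower[OF bdd, of 0 x] by (simp add: g_def)
  show "?q x \<le> p (x + y) - p y" for x
    using cINF_lower[OF bdd, of 1 x] by (simp add: g_def)
qed

text \<open>A minimal sublinear functional coincides with all its tangents, hence is additive.\<close>

lemma exists_linear_below_sublinear:
  fixes p :: "'a::real_vector \<Rightarrow> real"
  assumes p: "sublinear p"
  obtains f where "linear f" "\<And>x. f x \<le> p x"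
proof -
  \<comment> \<open>The order is reversed, so that Zorn's maximal element is a pointwise minimal
    sublinear functional.\<close>
  let ?A = "{q. sublinear q \<and> q \<le> p}" and ?P = "\<lambda>q r::'a \<Rightarrow> real. r \<le> q"
  have "\<exists>m\<in>?A. \<forall>a\<in>?A. ?P m a \<longrightarrow> a = m"
  proof (rule predicate_Zorn)
    show "partial_order_on ?A (relation_of ?P ?A)"
      by (auto simp: partial_order_on_def preorder_on_def refl_on_def trans_on_def antisym_on_def
          relation_of_def)
  next
    fix C assume C: "C \<in> Chains (relation_of ?P ?A)"
    then have CA: "C \<subseteq> ?A" and tot: "\<And>a b. a \<in> C \<Longrightarrow> b \<in> C \<Longrightarrow> a \<le> b \<or> b \<le> a"
      by (auto simp: Chains_def relation_of_def)
    show "\<exists>u\<in>?A. \<forall>a\<in>C. ?P a u"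
    proof (cases "C = {}")
      case True
      with p show ?thesis by auto
    next
      case False
      let ?u = "\<lambda>x. INF c\<in>C. c x"
      have bdd: "bdd_below ((\<lambda>c. c x) ` C)" for x
      proof (rule bdd_belowI2)
        fix c assume "c \<in> C"
        then have "sublinear c" "c (- x) \<le> p (- x)" using CA by (auto simp: le_fun_def)
        then show "- p (- x) \<le> c x" using sublinear_minus[of c x] by linarith
      qed
      have "sublinear ?u"
      proof (rule sublinear_INF[OF False bdd])
        fix s t x y assume st: "s \<in> C" "t \<in> C"
        show "\<exists>u\<in>C. u (x + y) \<le> s x + t y"
        proof (cases "s \<le> t")
          case True
          then have "s y \<le> t y" by (simp add: le_fun_def)
          moreover have "s (x + y) \<le> s x + s y" using st CA sublinear_add by blast
          ultimately show ?thesis using st by (intro bexI[of _ s]) auto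
        next
          case False
          then have "t \<le> s" using tot st by blast
          then have "t x \<le> s x" by (simp add: le_fun_def)
          moreover have "t (x + y) \<le> t x + t y" using st CA sublinear_add by blast
          ultimately show ?thesis using st by (intro bexI[of _ t]) auto
        qed
      next
        fix s x and c :: real assume "s \<in> C" "0 < c"
        then show "\<exists>u\<in>C. u (c *\<^sub>R x) \<le> c * s x"
          using CA by (intro bexI[of _ s]) (auto simp: sublinear_def)
      qed
      moreover have low: "?u \<le> c" if "c \<in> C" for c
        unfolding le_fun_def using cINF_lower[OF bdd that] by blast
      moreover have "?u \<le> p" using False low CA by (metis (no_types, lifting) all_not_in_conv mem_Collect_eq order_trans subsetD)
      ultimately show ?thesis by blast
    qed
  qed
  then obtain f where f: "sublinear f" "f \<le> p" and fmin: "\<And>q. sublinear q \<Longrightarrow> q \<le> f \<Longrightarrow> q = f"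
    by (auto intro: order_trans)
  have fadd: "f (x + y) = f x + f y" for x y
  proof -
    obtain q where q: "sublinear q" "\<And>x. q x \<le> f x" "\<And>x. q x \<le> f (x + y) - f y"
      using sublinear_tangent[OF f(1)] by metis
    then have "q = f" by (intro fmin) (auto simp: le_fun_def)
    with q(3)[of x] show ?thesis using sublinear_add[OF f(1), of x y] by simp
  qed
  have fneg: "f (- x) = - f x" for x
    using fadd[of x "-x"] sublinear_zero[OF f(1)] by simp
  have "f (r *\<^sub>R x) = r * f x" for r x
  proof (cases "0 \<le> r")
    case False
    then show ?thesis using sublinear_scale[OF f(1), of "-r" x] fneg[of "r *\<^sub>R x"] by simp
  qed (simp add: sublinear_scale[OF f(1)])
  then have "linear f" by (intro linearI) (auto simp: fadd)
  with f that show thesis by (auto simp: le_fun_def)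
qed

text \<open>A linear functional below the tangent \<open>q\<close> at \<open>y\<close> satisfies
  \<open>f (- y) \<le> q (- y) \<le> p 0 - p y\<close>, which forces equality at
  \<open>y\<close>.\<close>

lemma exists_linear_support:
  fixes p :: "'a::real_vector \<Rightarrow> real"
  assumes p: "sublinear p"
  obtains f where "linear f" "\<And>x. f x \<le> p x" "f y = p y"
proof -
  obtain q where q: "sublinear q" "\<And>x. q x \<le> p x" "\<And>x. q x \<le> p (x + y) - p y"
    using sublinear_tangent[OF p] by metis
  obtain f where f: "linear f" "\<And>x. f x \<le> q x"
    using exists_linear_below_sublinear[OF q(1)] by blast
  have "f (- y) \<le> - p y"
    using f(2)[of "-y"] q(3)[of "-y"] sublinear_zero[OF p] by simp
  then have "p y \<le> f y" using linear_neg[OF f(1), of y] by simp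
  moreover have le: "f x \<le> p x" for x using f(2)[of x] q(2)[of x] by simp
  ultimately show thesis using that[of f] f(1) le[of y] by (simp add: order_antisym)
qed

text \<open>The one-sided derivative of the norm at \<open>1\<close>. The real functionals it dominates are exactly the
  real parts of states, so it serves as the dominating functional in the Hahn-Banach argument.\<close>

definition norm_deriv_one :: "'a::real_normed_algebra_1 \<Rightarrow> real" where
  "norm_deriv_one x = (INF s\<in>{0..}. norm (of_real s + x) - s)"

lemma norm_deriv_one_bdd:
  "bdd_below ((\<lambda>s. norm (of_real s + (x::'a::real_normed_algebra_1)) - s) ` {0..})"
proof (rule bdd_belowI2)
  fix s :: real assume "s \<in> {0..}"
  then show "- norm x \<le> norm (of_real s + x) - s"
    using norm_triangle_ineq4[of "of_real s + x" x] by simp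
qed

lemma norm_deriv_one_le: "0 \<le> s \<Longrightarrow> norm_deriv_one x \<le> norm (of_real s + x) - s"
  unfolding norm_deriv_one_def by (rule cINF_lower[OF norm_deriv_one_bdd]) simp

lemma norm_deriv_one_less:
  assumes "norm_deriv_one x < r"
  obtains s where "0 \<le> s" "norm (of_real s + x) < s + r"
  using assms cINF_less_iff[OF _ norm_deriv_one_bdd[of x], of r] unfolding norm_deriv_one_def
  by (force simp: algebra_simps)

lemma sublinear_norm_deriv_one: "sublinear (norm_deriv_one :: 'a::real_normed_algebra_1 \<Rightarrow> real)"
  unfolding norm_deriv_one_def[abs_def]
proof (rule sublinear_INF[OF _ norm_deriv_one_bdd])
  fix s t :: real and x y :: 'a assume st: "s \<in> {0..}" "t \<in> {0..}"
  have "norm (of_real (s + t) + (x + y)) \<le> norm (of_real s + x) + norm (of_real t + y)"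
    using norm_triangle_ineq[of "of_real s + x" "of_real t + y"] by (simp add: algebra_simps)
  then show "\<exists>u\<in>{0..}. norm (of_real u + (x + y)) - u \<le> norm (of_real s + x) - s + (norm (of_real t + y) - t)"
    using st by (intro bexI[of _ "s + t"]) auto
next
  fix s c :: real and x :: 'a assume sc: "s \<in> {0..}" "0 < c"
  have "of_real (c * s) + c *\<^sub>R x = c *\<^sub>R (of_real s + x)"
    by (simp add: algebra_simps scaleR_conv_of_real)
  then have "norm (of_real (c * s) + c *\<^sub>R x) = c * norm (of_real s + x)"
    using sc by simp
  then show "\<exists>u\<in>{0..}. norm (of_real u + c *\<^sub>R x) - u \<le> c * (norm (of_real s + x) - s)"
    using sc by (intro bexI[of _ "c * s"]) (auto simp: algebra_simps)
qed auto

text \<open>If both derivatives lay below \<open>r = norm x / 4\<close>, then \<open>r + x\<close>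
  and \<open>r - x\<close> would be \<open>metric_pos\<close>, whence
  \<open>norm (r + x) \<le> 2 r\<close> and \<open>norm x \<le> 3 r\<close>. Any constant above 3
  would serve.\<close>

lemma norm_le_norm_deriv_one:
  fixes x :: "'a::cstar_algebra"
  assumes x: "adj x = x"
  shows "norm x \<le> 4 * max (norm_deriv_one x) (norm_deriv_one (- x))"
proof (rule ccontr)
  define r where "r = norm x / 4"
  assume "\<not> ?thesis"
  then have "norm_deriv_one x < r" "norm_deriv_one (- x) < r" by (auto simp: r_def)
  then obtain s1 s2 where s: "0 \<le> s1" "norm (of_real s1 + x) < s1 + r" "0 \<le> s2" "norm (of_real s2 + - x) < s2 + r"
    by (metis norm_deriv_one_less)
  define t where "t = max s1 s2"
  \<comment> \<open>\<open>norm (of_real u + y) - u\<close> does not increase with \<open>u\<close>,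
    so one parameter \<open>t\<close> serves both \<open>x\<close> and \<open>- x\<close>.\<close>
  have *: "norm (of_real t + y) \<le> t + r" if "norm (of_real u + y) < u + r" "u \<le> t" for u and y :: 'a
  proof -
    have "norm (of_real t + y) \<le> norm (of_real (t - u) :: 'a) + norm (of_real u + y)"
      using norm_triangle_ineq[of "of_real (t - u)" "of_real u + y"] by simp
    then show ?thesis using that unfolding norm_of_real by simp
  qed
  have t: "norm (of_real t + x) \<le> t + r" "norm (of_real t - x) \<le> t + r"
    using *[OF s(2)] *[OF s(4)] by (auto simp: t_def)
  have "metric_pos (of_real r + x)"
    unfolding metric_pos_def using t x by (auto simp: adj_add intro!: exI[of _ "t + r"])
  moreover have "metric_pos (of_real (2 * r) - (of_real r + x))"
  proof -
    have eq: "of_real (2 * r) - (of_real r + x) = of_real r - x"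
      unfolding of_real_add mult_2 by simp
    show ?thesis
      unfolding metric_pos_def eq using t x by (auto simp: adj_diff intro!: exI[of _ "t + r"])
  qed
  ultimately have "norm (of_real r + x) \<le> 2 * r"
    using metric_pos_bounded[of "of_real r + x" "2 * r"] by (simp add: r_def)
  moreover have "norm x \<le> norm (of_real r + x) + norm (of_real r :: 'a)"
    using norm_triangle_ineq4[of "of_real r + x" "of_real r"] by simp
  moreover have "norm (of_real r :: 'a) = r" by (simp add: r_def)
  ultimately have "norm x \<le> 3 * (norm x / 4)" by (simp only: r_def)
  then have "x = 0" by simp
  then show False
    using \<open>norm_deriv_one x < r\<close> sublinear_zero[OF sublinear_norm_deriv_one[where 'a='a]] by (simp add: r_def)
qed

lemma norm_of_real_add_ii:
  fixes x :: "'a::cstar_algebra"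
  assumes x: "adj x = x"
  shows "norm (of_real s + \<i> *\<^sub>C x) \<le> sqrt (s\<^sup>2 + (norm x)\<^sup>2)"
proof (rule real_le_rsqrt)
  have c: "of_real s * x = x * of_real s" by (simp add: of_real_def)
  have a: "adj (of_real s + \<i> *\<^sub>C x) = of_real s - \<i> *\<^sub>C x"
    by (simp add: adj_add adj_scaleC x scaleC_minus_left)
  have "adj (of_real s + \<i> *\<^sub>C x) * (of_real s + \<i> *\<^sub>C x) = of_real s * of_real s + x * x"
    unfolding a by (simp add: algebra_simps scaleC_left_mult scaleC_right_mult scaleC_scaleC
        scaleC_minus_left scaleC_diff_right scaleC_add_right c)
  then have "(norm (of_real s + \<i> *\<^sub>C x))\<^sup>2 = norm (of_real (s\<^sup>2) + x * x)"
    by (metis cstar_identity of_real_mult power2_eq_square)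
  also have "\<dots> \<le> norm (of_real (s\<^sup>2) :: 'a) + norm (x * x)" by (rule norm_triangle_ineq)
  also have "\<dots> = s\<^sup>2 + (norm x)\<^sup>2"
    using norm_selfadj_square[OF x] unfolding norm_of_real by simp
  finally show "(norm (of_real s + \<i> *\<^sub>C x))\<^sup>2 \<le> s\<^sup>2 + (norm x)\<^sup>2" .
qed

text \<open>\<open>sqrt (s^2 + norm x ^ 2) - s\<close> tends to 0 as \<open>s\<close> grows. Applied
  to \<open>x\<close> and \<open>- x\<close>, this makes every linear functional below
  \<open>norm_deriv_one\<close> vanish on \<open>\<i> *\<^sub>C x\<close>, so the complex functional
  built from it is real on selfadjoint elements.\<close>

lemma norm_deriv_one_ii:
  fixes x :: "'a::cstar_algebra"
  assumes x: "adj x = x"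
  shows "norm_deriv_one (\<i> *\<^sub>C x) \<le> 0"
proof (rule field_le_epsilon)
  fix e :: real assume e: "e > 0"
  \<comment> \<open>Chosen with \<open>s * e = norm x ^ 2\<close>, so that \<open>(s + e)^2\<close>
    exceeds \<open>s^2 + norm x ^ 2\<close>.\<close>
  define s where "s = (norm x)\<^sup>2 / e"
  have s: "s \<ge> 0" using e by (simp add: s_def)
  have "s\<^sup>2 + (norm x)\<^sup>2 \<le> (s + e)\<^sup>2"
    using e s by (simp add: power2_eq_square algebra_simps) (simp add: s_def power2_eq_square)
  then have "sqrt (s\<^sup>2 + (norm x)\<^sup>2) \<le> s + e" using e s by (intro real_le_lsqrt) auto
  then show "norm_deriv_one (\<i> *\<^sub>C x) \<le> 0 + e"
    using norm_deriv_one_le[OF s, of "\<i> *\<^sub>C x"] norm_of_real_add_ii[OF x, of s] by simp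
qed

lemma exists_norming_state:
  fixes x :: "'a::cstar_algebra"
  assumes x: "adj x = x"
  obtains \<mu> where "\<mu> \<in> state_space (UNIV :: 'a set)" "norm x \<le> 4 * cmod (\<mu> x)"
proof -
  let ?p = "norm_deriv_one :: 'a \<Rightarrow> real"
  \<comment> \<open>\<open>norm_deriv_one\<close> measures one direction only, so the functional may
    have to be supported at \<open>- x\<close>.\<close>
  obtain y where y: "y = x \<or> y = - x" "norm x \<le> 4 * ?p y"
    using norm_le_norm_deriv_one[OF x] by (metis max_def)
  obtain f where f: "linear f" "\<And>z. f z \<le> ?p z" "f y = ?p y"
    using exists_linear_support[OF sublinear_norm_deriv_one] by metis
  \<comment> \<open>The complex-linear functional with real part \<open>f\<close>.\<close>
  define \<mu> where "\<mu> z = Complex (f z) (- f (\<i> *\<^sub>C z))" for z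
  have fi: "f (\<i> *\<^sub>C z) = 0" if z: "adj z = z" for z
  proof -
    have "f (\<i> *\<^sub>C z) \<le> 0" using f(2)[of "\<i> *\<^sub>C z"] norm_deriv_one_ii[OF z] by simp
    moreover have "f (\<i> *\<^sub>C (- z)) \<le> 0"
      using f(2)[of "\<i> *\<^sub>C (- z)"] norm_deriv_one_ii[of "- z"] z by (simp add: adj_minus)
    ultimately show ?thesis by (simp add: scaleC_minus_right linear_neg[OF f(1)])
  qed
  have pos: "0 \<le> f z" if "metric_pos z" for z
  proof -
    from that obtain t where t: "norm (of_real t - z) \<le> t" by (auto simp: metric_pos_def)
    then have "0 \<le> t" using norm_ge_zero order_trans by blast
    then have "f (- z) \<le> 0" using f(2)[of "- z"] norm_deriv_one_le[of t "- z"] t by simp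
    then show ?thesis by (simp add: linear_neg[OF f(1)])
  qed
  have f1: "f 1 = 1"
  proof -
    have "f 1 \<le> 1" using f(2)[of 1] norm_deriv_one_le[of 0 "1::'a"] by simp
    moreover have "f (- 1) \<le> - 1" using f(2)[of "-1"] norm_deriv_one_le[of 1 "-1::'a"] by simp
    ultimately show ?thesis by (simp add: linear_neg[OF f(1)])
  qed
  have "\<mu> \<in> state_space UNIV"
    unfolding state_space_def
  proof (intro CollectI conjI ballI allI impI)
    show "\<mu> (u + v) = \<mu> u + \<mu> v" for u v
      by (simp add: \<mu>_def scaleC_add_right linear_add[OF f(1)] complex_eq_iff)
    show "\<mu> (c *\<^sub>C u) = c * \<mu> u" for c u
    proof -
      have scale: "f (w *\<^sub>C u) = Re w * f u + Im w * f (\<i> *\<^sub>C u)" for w u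
        unfolding scaleC_Re_Im[of w u] by (simp add: linear_add[OF f(1)] linear_scale[OF f(1)])
      have "f (\<i> *\<^sub>C (c *\<^sub>C u)) = Re (\<i> * c) * f u + Im (\<i> * c) * f (\<i> *\<^sub>C u)"
        unfolding scaleC_scaleC by (rule scale)
      then show ?thesis by (simp add: \<mu>_def complex_eq_iff scale[of c u])
    qed
    fix z :: 'a assume "positive_elt z"
    \<comment> \<open>Kaplansky's theorem enters here: \<open>state_space\<close> tests positivity
      on products \<open>adj y * y\<close>, while \<open>f\<close> is controlled on
      \<open>metric_pos\<close> elements.\<close>
    then have "metric_pos z" using metric_pos_adj_mult by (auto simp: positive_elt_def)
    then show "\<mu> z \<in> \<real>" "0 \<le> Re (\<mu> z)"
      using fi[of z] pos by (auto simp: \<mu>_def metric_pos_def complex_is_Real_iff)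
  next
    show "\<mu> 1 = 1" using f1 fi[of 1] by (simp add: \<mu>_def complex_eq_iff)
  qed auto
  moreover have "norm x \<le> 4 * cmod (\<mu> x)"
  proof -
    have "?p y \<le> \<bar>f x\<bar>" using y(1) f(3) linear_neg[OF f(1), of x] by auto
    also have "\<bar>f x\<bar> \<le> cmod (\<mu> x)" using abs_Re_le_cmod[of "\<mu> x"] by (simp add: \<mu>_def)
    finally show ?thesis using y(2) by simp
  qed
  ultimately show thesis using that by blast
qed

section \<open>Compact quantum metric spaces and total boundedness\<close>

definition operator_system :: "'a::cstar_algebra set \<Rightarrow> bool" where
  "operator_system E \<longleftrightarrow> 1 \<in> E \<and> (\<forall>x\<in>E. \<forall>y\<in>E. x + y \<in> E) \<and>
     (\<forall>c. \<forall>x\<in>E. c *\<^sub>C x \<in> E) \<and> (\<forall>x\<in>E. adj x \<in> E)"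

lemma operator_systemD:
  assumes "operator_system E"
  shows "1 \<in> E" "x \<in> E \<Longrightarrow> y \<in> E \<Longrightarrow> x + y \<in> E" "x \<in> E \<Longrightarrow> c *\<^sub>C x \<in> E" "x \<in> E \<Longrightarrow> adj x \<in> E"
    and "x \<in> E \<Longrightarrow> r *\<^sub>R x \<in> E" "x \<in> E \<Longrightarrow> - x \<in> E" "x \<in> E \<Longrightarrow> y \<in> E \<Longrightarrow> x - y \<in> E" "of_real r \<in> E" "0 \<in> E"
proof -
  show *: "1 \<in> E" "x \<in> E \<Longrightarrow> y \<in> E \<Longrightarrow> x + y \<in> E" "x \<in> E \<Longrightarrow> c *\<^sub>C x \<in> E" "x \<in> E \<Longrightarrow> adj x \<in> E" for x y c
    using assms by (auto simp: operator_system_def)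
  show R: "x \<in> E \<Longrightarrow> r *\<^sub>R x \<in> E" for r x using *(3) by (metis scaleC_of_real)
  show m: "x \<in> E \<Longrightarrow> - x \<in> E" for x using R[of x "-1"] by simp
  show "x \<in> E \<Longrightarrow> y \<in> E \<Longrightarrow> x - y \<in> E" using *(2)[of x "- y"] m by simp
  show "of_real r \<in> E" unfolding of_real_def using R *(1) by blast
  show "0 \<in> E" using R[OF *(1), of 0] by simp
qed

lemma state_spaceD:
  assumes "\<mu> \<in> state_space E"
  shows "x \<in> E \<Longrightarrow> y \<in> E \<Longrightarrow> \<mu> (x + y) = \<mu> x + \<mu> y" "x \<in> E \<Longrightarrow> \<mu> (c *\<^sub>C x) = c * \<mu> x" "\<mu> 1 = 1"
    "x \<in> E \<Longrightarrow> positive_elt x \<Longrightarrow> \<mu> x \<in> \<real> \<and> 0 \<le> Re (\<mu> x)"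
  using assms by (auto simp: state_space_def)

lemma state_scaleR: "\<mu> \<in> state_space E \<Longrightarrow> x \<in> E \<Longrightarrow> \<mu> (r *\<^sub>R x) = of_real r * \<mu> x"
  using state_spaceD(2) by (metis scaleC_of_real)

lemma state_diff:
  assumes "operator_system E" "\<mu> \<in> state_space E" "x \<in> E" "y \<in> E"
  shows "\<mu> (x - y) = \<mu> x - \<mu> y"
  using state_spaceD(1)[OF assms(2,3), of "(-1) *\<^sub>R y"] state_scaleR[OF assms(2,4), of "-1"]
    operator_systemD(6)[OF assms(1,4)] by simp

text \<open>The root \<open>h\<close> may lie outside an operator system containing
  \<open>a\<close>; \<open>state_space\<close> refers to positivity in the ambient algebra, so
  states still apply.\<close>

lemma positive_elt_of_norm_le:
  fixes a :: "'a::cstar_algebra"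
  assumes "adj a = a" "norm a \<le> t"
  shows "positive_elt (of_real t - a)"
proof -
  obtain h where "metric_pos h" "h * h = of_real t - a"
    using metric_pos_sqrt_commuting[OF metric_pos_of_norm_le[OF assms], of 1] by auto
  then show ?thesis unfolding positive_elt_def metric_pos_def by (intro exI[of _ h]) simp
qed

text \<open>Both claims come from positivity of \<open>norm x - y\<close> at \<open>y = x\<close>
  and \<open>y = - x\<close>, elements that lie in \<open>E\<close> along with
  \<open>x\<close>.\<close>

lemma state_selfadj:
  fixes x :: "'a::cstar_algebra"
  assumes E: "operator_system E" and \<mu>: "\<mu> \<in> state_space E" and x: "x \<in> E" "adj x = x"
  shows "\<mu> x \<in> \<real>" "cmod (\<mu> x) \<le> norm x"
proof -
  note D = operator_systemD[OF E]
  have *: "Im (\<mu> y) = 0 \<and> Re (\<mu> y) \<le> norm x" if y: "y \<in> E" "adj y = y" "norm y = norm x" for y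
  proof -
    have "\<mu> (of_real (norm x) - y) = of_real (norm x) - \<mu> y"
      using state_diff[OF E \<mu>, of "of_real (norm x)" y] state_scaleR[OF \<mu> D(1), of "norm x"]
        state_spaceD(3)[OF \<mu>] D(8) y by (simp add: of_real_def)
    moreover have "positive_elt (of_real (norm x) - y)"
      using y by (intro positive_elt_of_norm_le) auto
    ultimately show ?thesis
      using state_spaceD(4)[OF \<mu>, of "of_real (norm x) - y"] D(7)[OF D(8) y(1)]
      by (auto simp: complex_is_Real_iff)
  qed
  have "\<mu> (- x) = - \<mu> x" using state_scaleR[OF \<mu> x(1), of "-1"] by simp
  then have "Im (\<mu> x) = 0" "\<bar>Re (\<mu> x)\<bar> \<le> norm x"
    using *[of x] *[of "-x"] x D(6) by (auto simp: adj_minus abs_le_iff)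
  then show "\<mu> x \<in> \<real>" "cmod (\<mu> x) \<le> norm x" by (auto simp: complex_is_Real_iff cmod_eq_Re)
qed

lemma state_cartesian:
  fixes x :: "'a::cstar_algebra"
  assumes E: "operator_system E" and x: "x \<in> E"
  obtains a b where "a \<in> E" "b \<in> E" "adj a = a" "adj b = b" "norm a \<le> norm x" "norm b \<le> norm x"
    "norm x \<le> norm a + norm b"
    "\<And>\<mu>. \<mu> \<in> state_space E \<Longrightarrow> \<mu> x = \<mu> a + \<i> * \<mu> b"
proof -
  note D = operator_systemD[OF E]
  obtain a b where ab: "adj a = a" "adj b = b" "x = a + \<i> *\<^sub>C b" "norm a \<le> norm x" "norm b \<le> norm x"
    "a = (1/2) *\<^sub>R (x + adj x)" "b = (1/2) *\<^sub>R (- (\<i> *\<^sub>C (x - adj x)))"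
    by (rule cartesian_decomposition)
  have E: "a \<in> E" "b \<in> E" unfolding ab(6,7) using x D by auto
  have "norm x \<le> norm a + norm b"
    using norm_triangle_ineq[of a "\<i> *\<^sub>C b"] by (simp add: ab(3)[symmetric] norm_scaleC)
  moreover have "\<mu> x = \<mu> a + \<i> * \<mu> b" if "\<mu> \<in> state_space E" for \<mu>
    by (subst ab(3)) (use that E D in \<open>simp add: state_spaceD\<close>)
  ultimately show thesis by (rule that[OF E ab(1,2,4,5)])
qed

text \<open>The factor 2 comes from treating the two cartesian parts separately.\<close>

lemma state_bound:
  fixes x :: "'a::cstar_algebra"
  assumes E: "operator_system E" and \<mu>: "\<mu> \<in> state_space E" and x: "x \<in> E"
  shows "cmod (\<mu> x) \<le> 2 * norm x"
proof -
  obtain a b where ab: "a \<in> E" "b \<in> E" "adj a = a" "adj b = b" "norm a \<le> norm x" "norm b \<le> norm x"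
    "\<mu> x = \<mu> a + \<i> * \<mu> b"
    using state_cartesian[OF E x] \<mu> by metis
  have "cmod (\<mu> x) \<le> cmod (\<mu> a) + cmod (\<mu> b)"
    unfolding ab(7) using norm_triangle_ineq[of "\<mu> a" "\<i> * \<mu> b"] by (simp add: norm_mult)
  also have "\<dots> \<le> norm a + norm b"
    using state_selfadj(2)[OF E \<mu>] ab by (intro add_mono) auto
  finally show ?thesis using ab by simp
qed

lemma restrict_state:
  assumes E: "operator_system E" and \<mu>: "\<mu> \<in> state_space UNIV"
  shows "restrict \<mu> E \<in> state_space E"
  using operator_systemD[OF E] state_spaceD[OF \<mu>] by (auto simp: state_space_def)

lemma state_space_nonempty: "operator_system E \<Longrightarrow> state_space (E::'a::cstar_algebra set) \<noteq> {}"
  using exists_norming_state[of "1::'a"] restrict_state by (metis adj_one empty_iff)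

text \<open>The constant is 4 from \<open>exists_norming_state\<close>, doubled for the two
  cartesian parts. Norming states of the whole algebra are restricted to \<open>E\<close>.\<close>

lemma norm_le_states:
  fixes x :: "'a::cstar_algebra"
  assumes E: "operator_system E" and x: "x \<in> E"
    and d: "\<And>\<mu>. \<mu> \<in> state_space E \<Longrightarrow> cmod (\<mu> x) \<le> d"
  shows "norm x \<le> 8 * d"
proof -
  obtain a b where ab: "a \<in> E" "b \<in> E" "adj a = a" "adj b = b" "norm x \<le> norm a + norm b"
    and \<mu>x: "\<And>\<mu>. \<mu> \<in> state_space E \<Longrightarrow> \<mu> x = \<mu> a + \<i> * \<mu> b"
    using state_cartesian[OF E x] by metis
  have *: "norm y \<le> 4 * d" if y: "y \<in> E" "adj y = y" "y = a \<or> y = b" for y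
  proof -
    obtain \<mu> where \<mu>: "\<mu> \<in> state_space (UNIV::'a set)" "norm y \<le> 4 * cmod (\<mu> y)"
      using exists_norming_state[OF y(2)] by metis
    let ?\<mu> = "restrict \<mu> E"
    have S: "?\<mu> \<in> state_space E" by (rule restrict_state[OF E \<mu>(1)])
    \<comment> \<open>States are real on selfadjoint elements, so the values at \<open>a\<close> and
      \<open>b\<close> are the real and imaginary parts of the value at \<open>x\<close>.\<close>
    have "Im (?\<mu> a) = 0" "Im (?\<mu> b) = 0"
      using state_selfadj(1)[OF E S] ab by (auto simp only: complex_is_Real_iff)
    then have "cmod (?\<mu> y) \<le> cmod (?\<mu> x)"
      unfolding \<mu>x[OF S] using y(3) abs_Re_le_cmod[of "?\<mu> a + \<i> * ?\<mu> b"]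
        abs_Im_le_cmod[of "?\<mu> a + \<i> * ?\<mu> b"] by (auto simp: cmod_eq_Re)
    then show ?thesis using \<mu>(2) d[OF S] y(1) by simp
  qed
  show ?thesis using *[of a] *[of b] ab by simp
qed

section \<open>The weak* topology on the state space\<close>

text \<open>Asking for all smaller \<open>s\<close> in the hypothesis lets the condition pass to the
  minimum of finitely many radii.\<close>

lemma finite_uniform_radius:
  assumes "finite F" "\<And>x. x \<in> F \<Longrightarrow> \<exists>r>0. \<forall>s\<le>r. P x (s::real)"
  shows "\<exists>r>0. \<forall>x\<in>F. P x r"
proof -
  have "\<exists>r>0. \<forall>x\<in>F. \<forall>s\<le>r. P x s"
    using assms
  proof (induction F rule: finite_induct)
    case empty
    then show ?case by (auto intro: exI[of _ 1])
  next
    case (insert x F)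
    then obtain r q where "r > 0" "\<forall>x\<in>F. \<forall>s\<le>r. P x s" "q > 0" "\<forall>s\<le>q. P x s"
      by (metis insertCI)
    then show ?case by (intro exI[of _ "min r q"]) auto
  qed
  then show ?thesis by blast
qed

lemma openin_weak_star_iff:
  "openin (weak_star_topology E) U \<longleftrightarrow> U \<subseteq> state_space E \<and>
     (\<forall>\<mu>\<in>U. \<exists>F r. finite F \<and> F \<subseteq> E \<and> r > 0 \<and>
        (\<forall>\<nu>\<in>state_space E. (\<forall>x\<in>F. cmod (\<mu> x - \<nu> x) < r) \<longrightarrow> \<nu> \<in> U))"
    (is "?l \<longleftrightarrow> ?r")
proof
  assume ?l
  then obtain T where T: "openin (product_topology (\<lambda>_. euclidean) E) T" and U: "U = T \<inter> state_space E"
    unfolding weak_star_topology_def openin_subtopology by blast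
  show ?r
  proof (intro conjI ballI)
    fix \<mu> assume "\<mu> \<in> U"
    then obtain W where W: "finite {i \<in> E. W i \<noteq> UNIV}" "\<And>i. i \<in> E \<Longrightarrow> open (W i)"
      "\<mu> \<in> Pi\<^sub>E E W" "Pi\<^sub>E E W \<subseteq> T"
      using T unfolding U openin_product_topology_alt by (auto simp del: PiE_iff)
    let ?F = "{i \<in> E. W i \<noteq> UNIV}"
    have "\<exists>r>0. \<forall>x\<in>?F. \<forall>z. cmod (\<mu> x - z) < r \<longrightarrow> z \<in> W x"
    proof (rule finite_uniform_radius[OF W(1)])
      fix x assume x: "x \<in> ?F"
      then have "\<mu> x \<in> W x" "open (W x)" using W by auto
      then obtain r where "r > 0" "ball (\<mu> x) r \<subseteq> W x" using openE by blast
      then show "\<exists>r>0. \<forall>s\<le>r. \<forall>z. cmod (\<mu> x - z) < s \<longrightarrow> z \<in> W x"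
        by (intro exI[of _ r]) (auto simp: dist_norm)
    qed
    then obtain r where r: "r > 0" "\<And>x z. x \<in> ?F \<Longrightarrow> cmod (\<mu> x - z) < r \<Longrightarrow> z \<in> W x" by blast
    have "\<nu> \<in> U" if \<nu>: "\<nu> \<in> state_space E" "\<forall>x\<in>?F. cmod (\<mu> x - \<nu> x) < r" for \<nu>
    proof -
      have "\<nu> x \<in> W x" if "x \<in> E" for x
        using r(2)[of x "\<nu> x"] \<nu>(2) that by (cases "W x = UNIV") auto
      moreover have "\<nu> \<in> extensional E" using \<nu>(1) by (simp add: state_space_def)
      ultimately have "\<nu> \<in> Pi\<^sub>E E W" by (simp add: PiE_iff)
      then show ?thesis using W(4) \<nu>(1) U by blast
    qed
    then show "\<exists>F r. finite F \<and> F \<subseteq> E \<and> r > 0 \<and>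
        (\<forall>\<nu>\<in>state_space E. (\<forall>x\<in>F. cmod (\<mu> x - \<nu> x) < r) \<longrightarrow> \<nu> \<in> U)"
      using W(1) r(1) by (intro exI[of _ ?F] exI[of _ r]) auto
  qed (simp add: U)
next
  assume R: ?r
  show ?l
  proof (subst openin_subopen, intro ballI)
    fix \<mu> assume \<mu>: "\<mu> \<in> U"
    with R obtain F r where F: "finite F" "F \<subseteq> E" "r > 0"
      "\<And>\<nu>. \<nu> \<in> state_space E \<Longrightarrow> (\<forall>x\<in>F. cmod (\<mu> x - \<nu> x) < r) \<Longrightarrow> \<nu> \<in> U"
      by metis
    let ?W = "\<lambda>x. if x \<in> F then ball (\<mu> x) r else UNIV"
    let ?T = "Pi\<^sub>E E ?W \<inter> state_space E"
    have "{i \<in> E. ?W i \<noteq> UNIV} \<subseteq> F" by auto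
    then have "finite {i \<in> E. ?W i \<noteq> UNIV}" using F(1) finite_subset by blast
    then have "openin (product_topology (\<lambda>_. euclidean) E) (Pi\<^sub>E E ?W)"
      unfolding openin_PiE_gen by auto
    then have "openin (weak_star_topology E) ?T"
      unfolding weak_star_topology_def openin_subtopology by blast
    moreover have "\<mu> \<in> ?T" using R \<mu> F(3) by (auto simp: PiE_iff state_space_def)
    moreover have "?T \<subseteq> U"
    proof
      fix \<nu> assume \<nu>: "\<nu> \<in> ?T"
      then have "cmod (\<mu> x - \<nu> x) < r" if "x \<in> F" for x
        using PiE_mem[of \<nu> E ?W x] that F(2) by (auto simp: dist_norm)
      then show "\<nu> \<in> U" using F(4) \<nu> by blast
    qed
    ultimately show "\<exists>T. openin (weak_star_topology E) T \<and> \<mu> \<in> T \<and> T \<subseteq> U" by blast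
  qed
qed

lemma weak_star_neighbourhood:
  assumes "openin (weak_star_topology E) U" "\<mu> \<in> U"
  obtains F r where "finite F" "F \<subseteq> E" "r > 0"
    "\<forall>\<nu>\<in>state_space E. (\<forall>x\<in>F. cmod (\<mu> x - \<nu> x) < r) \<longrightarrow> \<nu> \<in> U"
proof -
  have "\<forall>\<mu>\<in>U. \<exists>F r. finite F \<and> F \<subseteq> E \<and> r > 0 \<and>
        (\<forall>\<nu>\<in>state_space E. (\<forall>x\<in>F. cmod (\<mu> x - \<nu> x) < r) \<longrightarrow> \<nu> \<in> U)"
    using assms(1) unfolding openin_weak_star_iff by (rule conjunct2)
  from bspec[OF this assms(2)] show thesis by (elim exE conjE) (rule that)
qed

lemma topspace_weak_star: "topspace (weak_star_topology E) = state_space E"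
  by (auto simp: weak_star_topology_def state_space_def dest: extensional_arb)

text \<open>Banach-Alaoglu by way of Tychonoff: \<open>state_bound\<close> places the states in a
  product of discs, and each defining condition involves finitely many evaluations, hence is
  closed.\<close>

lemma compact_space_weak_star:
  fixes E :: "'a::cstar_algebra set"
  assumes E: "operator_system E"
  shows "compact_space (weak_star_topology E)"
proof -
  let ?X = "product_topology (\<lambda>_. euclidean) E :: ('a \<Rightarrow> complex) topology"
  let ?K = "Pi\<^sub>E E (\<lambda>x. cball 0 (2 * norm x)) :: ('a \<Rightarrow> complex) set"
  note D = operator_systemD[OF E]
  have "compactin ?X ?K" by (simp add: compactin_PiE)
  moreover have "state_space E \<subseteq> ?K"
  proof
    fix \<mu> assume \<mu>: "\<mu> \<in> state_space E"
    then have "\<mu> \<in> extensional E" by (simp add: state_space_def)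
    then show "\<mu> \<in> ?K" using state_bound[OF E \<mu>] by (simp add: PiE_iff)
  qed
  moreover have "closedin ?X (state_space E)"
  proof -
    have pr: "continuous_map ?X euclidean (\<lambda>\<mu>. \<mu> x)" if "x \<in> E" for x
      using continuous_map_product_projection[OF that, of "\<lambda>_. euclidean"] .
    have cl: "closedin ?X {\<mu> \<in> topspace ?X. f \<mu> \<in> C}" if "continuous_map ?X euclidean f" "closed C"
      for f :: "('a \<Rightarrow> complex) \<Rightarrow> complex" and C
      using that by (intro closedin_continuous_map_preimage[of _ euclidean]) auto
    define A where "A x y = {\<mu> \<in> topspace ?X. \<mu> (x + y) - (\<mu> x + \<mu> y) \<in> {0}}" for x y
    define B where "B c x = {\<mu> \<in> topspace ?X. \<mu> (c *\<^sub>C x) - c * \<mu> x \<in> {0}}" for c x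
    define P where "P x = {\<mu> \<in> topspace ?X. \<mu> x \<in> {z. z \<in> \<real> \<and> 0 \<le> Re z}}" for x
    define N where "N = {\<mu> \<in> topspace ?X. \<mu> 1 - 1 \<in> {0}}"
    have "closedin ?X (A x y)" if "x \<in> E" "y \<in> E" for x y
      unfolding A_def using that D by (intro cl continuous_map_diff continuous_map_add pr) auto
    moreover have "closedin ?X (B c x)" if "x \<in> E" for c x
      unfolding B_def
    proof (rule cl)
      have "continuous_map ?X euclidean ((\<lambda>z. c * z) \<circ> (\<lambda>\<mu>. \<mu> x))"
        using pr[OF that] by (rule continuous_map_compose) (auto intro!: continuous_intros)
      then show "continuous_map ?X euclidean (\<lambda>\<mu>. \<mu> (c *\<^sub>C x) - c * \<mu> x)"
        using that D by (intro continuous_map_diff pr) (auto simp: o_def)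
    qed simp
    moreover have "closedin ?X (P x)" if "x \<in> E" for x
      unfolding P_def
    proof (rule cl[OF pr[OF that]])
      have "closed {z. Im z = 0}" "closed {z. 0 \<le> Re z}"
        by (auto intro!: closed_Collect_eq closed_Collect_le continuous_intros)
      then show "closed {z. z \<in> \<real> \<and> 0 \<le> Re z}"
        unfolding complex_is_Real_iff Collect_conj_eq by (rule closed_Int)
    qed
    moreover have "closedin ?X N"
      unfolding N_def using D(1) by (intro cl continuous_map_diff pr) auto
    ultimately have "closedin ?X (\<Inter> ({N} \<union> {A x y |x y. x \<in> E \<and> y \<in> E} \<union> {B c x |c x. x \<in> E} \<union>
        {P x |x. x \<in> E \<and> positive_elt x}))" (is "closedin ?X ?I")
      by (intro closedin_Inter) auto
    moreover have "?I = state_space E"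
    proof (intro equalityI subsetI)
      fix \<mu> assume \<mu>: "\<mu> \<in> ?I"
      have N: "\<mu> \<in> N" by (rule InterD[OF \<mu>]) simp
      have A: "\<mu> \<in> A x y" if "x \<in> E" "y \<in> E" for x y by (rule InterD[OF \<mu>]) (use that in blast)
      have B: "\<mu> \<in> B c x" if "x \<in> E" for c x by (rule InterD[OF \<mu>]) (use that in blast)
      have P: "\<mu> \<in> P x" if "x \<in> E" "positive_elt x" for x
        by (rule InterD[OF \<mu>]) (use that in blast)
      show "\<mu> \<in> state_space E"
        unfolding state_space_def
      proof (intro CollectI conjI ballI allI impI)
        show "\<mu> \<in> extensional E" "\<mu> 1 = 1" using N by (simp_all add: N_def PiE_iff)
      qed (use A B P in \<open>simp_all add: A_def B_def P_def\<close>)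
    next
      fix \<mu> assume \<mu>: "\<mu> \<in> state_space E"
      then have "\<mu> \<in> extensional E" by (simp add: state_space_def)
      then have top: "\<mu> \<in> topspace ?X" by (simp add: PiE_iff)
      have "\<mu> \<in> N" "x \<in> E \<Longrightarrow> y \<in> E \<Longrightarrow> \<mu> \<in> A x y" "x \<in> E \<Longrightarrow> \<mu> \<in> B c x"
        "x \<in> E \<Longrightarrow> positive_elt x \<Longrightarrow> \<mu> \<in> P x" for x y c
        unfolding N_def A_def B_def P_def using top state_spaceD[OF \<mu>] by simp_all
      then show "\<mu> \<in> ?I" by (intro InterI) (elim UnE, auto)
    qed
    ultimately show ?thesis by simp
  qed
  ultimately have "compactin ?X (state_space E)" by (meson closed_compactin)
  then show ?thesis unfolding weak_star_topology_def by (rule compact_space_subtopology)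
qed

text \<open>A supremum below \<open>r\<close> leaves a gap; pointwise strict inequalities would not,
  hence the uniform bound \<open>q\<close>.\<close>

lemma dist_L_less_iff:
  "dist_L E L \<mu> \<nu> < ereal r \<longleftrightarrow> (\<exists>q<r. \<forall>x\<in>E. L x \<le> 1 \<longrightarrow> cmod (\<mu> x - \<nu> x) \<le> q)"
proof -
  have le: "dist_L E L \<mu> \<nu> \<le> ereal q \<longleftrightarrow> (\<forall>x\<in>E. L x \<le> 1 \<longrightarrow> cmod (\<mu> x - \<nu> x) \<le> q)" for q
    unfolding dist_L_def Sup_le_iff by auto
  show ?thesis
  proof
    assume "dist_L E L \<mu> \<nu> < ereal r"
    then obtain q where "dist_L E L \<mu> \<nu> < ereal q" "ereal q < ereal r"
      using ereal_dense2 by blast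
    then show "\<exists>q<r. \<forall>x\<in>E. L x \<le> 1 \<longrightarrow> cmod (\<mu> x - \<nu> x) \<le> q"
      using le[of q] by (intro exI[of _ q]) auto
  next
    assume "\<exists>q<r. \<forall>x\<in>E. L x \<le> 1 \<longrightarrow> cmod (\<mu> x - \<nu> x) \<le> q"
    then obtain q where "q < r" "dist_L E L \<mu> \<nu> \<le> ereal q" using le by blast
    then show "dist_L E L \<mu> \<nu> < ereal r" by (metis less_ereal.simps(1) order_le_less_trans)
  qed
qed

section \<open>Total boundedness of the Lipschitz ball\<close>

text \<open>\<open>V\<close> will be \<open>scalars\<close> or \<open>{0}\<close>; the latter gives
  ordinary total boundedness. The centres \<open>F\<close> may lie outside \<open>X\<close>.\<close>

definition totally_bounded_mod :: "'a::real_normed_vector set \<Rightarrow> 'a set \<Rightarrow> bool" where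
  "totally_bounded_mod V X \<longleftrightarrow>
     (\<forall>e>0. \<exists>F. finite F \<and> (\<forall>x\<in>X. \<exists>y\<in>F. \<exists>v\<in>V. norm (x - y - v) < e))"

definition scalars :: "'a::cstar_algebra set" where
  "scalars = range (\<lambda>c. c *\<^sub>C 1)"

lemma totally_bounded_mod_inner:
  assumes X: "totally_bounded_mod V X" and V: "\<And>u v. u \<in> V \<Longrightarrow> v \<in> V \<Longrightarrow> u - v \<in> V" and e: "e > 0"
  obtains F where "finite F" "F \<subseteq> X" "\<And>x. x \<in> X \<Longrightarrow> \<exists>y\<in>F. \<exists>v\<in>V. norm (x - y - v) < e"
proof -
  obtain G where G: "finite G" "\<And>x. x \<in> X \<Longrightarrow> \<exists>y\<in>G. \<exists>v\<in>V. norm (x - y - v) < e / 2"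
    using X e unfolding totally_bounded_mod_def by (metis half_gt_zero)
  define near where "near x y \<longleftrightarrow> (\<exists>v\<in>V. norm (x - y - v) < e / 2)" for x y
  define pick where "pick y = (SOME x. x \<in> X \<and> near x y)" for y
  have pick: "pick y \<in> X \<and> near (pick y) y" if "x \<in> X" "near x y" for x y
    unfolding pick_def by (rule someI[of _ x]) (use that in auto)
  let ?F = "pick ` {y \<in> G. \<exists>x\<in>X. near x y}"
  show thesis
  proof (rule that[of ?F])
    show "finite ?F" using G by simp
    show "?F \<subseteq> X" using pick by blast
    fix x assume x: "x \<in> X"
    then obtain y where y: "y \<in> G" "near x y" using G(2) near_def by blast
    then have p: "near (pick y) y" using pick x by blast
    obtain u v where uv: "u \<in> V" "v \<in> V" "norm (x - y - u) < e / 2" "norm (pick y - y - v) < e / 2"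
      using y p by (auto simp: near_def)
    have "norm (x - pick y - (u - v)) = norm ((x - y - u) - (pick y - y - v))"
      by (simp add: algebra_simps)
    also have "\<dots> \<le> norm (x - y - u) + norm (pick y - y - v)" by (rule norm_triangle_ineq4)
    also have "\<dots> < e" using uv by simp
    finally show "\<exists>y\<in>?F. \<exists>v\<in>V. norm (x - y - v) < e" using x y V[OF uv(1,2)] by blast
  qed
qed

lemma scalars_diff: "u \<in> scalars \<Longrightarrow> v \<in> scalars \<Longrightarrow> u - v \<in> scalars"
  unfolding scalars_def by (auto simp flip: scaleC_diff_left)

text \<open>All states agree on scalars, so weak* closeness on a finite net of the
  \<open>L\<close>-ball controls the metric on the whole ball. The other comparison of topologies
  rests on \<open>L\<close> being a finite-valued seminorm.\<close>

lemma compact_qms_if_totally_bounded: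
  fixes E :: "'a::cstar_algebra set"
  assumes E: "operator_system E" and L: "slip_norm E L"
    and tb: "totally_bounded_mod scalars {x \<in> E. L x \<le> 1}"
  shows "compact_qms E L"
  unfolding compact_qms_def
proof (intro allI iffI)
  note D = operator_systemD[OF E]
  fix U assume U: "openin (weak_star_topology E) U"
  show "dist_L_open E L U"
    unfolding dist_L_open_def
  proof (intro conjI ballI)
    show "U \<subseteq> state_space E" using U openin_weak_star_iff by blast
    fix \<mu> assume \<mu>: "\<mu> \<in> U"
    obtain F r where F: "finite F" "F \<subseteq> E" "r > 0"
      "\<forall>\<nu>\<in>state_space E. (\<forall>x\<in>F. cmod (\<mu> x - \<nu> x) < r) \<longrightarrow> \<nu> \<in> U"
      by (rule weak_star_neighbourhood[OF U \<mu>])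
    have \<mu>S: "\<mu> \<in> state_space E" using U \<mu> openin_weak_star_iff by blast
    \<comment> \<open>\<open>x / (L x + 1)\<close> lies in the unit ball of \<open>L\<close> even
      when \<open>L x = 0\<close>; the factor \<open>L x + 1\<close> reappears when the estimate
      returns to \<open>x\<close>.\<close>
    have "\<exists>s>0. \<forall>x\<in>F. s * (L x + 1) \<le> r"
    proof (rule finite_uniform_radius[OF F(1)])
      fix x assume "x \<in> F"
      then have p: "L x + 1 > 0" using F L by (auto simp: slip_norm_def add_nonneg_pos)
      then show "\<exists>s>0. \<forall>t\<le>s. t * (L x + 1) \<le> r"
        using F(3) by (intro exI[of _ "r / (L x + 1)"]) (auto simp: pos_le_divide_eq)
    qed
    then obtain s where s: "s > 0" "\<And>x. x \<in> F \<Longrightarrow> s * (L x + 1) \<le> r" by blast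
    have "\<nu> \<in> U" if \<nu>: "\<nu> \<in> state_space E" "dist_L E L \<mu> \<nu> < ereal s" for \<nu>
    proof (rule F(4)[rule_format, OF \<nu>(1)])
      fix x assume x: "x \<in> F"
      then have xE: "x \<in> E" using F by blast
      then have p: "L x + 1 > 0" using L by (auto simp: slip_norm_def add_nonneg_pos)
      define y where "y = (1 / (L x + 1)) *\<^sub>R x"
      have yE: "y \<in> E" unfolding y_def using xE D by simp
      have "L y = (1 / (L x + 1)) * L x"
      proof -
        have "L (complex_of_real (1 / (L x + 1)) *\<^sub>C x) = cmod (complex_of_real (1 / (L x + 1))) * L x"
          using L xE by (simp only: slip_norm_def)
        then show ?thesis using p unfolding scaleC_of_real y_def[symmetric] norm_of_real by simp
      qed
      then have "L y \<le> 1" using p by simp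
      then have "cmod (\<mu> y - \<nu> y) < s"
        using \<nu>(2) yE unfolding dist_L_less_iff by fastforce
      moreover have "cmod (\<mu> y - \<nu> y) = (1 / (L x + 1)) * cmod (\<mu> x - \<nu> x)"
      proof -
        have eq: "\<mu> y - \<nu> y = of_real (1 / (L x + 1)) * (\<mu> x - \<nu> x)"
          unfolding y_def state_scaleR[OF \<mu>S xE] state_scaleR[OF \<nu>(1) xE] by (simp only: right_diff_distrib)
        show ?thesis unfolding eq norm_mult norm_of_real using p by simp
      qed
      ultimately have "cmod (\<mu> x - \<nu> x) < s * (L x + 1)" using p by (simp add: field_simps)
      then show "cmod (\<mu> x - \<nu> x) < r" using s(2)[OF x] by simp
    qed
    then show "\<exists>r>0. \<forall>\<nu>\<in>state_space E. dist_L E L \<mu> \<nu> < ereal r \<longrightarrow> \<nu> \<in> U"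
      using s(1) by blast
  qed
next
  note D = operator_systemD[OF E]
  fix U assume U: "dist_L_open E L U"
  show "openin (weak_star_topology E) U"
    unfolding openin_weak_star_iff
  proof (intro conjI ballI)
    show US: "U \<subseteq> state_space E" using U by (simp add: dist_L_open_def)
    fix \<mu> assume \<mu>: "\<mu> \<in> U"
    then obtain r where r: "r > 0" "\<And>\<nu>. \<nu> \<in> state_space E \<Longrightarrow> dist_L E L \<mu> \<nu> < ereal r \<Longrightarrow> \<nu> \<in> U"
      using U by (auto simp: dist_L_open_def)
    \<comment> \<open>Net accuracy \<open>r / 8\<close>, doubled by \<open>state_bound\<close>,
      costs \<open>r / 4\<close> for each of the two states; the net points contribute another
      \<open>r / 4\<close>.\<close>
    obtain F where F: "finite F" "F \<subseteq> {x \<in> E. L x \<le> 1}"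
      "\<And>x. x \<in> {x \<in> E. L x \<le> 1} \<Longrightarrow> \<exists>y\<in>F. \<exists>v\<in>scalars. norm (x - y - v) < r / 8"
      using totally_bounded_mod_inner[OF tb scalars_diff, of "r / 8"] r(1) by auto
    have "\<nu> \<in> U" if \<nu>: "\<nu> \<in> state_space E" "\<forall>x\<in>F. cmod (\<mu> x - \<nu> x) < r / 4" for \<nu>
    proof (rule r(2)[OF \<nu>(1)], unfold dist_L_less_iff, intro exI[of _ "3/4 * r"] conjI ballI impI)
      fix x assume x: "x \<in> E" "L x \<le> 1"
      then obtain y c where y: "y \<in> F" "norm (x - y - c *\<^sub>C 1) < r / 8"
        using F(3)[of x] by (auto simp: scalars_def)
      define z where "z = x - y - c *\<^sub>C 1"
      have yE: "y \<in> E" using y F by auto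
      then have zE: "z \<in> E" unfolding z_def using x D by simp
      have ev: "\<rho> x = \<rho> z + \<rho> y + c" if \<rho>: "\<rho> \<in> state_space E" for \<rho>
      proof -
        have "x = (z + y) + c *\<^sub>C 1" by (simp add: z_def)
        then have "\<rho> x = \<rho> (z + y) + \<rho> (c *\<^sub>C 1)"
          using state_spaceD(1)[OF \<rho>, of "z + y" "c *\<^sub>C 1"] zE yE D by metis
        then show ?thesis
          using state_spaceD(1)[OF \<rho> zE yE] state_spaceD(2)[OF \<rho> D(1), of c] state_spaceD(3)[OF \<rho>] by simp
      qed
      have \<mu>S: "\<mu> \<in> state_space E" using \<mu> US by blast
      have eq: "\<mu> x - \<nu> x = \<mu> z - \<nu> z + (\<mu> y - \<nu> y)" using ev[OF \<mu>S] ev[OF \<nu>(1)] by simp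
      have "cmod (\<mu> x - \<nu> x) \<le> cmod (\<mu> z) + cmod (\<nu> z) + cmod (\<mu> y - \<nu> y)"
        unfolding eq by (rule order_trans[OF norm_triangle_ineq add_right_mono[OF norm_triangle_ineq4]])
      also have "\<dots> \<le> 2 * (r / 8) + 2 * (r / 8) + r / 4"
        using state_bound[OF E \<mu>S zE] state_bound[OF E \<nu>(1) zE] y \<nu>(2)
        by (intro add_mono) (auto simp: z_def)
      finally show "cmod (\<mu> x - \<nu> x) \<le> 3/4 * r" by simp
    qed (use r in simp)
    then show "\<exists>F r. finite F \<and> F \<subseteq> E \<and> r > 0 \<and>
        (\<forall>\<nu>\<in>state_space E. (\<forall>x\<in>F. cmod (\<mu> x - \<nu> x) < r) \<longrightarrow> \<nu> \<in> U)"
      using F(1,2) r(1) by (intro exI[of _ F] exI[of _ "r / 4"]) auto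
  qed
qed

text \<open>Moving from \<open>\<mu>\<close> a short way along the segment towards \<open>\<nu>\<close> stays inside a weak* neighbourhood, hence inside the unit ball of the metric.\<close>

lemma dist_L_bounded_if_ball_open:
  assumes E: "operator_system E"
    and ball: "openin (weak_star_topology E) {\<rho> \<in> state_space E. dist_L E L \<mu> \<rho> < ereal 1}"
    and \<mu>S: "\<mu> \<in> state_space E" and \<nu>: "\<nu> \<in> state_space E"
  obtains d where "\<And>x. x \<in> E \<Longrightarrow> L x \<le> 1 \<Longrightarrow> cmod (\<mu> x - \<nu> x) \<le> d"
proof -
  note D = operator_systemD[OF E]
  let ?B = "{\<rho> \<in> state_space E. dist_L E L \<mu> \<rho> < ereal 1}"
  have \<mu>: "\<mu> \<in> ?B" using \<mu>S by (auto simp: dist_L_less_iff intro!: exI[of _ 0])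
  obtain F r where F: "finite F" "F \<subseteq> E" "r > 0"
    "\<forall>\<rho>\<in>state_space E. (\<forall>x\<in>F. cmod (\<mu> x - \<rho> x) < r) \<longrightarrow> \<rho> \<in> ?B"
    by (rule weak_star_neighbourhood[OF ball \<mu>])
  \<comment> \<open>The extra point 0 secures \<open>t \<le> 1\<close> when \<open>F\<close> is
    empty.\<close>
  have "\<exists>t>0. \<forall>x\<in>insert 0 F. t * cmod (\<mu> x - \<nu> x) < r \<and> t \<le> 1"
  proof (rule finite_uniform_radius)
    fix x
    define m where "m = cmod (\<mu> x - \<nu> x) + 1"
    have m: "m > 0" by (simp add: m_def add_nonneg_pos)
    have "t * cmod (\<mu> x - \<nu> x) < r \<and> t \<le> 1" if t: "t \<le> min 1 (r / m / 2)" for t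
    proof -
      have "t * cmod (\<mu> x - \<nu> x) \<le> r / m / 2 * cmod (\<mu> x - \<nu> x)"
        using t by (intro mult_right_mono) auto
      also have "\<dots> \<le> r / m / 2 * m" using F(3) m by (intro mult_left_mono) (auto simp: m_def)
      also have "\<dots> < r" using F(3) m by simp
      finally show ?thesis using t by simp
    qed
    then show "\<exists>s>0. \<forall>t\<le>s. t * cmod (\<mu> x - \<nu> x) < r \<and> t \<le> 1"
      using F(3) m by (intro exI[of _ "min 1 (r / m / 2)"]) auto
  qed (use F in simp)
  then obtain t where t: "t > 0" "t \<le> 1" "\<And>x. x \<in> F \<Longrightarrow> t * cmod (\<mu> x - \<nu> x) < r" by auto
  define \<rho> where "\<rho> = (\<lambda>x\<in>E. (1 - of_real t) * \<mu> x + of_real t * \<nu> x)"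
  have \<rho>S: "\<rho> \<in> state_space E"
    unfolding state_space_def
  proof (intro CollectI conjI ballI allI impI)
    fix x assume "x \<in> E" "positive_elt x"
    then have "\<mu> x \<in> \<real> \<and> 0 \<le> Re (\<mu> x)" "\<nu> x \<in> \<real> \<and> 0 \<le> Re (\<nu> x)"
      using state_spaceD(4) \<mu>S \<nu> by blast+
    then show "\<rho> x \<in> \<real>" "0 \<le> Re (\<rho> x)"
      using t \<open>x \<in> E\<close> by (auto simp: \<rho>_def complex_is_Real_iff)
  next
    fix x y assume "x \<in> E" "y \<in> E"
    then show "\<rho> (x + y) = \<rho> x + \<rho> y"
      using D(2)[of x y] state_spaceD(1)[OF \<mu>S, of x y] state_spaceD(1)[OF \<nu>, of x y]
      by (simp add: \<rho>_def algebra_simps)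
  next
    fix c x assume "x \<in> E"
    then show "\<rho> (c *\<^sub>C x) = c * \<rho> x"
      using D(3)[of x c] state_spaceD(2)[OF \<mu>S, of x c] state_spaceD(2)[OF \<nu>, of x c]
      by (simp add: \<rho>_def algebra_simps)
  qed (use D(1) state_spaceD(3)[OF \<mu>S] state_spaceD(3)[OF \<nu>] in \<open>auto simp: \<rho>_def\<close>)
  have diff: "cmod (\<mu> x - \<rho> x) = t * cmod (\<mu> x - \<nu> x)" if "x \<in> E" for x
  proof -
    have "\<mu> x - \<rho> x = of_real t * (\<mu> x - \<nu> x)" using that by (simp add: \<rho>_def algebra_simps)
    then show ?thesis using t by (simp add: norm_mult)
  qed
  have "\<rho> \<in> ?B" using F(2) t(3) diff by (intro F(4)[rule_format, OF \<rho>S]) (auto simp: subset_iff)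
  then obtain q where "\<And>x. x \<in> E \<Longrightarrow> L x \<le> 1 \<Longrightarrow> cmod (\<mu> x - \<rho> x) \<le> q"
    by (auto simp: dist_L_less_iff)
  then have "cmod (\<mu> x - \<nu> x) \<le> q / t" if "x \<in> E" "L x \<le> 1" for x
    using that diff t(1) by (simp add: field_simps)
  then show thesis using that by blast
qed

text \<open>Weak* compactness gives finitely many states \<open>M\<close> approximating every state
  within \<open>\<delta>\<close> in the metric. An element \<open>x\<close> is coded by the
  differences \<open>\<mu>0 x - \<mu> x\<close> on \<open>M\<close>, rounded to multiples of
  \<open>\<delta>\<close>; equal codes mean equality up to a scalar and a small error. Finite
  distances leave only finitely many codes.\<close>

lemma totally_bounded_if_compact_qms:
  fixes E :: "'a::cstar_algebra set"
  assumes E: "operator_system E" and q: "compact_qms E L"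
  shows "totally_bounded_mod scalars {x \<in> E. L x \<le> 1}" (is "totally_bounded_mod _ ?X")
  unfolding totally_bounded_mod_def
proof (intro allI impI)
  note D = operator_systemD[OF E]
  define B where "B \<mu> d = {\<rho> \<in> state_space E. dist_L E L \<mu> \<rho> < ereal d}" for \<mu> d
  have Bopen: "openin (weak_star_topology E) (B \<mu> d)" for \<mu> d
  proof -
    have "dist_L_open E L (B \<mu> d)"
      unfolding dist_L_open_def
    proof (intro conjI ballI)
      fix \<rho> assume "\<rho> \<in> B \<mu> d"
      then obtain p where p: "p < d" "\<And>x. x \<in> E \<Longrightarrow> L x \<le> 1 \<Longrightarrow> cmod (\<mu> x - \<rho> x) \<le> p"
        unfolding B_def dist_L_less_iff by blast
      have "\<nu> \<in> B \<mu> d" if \<nu>: "\<nu> \<in> state_space E" "dist_L E L \<rho> \<nu> < ereal (d - p)" for \<nu>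
      proof -
        obtain s where s: "s < d - p" "\<And>x. x \<in> E \<Longrightarrow> L x \<le> 1 \<Longrightarrow> cmod (\<rho> x - \<nu> x) \<le> s"
          using \<nu>(2) unfolding dist_L_less_iff by blast
        have "cmod (\<mu> x - \<nu> x) \<le> p + s" if "x \<in> E" "L x \<le> 1" for x
          using norm_triangle_ineq[of "\<mu> x - \<rho> x" "\<rho> x - \<nu> x"] p(2)[OF that] s(2)[OF that] by simp
        then show ?thesis unfolding B_def dist_L_less_iff using s(1) \<nu>(1) by (auto intro!: exI[of _ "p + s"])
      qed
      then show "\<exists>r>0. \<forall>\<nu>\<in>state_space E. dist_L E L \<rho> \<nu> < ereal r \<longrightarrow> \<nu> \<in> B \<mu> d"
        using p(1) by (intro exI[of _ "d - p"]) auto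
    qed (auto simp: B_def)
    then show ?thesis using q by (simp add: compact_qms_def)
  qed
  have Bself: "\<mu> \<in> B \<mu> d" if "\<mu> \<in> state_space E" "d > 0" for \<mu> d
    using that by (auto simp: B_def dist_L_less_iff intro!: exI[of _ 0])
  fix e :: real assume e: "e > 0"
  \<comment> \<open>\<open>norm_le_states\<close> turns the later bound \<open>4 * \<delta>\<close>
    on states into \<open>32 * \<delta>\<close>, just below \<open>e\<close>.\<close>
  define \<delta> where "\<delta> = e / 33"
  have \<delta>: "\<delta> > 0" using e by (simp add: \<delta>_def)
  let ?C = "(\<lambda>\<mu>. B \<mu> \<delta>) ` state_space E"
  have C: "(\<forall>U\<in>?C. openin (weak_star_topology E) U) \<and> topspace (weak_star_topology E) \<subseteq> \<Union> ?C"
    unfolding topspace_weak_star using Bself[OF _ \<delta>] Bopen by blast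
  then obtain \<F> where "finite \<F>" "\<F> \<subseteq> ?C" "state_space E \<subseteq> \<Union> \<F>"
    using compact_space_weak_star[OF E, unfolded compact_space_alt, THEN spec, THEN mp, OF C]
    unfolding topspace_weak_star by (elim exE conjE)
  then obtain M where M: "finite M" "M \<subseteq> state_space E" "state_space E \<subseteq> \<Union> ((\<lambda>\<mu>. B \<mu> \<delta>) ` M)"
    using finite_subset_image[of \<F> "\<lambda>\<mu>. B \<mu> \<delta>" "state_space E"] by blast
  obtain \<mu>0 where \<mu>0: "\<mu>0 \<in> state_space E" using state_space_nonempty[OF E] by blast
  have "\<exists>d. \<forall>x\<in>?X. cmod (\<mu>0 x - \<mu> x) \<le> d" if "\<mu> \<in> state_space E" for \<mu>
    by (rule dist_L_bounded_if_ball_open[OF E Bopen[of \<mu>0 1, unfolded B_def] \<mu>0 that]) auto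
  then obtain d where d: "\<And>\<mu> x. \<mu> \<in> state_space E \<Longrightarrow> x \<in> ?X \<Longrightarrow> cmod (\<mu>0 x - \<mu> x) \<le> d \<mu>"
    by metis
  define g where "g x = (\<lambda>\<mu>\<in>M. (\<lfloor>Re (\<mu>0 x - \<mu> x) / \<delta>\<rfloor>, \<lfloor>Im (\<mu>0 x - \<mu> x) / \<delta>\<rfloor>))" for x
  define N where "N \<mu> = {\<lfloor>- d \<mu> / \<delta>\<rfloor>..\<lfloor>d \<mu> / \<delta>\<rfloor>}" for \<mu>
  have "g ` ?X \<subseteq> Pi\<^sub>E M (\<lambda>\<mu>. N \<mu> \<times> N \<mu>)"
  proof
    fix h assume "h \<in> g ` ?X"
    then obtain x where x: "x \<in> ?X" and h: "h = g x" by blast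
    have fl: "\<lfloor>u / \<delta>\<rfloor> \<in> N \<mu>" if "\<bar>u\<bar> \<le> d \<mu>" for u \<mu>
      using divide_right_mono[of "- d \<mu>" u \<delta>] divide_right_mono[of u "d \<mu>" \<delta>] that \<delta>
      by (auto simp: N_def intro!: floor_mono)
    have "\<lfloor>Re (\<mu>0 x - \<mu> x) / \<delta>\<rfloor> \<in> N \<mu>" "\<lfloor>Im (\<mu>0 x - \<mu> x) / \<delta>\<rfloor> \<in> N \<mu>" if "\<mu> \<in> M" for \<mu>
    proof -
      have "cmod (\<mu>0 x - \<mu> x) \<le> d \<mu>" using d x that M(2) by blast
      then show "\<lfloor>Re (\<mu>0 x - \<mu> x) / \<delta>\<rfloor> \<in> N \<mu>" "\<lfloor>Im (\<mu>0 x - \<mu> x) / \<delta>\<rfloor> \<in> N \<mu>"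
        using abs_Re_le_cmod[of "\<mu>0 x - \<mu> x"] abs_Im_le_cmod[of "\<mu>0 x - \<mu> x"]
        by (auto intro!: fl simp del: minus_complex.sel)
    qed
    then show "h \<in> Pi\<^sub>E M (\<lambda>\<mu>. N \<mu> \<times> N \<mu>)" unfolding h g_def by (simp add: PiE_iff)
  qed
  moreover have "finite (Pi\<^sub>E M (\<lambda>\<mu>. N \<mu> \<times> N \<mu>))"
    using M(1) by (intro finite_PiE) (auto simp: N_def)
  ultimately have fin: "finite (g ` ?X)" by (rule finite_subset)
  then obtain F where F: "F \<subseteq> ?X" "finite F" "g ` ?X = g ` F"
    using finite_subset_image[OF fin subset_refl] by (elim exE conjE)
  have "\<exists>y\<in>F. \<exists>v\<in>scalars. norm (x - y - v) < e" if x: "x \<in> ?X" for x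
  proof -
    obtain y where y: "y \<in> F" "g x = g y" using imageI[OF x, of g] unfolding F(3) by (rule imageE)
    have yX: "y \<in> ?X" using y F by blast
    \<comment> \<open>This scalar gives \<open>\<mu>0 z = 0\<close>; then \<open>\<mu> z\<close> is,
      up to sign, the difference of the coded quantities.\<close>
    define c where "c = \<mu>0 x - \<mu>0 y"
    define z where "z = x - y - c *\<^sub>C 1"
    have zE: "z \<in> E" unfolding z_def using x yX D by simp
    have ev: "\<rho> z = \<rho> x - \<rho> y - c" if \<rho>: "\<rho> \<in> state_space E" for \<rho>
      unfolding z_def using x yX D state_diff[OF E \<rho>] state_spaceD[OF \<rho>] by simp
    have fl: "\<bar>u - v\<bar> < \<delta>" if "\<lfloor>u / \<delta>\<rfloor> = \<lfloor>v / \<delta>\<rfloor>" for u v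
    proof -
      have "\<bar>u / \<delta> - v / \<delta>\<bar> < 1" using that by linarith
      then have "\<bar>u - v\<bar> / \<delta> < 1" using \<delta> by (simp flip: diff_divide_distrib add: abs_divide)
      then show ?thesis using \<delta> by simp
    qed
    have small: "cmod (\<mu> z) \<le> 2 * \<delta>" if "\<mu> \<in> M" for \<mu>
    proof -
      let ?u = "\<mu>0 x - \<mu> x" and ?v = "\<mu>0 y - \<mu> y"
      have "g x \<mu> = g y \<mu>" using y by simp
      then have "\<bar>Re ?u - Re ?v\<bar> < \<delta>" "\<bar>Im ?u - Im ?v\<bar> < \<delta>"
        using that by (auto simp: g_def intro!: fl simp del: minus_complex.sel)
      moreover have "cmod (?u - ?v) \<le> \<bar>Re ?u - Re ?v\<bar> + \<bar>Im ?u - Im ?v\<bar>"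
        using cmod_le[of "?u - ?v"] by (simp only: minus_complex.sel)
      moreover have "\<mu> \<in> state_space E" using that M(2) by blast
      then have "\<mu> z = - (?u - ?v)" by (simp add: ev c_def)
      then have "cmod (\<mu> z) = cmod (?u - ?v)" by (simp only: norm_minus_cancel)
      ultimately show ?thesis by linarith
    qed
    have "cmod (\<rho> z) \<le> 4 * \<delta>" if \<rho>: "\<rho> \<in> state_space E" for \<rho>
    proof -
      obtain \<mu> where \<mu>: "\<mu> \<in> M" "\<rho> \<in> B \<mu> \<delta>" using M(3) \<rho> by blast
      then obtain p where "p < \<delta>" "\<And>x. x \<in> E \<Longrightarrow> L x \<le> 1 \<Longrightarrow> cmod (\<mu> x - \<rho> x) \<le> p"
        unfolding B_def dist_L_less_iff by blast
      then have "cmod (\<mu> x - \<rho> x) \<le> \<delta>" "cmod (\<mu> y - \<rho> y) \<le> \<delta>" using x yX by force+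
      moreover have \<mu>S: "\<mu> \<in> state_space E" using \<mu> M by blast
      have eq: "\<rho> z = \<mu> z - (\<mu> x - \<rho> x) + (\<mu> y - \<rho> y)" using ev[OF \<mu>S] ev[OF \<rho>] by simp
      have "cmod (\<rho> z) \<le> cmod (\<mu> z) + cmod (\<mu> x - \<rho> x) + cmod (\<mu> y - \<rho> y)"
        unfolding eq by (rule order_trans[OF norm_triangle_ineq add_right_mono[OF norm_triangle_ineq4]])
      ultimately show ?thesis using small[OF \<mu>(1)] by simp
    qed
    then have "norm z \<le> 8 * (4 * \<delta>)" by (rule norm_le_states[OF E zE])
    also have "\<dots> < e" using e by (simp add: \<delta>_def)
    finally show ?thesis using y(1) unfolding z_def by (auto simp: scalars_def)
  qed
  with F(2) show "\<exists>F. finite F \<and> (\<forall>x\<in>?X. \<exists>y\<in>F. \<exists>v\<in>scalars. norm (x - y - v) < e)" by blast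
qed

section \<open>Fourier analysis of a circle action\<close>

definition circle_mean :: "(real \<Rightarrow> 'a::real_normed_vector) \<Rightarrow> 'a" where
  "circle_mean f = (1 / (2 * pi)) *\<^sub>R integral {0..2*pi} f"

lemma integrable_on_circle:
  fixes f :: "real \<Rightarrow> 'a::banach"
  shows "continuous_on UNIV f \<Longrightarrow> f integrable_on {a..b}"
  by (rule integrable_continuous_real) (rule continuous_on_subset[OF _ subset_UNIV])

lemma circle_mean_linear:
  fixes f :: "real \<Rightarrow> 'a::banach" and h :: "'a \<Rightarrow> 'b::banach"
  assumes f: "continuous_on UNIV f" and h: "bounded_linear h"
  shows "circle_mean (\<lambda>t. h (f t)) = h (circle_mean f)"
  using integral_linear[OF integrable_on_circle[OF f] h, of 0 "2*pi"]
  by (simp add: circle_mean_def o_def linear_scale[OF bounded_linear.linear[OF h]])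

lemma circle_mean_const: "circle_mean (\<lambda>_. c) = (c :: 'a::banach)"
  by (simp add: circle_mean_def)

lemma circle_mean_diff:
  fixes f g :: "real \<Rightarrow> 'a::banach"
  assumes "continuous_on UNIV f" "continuous_on UNIV g"
  shows "circle_mean (\<lambda>t. f t - g t) = circle_mean f - circle_mean g"
  using assms by (simp add: circle_mean_def integrable_on_circle integral_diff scaleR_diff_right)

lemma circle_mean_sum:
  fixes f :: "'i \<Rightarrow> real \<Rightarrow> 'a::banach"
  assumes "finite I" "\<And>i. i \<in> I \<Longrightarrow> continuous_on UNIV (f i)"
  shows "circle_mean (\<lambda>t. \<Sum>i\<in>I. f i t) = (\<Sum>i\<in>I. circle_mean (f i))"
  using assms by (simp add: circle_mean_def integrable_on_circle integral_sum scaleR_sum_right)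

lemma norm_circle_mean_le:
  fixes f :: "real \<Rightarrow> 'a::banach"
  assumes "continuous_on UNIV f" "continuous_on UNIV g" "\<And>t. norm (f t) \<le> g t"
  shows "norm (circle_mean f) \<le> circle_mean g"
proof -
  have "norm (integral {0..2*pi} f) \<le> integral {0..2*pi} g"
    by (rule Henstock_Kurzweil_Integration.integral_norm_bound_integral)
      (rule integrable_on_circle assms)+
  then have "norm (integral {0..2*pi} f) / (2 * pi) \<le> integral {0..2*pi} g / (2 * pi)"
    by (rule divide_right_mono) simp
  then show ?thesis by (simp add: circle_mean_def)
qed

text \<open>The window \<open>{s..s + 2*pi}\<close> is cut at \<open>2*pi\<close> and its tail moved
  back by one period; \<open>circle_cis\<close> supplies shifts in this range.\<close>

lemma circle_mean_shift:
  fixes f :: "real \<Rightarrow> 'a::banach"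
  assumes f: "continuous_on UNIV f" and per: "\<And>t. f (t + 2 * pi) = f t" and s: "0 \<le> s" "s \<le> 2 * pi"
  shows "circle_mean (\<lambda>t. f (t + s)) = circle_mean f"
proof -
  have i: "f integrable_on {a..b}" for a b by (rule integrable_on_circle[OF f])
  have "integral {0..2*pi} (\<lambda>t. f (t + s)) = integral {s..s + 2*pi} f"
    using integral_shift_real_ivl[of s s "s + 2*pi" f] by simp
  also have "\<dots> = integral {s..2*pi} f + integral {2*pi..s + 2*pi} f"
    by (rule Henstock_Kurzweil_Integration.integral_combine[symmetric]) (use s i in auto)
  also have "integral {2*pi..s + 2*pi} f = integral {0..s} f"
    using integral_shift_real_ivl[of "2*pi" "2*pi" "s + 2*pi" f] by (simp add: per)
  also have "integral {s..2*pi} f + integral {0..s} f = integral {0..2*pi} f"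
    by (subst add.commute, rule Henstock_Kurzweil_Integration.integral_combine) (use s i in auto)
  finally show ?thesis by (simp add: circle_mean_def)
qed

lemma circle_mean_cis: "circle_mean (\<lambda>t. cis (of_int n * t)) = (if n = 0 then 1 else 0)"
proof (cases "n = 0")
  case True
  then show ?thesis by (simp add: circle_mean_const)
next
  case False
  let ?F = "\<lambda>t. cis (of_int n * t) / (\<i> * of_int n)"
  have "((\<lambda>t. cis (of_int n * t)) has_integral (?F (2*pi) - ?F 0)) {0..2*pi}"
  proof (rule fundamental_theorem_of_calculus)
    fix t :: real
    have "((\<lambda>t. exp (\<i> * of_int n * of_real t) / (\<i> * of_int n)) has_vector_derivative
        exp (\<i> * of_int n * of_real t)) (at t within {0..2*pi})"
      by (rule has_vector_derivative_real_field) (use False in \<open>auto intro!: derivative_eq_intros\<close>)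
    then show "(?F has_vector_derivative cis (of_int n * t)) (at t within {0..2*pi})"
      by (simp add: cis_conv_exp mult.assoc)
  qed simp
  moreover have "cis (of_int n * (2 * pi)) = 1"
    using cis_power_int[of "2*pi" n] by simp
  ultimately have "integral {0..2*pi} (\<lambda>t. cis (of_int n * t)) = 0"
    by (simp add: integral_unique)
  then show ?thesis using False by (simp add: circle_mean_def)
qed

section \<open>The Fejer kernel\<close>

text \<open>With \<open>y = \<bar>x\<bar> / 2 < 2\<close> the Taylor bound gives
  \<open>sin y \<ge> y - y^3 / 6 \<ge> y / 3\<close>, and then
  \<open>1 - cos x = 2 (sin y)^2 \<ge> x^2 / 18\<close>.\<close>

lemma square_le_one_minus_cos:
  assumes "\<bar>x\<bar> \<le> pi"
  shows "x\<^sup>2 \<le> 18 * (1 - cos x)"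
proof -
  define y where "y = \<bar>x\<bar> / 2"
  have y: "0 \<le> y" "y < 2" using assms pi_less_4 by (auto simp: y_def)
  have "\<bar>sin y - y\<bar> \<le> y ^ 3 / 6"
    using Maclaurin_sin_bound[of y 3] y
    by (simp add: sin_coeff_def eval_nat_numeral field_simps)
  moreover have "y ^ 3 \<le> 4 * y"
    using mult_mono[of "y * y" 4 y y] mult_mono[of y 2 y 2] y by (simp add: power3_eq_cube)
  ultimately have "y / 3 \<le> sin y" by linarith
  then have "(y / 3)\<^sup>2 \<le> (sin y)\<^sup>2" using y by (intro power_mono) auto
  moreover have "cos x = 1 - 2 * (sin y)\<^sup>2"
    using cos_double_sin[of y] by (simp add: y_def)
  ultimately show ?thesis by (simp add: y_def power_divide)
qed

lemma ell_square_le: "(ell (cis t))\<^sup>2 \<le> 18 * (1 - cos t)"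
proof -
  have "cos (Arg (cis t)) = cos t" using cos_Arg[of "cis t"] by simp
  moreover have "\<bar>Arg (cis t)\<bar> \<le> pi" using Arg_bounded[of "cis t"] by linarith
  ultimately show ?thesis
    using square_le_one_minus_cos[of "Arg (cis t)"] by (simp add: ell_def)
qed

lemma ell_le_pi: "ell z \<le> pi"
  using Arg_bounded[of z] by (auto simp: ell_def)

lemma circle_cis: "z \<in> circle \<Longrightarrow> \<exists>s. 0 \<le> s \<and> s \<le> 2 * pi \<and> z = cis s"
proof -
  assume "z \<in> circle"
  then have z: "cis (Arg z) = z" by (cases "z = 0") (auto simp: cis_Arg sgn_eq)
  have "cis (Arg z + 2 * pi) = z" using z by (simp flip: cis_mult)
  then have z2: "z = cis (Arg z + 2 * pi)" by (rule sym)
  show ?thesis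
  proof (cases "0 \<le> Arg z")
    case True
    then show ?thesis using z Arg_bounded[of z] by (intro exI[of _ "Arg z"]) auto
  next
    case False
    then show ?thesis using z2 Arg_bounded[of z] by (intro exI[of _ "Arg z + 2 * pi"]) auto
  qed
qed

text \<open>One-sided rather than symmetric, which makes it a geometric sum; only its modulus enters
  the Fejer kernel.\<close>

definition dirichlet_sum :: "nat \<Rightarrow> real \<Rightarrow> complex" where
  "dirichlet_sum N t = (\<Sum>k<N. cis (of_nat k * t))"

definition fejer_kernel :: "nat \<Rightarrow> real \<Rightarrow> real" where
  "fejer_kernel N t = (cmod (dirichlet_sum N t))\<^sup>2 / of_nat N"

lemma continuous_on_cis_mult [continuous_intros]: "continuous_on S (\<lambda>t. cis (c * t))"
  by (intro continuous_intros)

lemma fejer_kernel_nonneg: "0 \<le> fejer_kernel N t"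
  by (simp add: fejer_kernel_def)

lemma continuous_on_fejer_kernel: "continuous_on S (fejer_kernel N)"
  unfolding fejer_kernel_def[abs_def] dirichlet_sum_def[abs_def]
  by (cases "N = 0") (auto intro!: continuous_intros)

lemma fejer_kernel_double_sum:
  "complex_of_real (fejer_kernel N t) =
     (\<Sum>j<N. \<Sum>k<N. cis (of_int (int j - int k) * t)) / of_nat N"
proof -
  have "complex_of_real ((cmod (dirichlet_sum N t))\<^sup>2) = dirichlet_sum N t * cnj (dirichlet_sum N t)"
    by (rule complex_norm_square)
  also have "\<dots> = (\<Sum>j<N. \<Sum>k<N. cis (of_int (int j - int k) * t))"
    by (simp add: dirichlet_sum_def sum_product cis_cnj cis_mult algebra_simps)
  finally show ?thesis by (simp add: fejer_kernel_def)
qed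

lemma circle_mean_fejer_kernel:
  assumes "N > 0"
  shows "circle_mean (fejer_kernel N) = 1"
proof -
  have "complex_of_real (circle_mean (fejer_kernel N)) = circle_mean (\<lambda>t. complex_of_real (fejer_kernel N t))"
    by (rule circle_mean_linear[symmetric]) (auto intro: bounded_linear_of_real continuous_on_fejer_kernel)
  also have "\<dots> = circle_mean (\<lambda>t. \<Sum>j<N. \<Sum>k<N. cis (of_int (int j - int k) * t)) / of_nat N"
    unfolding fejer_kernel_double_sum
    by (rule circle_mean_linear) (auto intro!: bounded_linear_divide continuous_intros)
  also have "circle_mean (\<lambda>t. \<Sum>j<N. \<Sum>k<N. cis (of_int (int j - int k) * t)) =
      (\<Sum>j<N. \<Sum>k<N. if int j - int k = 0 then 1 else 0)"
    by (simp only: circle_mean_sum circle_mean_cis finite_lessThan continuous_on_sum continuous_on_cis_mult)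
  also have "\<dots> = (\<Sum>j<N. \<Sum>k<N. if k = j then 1 else (0::complex))"
    by (intro sum.cong refl) auto
  also have "\<dots> = of_nat N" by simp
  finally show ?thesis using assms by (metis divide_self of_nat_0_eq_iff of_real_eq_1_iff less_irrefl)
qed

text \<open>\<open>(1 - cis t) * dirichlet_sum N t\<close> has modulus at most 2, and
  \<open>1 - cis t\<close> has squared modulus \<open>2 (1 - cos t)\<close>. Keeping
  \<open>1 - cos t\<close> as a factor includes the points where it vanishes.\<close>

lemma fejer_kernel_decay: "fejer_kernel N t * (1 - cos t) \<le> 2 / of_nat N"
proof -
  have "dirichlet_sum N t = (\<Sum>k<N. cis t ^ k)"
    unfolding dirichlet_sum_def by (rule sum.cong) (simp_all add: Complex.DeMoivre)
  then have "(1 - cis t) * dirichlet_sum N t = 1 - cis t ^ N"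
    by (simp only: one_diff_power_eq)
  then have "cmod (1 - cis t) * cmod (dirichlet_sum N t) = cmod (1 - cis t ^ N)"
    by (metis norm_mult)
  also have "\<dots> \<le> 2" using norm_triangle_ineq4[of 1 "cis t ^ N"] by (simp add: norm_power)
  finally have "(cmod (1 - cis t) * cmod (dirichlet_sum N t))\<^sup>2 \<le> 2\<^sup>2"
    by (intro power_mono) auto
  moreover have "(cmod (1 - cis t))\<^sup>2 = 2 * (1 - cos t)"
    using sin_cos_squared_add[of t] by (simp add: cmod_def power2_eq_square algebra_simps)
  ultimately have "(cmod (dirichlet_sum N t))\<^sup>2 * (1 - cos t) \<le> 2"
    by (simp add: power_mult_distrib algebra_simps)
  then have "(cmod (dirichlet_sum N t))\<^sup>2 * (1 - cos t) / of_nat N \<le> 2 / of_nat N"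
    by (rule divide_right_mono) simp
  then show ?thesis by (simp add: fejer_kernel_def)
qed

section \<open>Spectral projections of a circle action\<close>

locale circle_action =
  fixes \<sigma> :: "complex \<Rightarrow> 'a::cstar_algebra \<Rightarrow> 'a"
  assumes action: "strongly_cont_circle_action \<sigma>"
begin

lemma star_hom: "z \<in> circle \<Longrightarrow> star_hom_on UNIV (\<sigma> z)"
  using action by (simp add: strongly_cont_circle_action_def star_automorphism_def)

lemma
  assumes "z \<in> circle"
  shows action_add: "\<sigma> z (a + b) = \<sigma> z a + \<sigma> z b"
    and action_mult: "\<sigma> z (a * b) = \<sigma> z a * \<sigma> z b"
    and action_scaleC: "\<sigma> z (c *\<^sub>C a) = c *\<^sub>C \<sigma> z a"
    and action_adj: "\<sigma> z (adj a) = adj (\<sigma> z a)"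
    and action_one: "\<sigma> z 1 = 1"
  using star_hom[OF assms] by (auto simp: star_hom_on_def)

lemma norm_action_le: "z \<in> circle \<Longrightarrow> norm (\<sigma> z a) \<le> norm a"
  by (rule star_hom_contractive[OF star_hom]) (auto simp: closed_subalgebra_def)

lemma bounded_linear_action: "z \<in> circle \<Longrightarrow> bounded_linear (\<sigma> z)"
  by (rule bounded_linear_intro[where K=1])
    (use action_scaleC[of z "complex_of_real r" for r] in \<open>auto simp: action_add norm_action_le scaleC_of_real\<close>)

lemma action_cis_add: "\<sigma> (cis s) (\<sigma> (cis t) a) = \<sigma> (cis (t + s)) a"
proof -
  have "\<sigma> (cis s * cis t) = \<sigma> (cis s) \<circ> \<sigma> (cis t)"
    using action unfolding strongly_cont_circle_action_def by (elim conjE) simp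
  then show ?thesis by (simp add: cis_mult add.commute)
qed

lemma continuous_on_orbit [continuous_intros]:
  assumes "continuous_on S g"
  shows "continuous_on S (\<lambda>t. \<sigma> (cis (g t)) a)"
proof -
  have "continuous_on circle (\<lambda>z. \<sigma> z a)"
    using action by (simp add: strongly_cont_circle_action_def)
  then show ?thesis
    by (rule continuous_on_compose2) (auto intro!: continuous_intros assms)
qed

lemma spectral_proj_eq:
  "spectral_proj \<sigma> n a = circle_mean (\<lambda>t. cis (- (t * of_int n)) *\<^sub>C \<sigma> (cis t) a)"
  by (simp add: spectral_proj_def circle_mean_def)

lemma continuous_on_fourier [continuous_intros]:
  "continuous_on S (\<lambda>t. cis (- (t * of_int n)) *\<^sub>C \<sigma> (cis t) a)"
  by (intro continuous_intros)

lemma cis_power_int': "cis t powi n = cis (t * of_int n)"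
  by (simp add: cis_power_int mult.commute)

lemma spectral_proj_in_subspace: "spectral_proj \<sigma> n a \<in> spectral_subspace \<sigma> n"
  unfolding spectral_subspace_def
proof (intro CollectI ballI)
  fix z :: complex assume z: "z \<in> circle"
  then obtain s where s: "0 \<le> s" "s \<le> 2 * pi" "z = cis s" using circle_cis by blast
  let ?f = "\<lambda>t. cis (- (t * of_int n)) *\<^sub>C \<sigma> (cis t) a"
  have "\<sigma> z (spectral_proj \<sigma> n a) = circle_mean (\<lambda>t. \<sigma> z (?f t))"
    unfolding spectral_proj_eq
    by (rule circle_mean_linear[symmetric]) (auto intro!: continuous_intros bounded_linear_action z)
  also have "\<dots> = circle_mean (\<lambda>t. (z powi n) *\<^sub>C ?f (t + s))"
  proof -
    have "\<sigma> z (?f t) = (z powi n) *\<^sub>C ?f (t + s)" for t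
      by (simp add: s(3) action_scaleC action_cis_add scaleC_scaleC cis_power_int' cis_mult algebra_simps)
    then show ?thesis by simp
  qed
  also have "\<dots> = (z powi n) *\<^sub>C circle_mean (\<lambda>t. ?f (t + s))"
    by (rule circle_mean_linear) (auto intro!: continuous_intros bounded_linear_scaleC)
  also have "circle_mean (\<lambda>t. ?f (t + s)) = circle_mean ?f"
  proof (rule circle_mean_shift)
    show "?f (t + 2 * pi) = ?f t" for t
    proof -
      have "cis (- ((t + 2 * pi) * of_int n)) = cis (- (t * of_int n)) * cis (2 * pi) powi (- n)"
        unfolding cis_power_int' cis_mult by (simp add: algebra_simps)
      moreover have "cis (t + 2 * pi) = cis t" by (simp flip: cis_mult)
      ultimately show ?thesis by simp
    qed
  qed (use s in \<open>auto intro!: continuous_intros\<close>)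
  finally show "\<sigma> z (spectral_proj \<sigma> n a) = (z powi n) *\<^sub>C spectral_proj \<sigma> n a"
    by (simp add: spectral_proj_eq)
qed

lemma spectral_proj_adj: "spectral_proj \<sigma> (- n) a = adj (spectral_proj \<sigma> n (adj a))"
proof -
  have "adj (spectral_proj \<sigma> n (adj a)) =
      circle_mean (\<lambda>t. adj (cis (- (t * of_int n)) *\<^sub>C \<sigma> (cis t) (adj a)))"
    unfolding spectral_proj_eq
    by (rule circle_mean_linear[symmetric]) (auto intro!: continuous_intros bounded_linear_adj)
  then show ?thesis
    by (simp add: spectral_proj_eq action_adj adj_scaleC adj_adj cis_cnj)
qed

text \<open>The orbit of \<open>adj w\<close> contributes the factor
  \<open>cis (- (t * of_int n))\<close>, which turns coefficient 0 into coefficient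
  \<open>n\<close>. In this way assumptions on the projection onto fixed points reach the other
  components.\<close>

lemma spectral_proj_zero_mult_adj:
  assumes w: "w \<in> spectral_subspace \<sigma> n"
  shows "spectral_proj \<sigma> 0 (a * adj w) = spectral_proj \<sigma> n a * adj w"
proof -
  let ?f = "\<lambda>t. cis (- (t * of_int n)) *\<^sub>C \<sigma> (cis t) a"
  have "\<sigma> (cis t) w = (cis t powi n) *\<^sub>C w" for t
    using w by (simp add: spectral_subspace_def)
  then have "\<sigma> (cis t) (a * adj w) = ?f t * adj w" for t
    by (simp add: action_mult action_adj adj_scaleC scaleC_right_mult scaleC_left_mult cis_power_int' cis_cnj)
  then have "spectral_proj \<sigma> 0 (a * adj w) = circle_mean (\<lambda>t. ?f t * adj w)"
    by (simp add: spectral_proj_eq)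
  also have "\<dots> = circle_mean ?f * adj w"
    by (rule circle_mean_linear) (auto intro!: continuous_intros bounded_linear_mult_left)
  finally show ?thesis by (simp add: spectral_proj_eq)
qed

text \<open>For \<open>n \<noteq> 0\<close> constants have vanishing \<open>n\<close>-th
  coefficient, so \<open>\<sigma> z a\<close> may be replaced by \<open>\<sigma> z a - a\<close>, of
  norm at most \<open>c * pi\<close>. The bound is absolute, not modulo scalars.\<close>

lemma norm_spectral_proj_le:
  assumes n: "n \<noteq> 0" and a: "\<And>z. z \<in> circle \<Longrightarrow> norm (\<sigma> z a - a) \<le> c * ell z" and c: "0 \<le> c"
  shows "norm (spectral_proj \<sigma> n a) \<le> c * pi"
proof -
  let ?e = "\<lambda>t. cis (- (t * of_int n))"
  have "circle_mean (\<lambda>t. ?e t *\<^sub>C a) = circle_mean ?e *\<^sub>C a"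
    by (rule circle_mean_linear) (auto intro!: continuous_intros bounded_linear_scaleC_left)
  also have "circle_mean ?e = 0"
    using circle_mean_cis[of "- n"] n by (simp add: mult.commute)
  finally have "circle_mean (\<lambda>t. ?e t *\<^sub>C \<sigma> (cis t) a - ?e t *\<^sub>C a) = spectral_proj \<sigma> n a"
    unfolding spectral_proj_eq by (subst circle_mean_diff) (auto intro!: continuous_intros)
  moreover have "norm (circle_mean (\<lambda>t. ?e t *\<^sub>C \<sigma> (cis t) a - ?e t *\<^sub>C a)) \<le> circle_mean (\<lambda>_. c * pi)"
  proof (rule norm_circle_mean_le)
    show "norm (?e t *\<^sub>C \<sigma> (cis t) a - ?e t *\<^sub>C a) \<le> c * pi" for t
      using a[of "cis t"] mult_left_mono[OF ell_le_pi[of "cis t"] c]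
      by (simp add: norm_scaleC flip: scaleC_diff_right)
  qed (auto intro!: continuous_intros)
  ultimately show ?thesis by (simp add: circle_mean_const)
qed

text \<open>The error is at most \<open>c\<close> times the mean of
  \<open>fejer_kernel N t * ell (cis t)\<close>. Bounding \<open>ell\<close> by
  \<open>e / 2 + ell^2 / (2 e)\<close> replaces the usual splitting into small and large
  \<open>t\<close>; the quadratic part is absorbed by \<open>ell_square_le\<close> and
  \<open>fejer_kernel_decay\<close>. Only \<open>c\<close> remembers \<open>a\<close>, hence
  uniformity.\<close>

lemma fejer_approximation:
  assumes N: "N > 0" and e: "e > 0" and c: "0 \<le> c"
    and a: "\<And>z. z \<in> circle \<Longrightarrow> norm (\<sigma> z a - a) \<le> c * ell z"
  shows "norm (a - (1 / of_nat N) *\<^sub>R (\<Sum>j<N. \<Sum>k<N. spectral_proj \<sigma> (int k - int j) a))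
    \<le> c * (e / 2 + 18 / (e * of_nat N))"
proof -
  let ?K = "fejer_kernel N"
  have "circle_mean (\<lambda>t. ?K t *\<^sub>R \<sigma> (cis t) a) =
      circle_mean (\<lambda>t. (1 / of_nat N) *\<^sub>R (\<Sum>j<N. \<Sum>k<N. cis (- (t * of_int (int k - int j))) *\<^sub>C \<sigma> (cis t) a))"
  proof -
    have "?K t *\<^sub>R x = (1 / of_nat N) *\<^sub>R (\<Sum>j<N. \<Sum>k<N. cis (- (t * of_int (int k - int j))) *\<^sub>C x)" for t and x :: 'a
    proof -
      have "?K t *\<^sub>R x = complex_of_real (1 / of_nat N) *\<^sub>C ((\<Sum>j<N. \<Sum>k<N. cis (of_int (int j - int k) * t)) *\<^sub>C x)"
        unfolding scaleC_scaleC scaleC_of_real[symmetric] fejer_kernel_double_sum by simp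
      also have "(\<Sum>j<N. \<Sum>k<N. cis (of_int (int j - int k) * t)) *\<^sub>C x =
          (\<Sum>j<N. \<Sum>k<N. cis (of_int (int j - int k) * t) *\<^sub>C x)"
        by (simp only: linear_sum[OF bounded_linear.linear[OF bounded_linear_scaleC_left]])
      finally show ?thesis unfolding scaleC_of_real by (simp add: algebra_simps)
    qed
    then show ?thesis by simp
  qed
  also have "\<dots> = (1 / of_nat N) *\<^sub>R circle_mean (\<lambda>t. \<Sum>j<N. \<Sum>k<N. cis (- (t * of_int (int k - int j))) *\<^sub>C \<sigma> (cis t) a)"
    by (rule circle_mean_linear) (intro continuous_intros bounded_linear_scaleR_right)+
  also have "circle_mean (\<lambda>t. \<Sum>j<N. \<Sum>k<N. cis (- (t * of_int (int k - int j))) *\<^sub>C \<sigma> (cis t) a) =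
      (\<Sum>j<N. \<Sum>k<N. spectral_proj \<sigma> (int k - int j) a)"
    unfolding spectral_proj_eq
    by (simp only: circle_mean_sum finite_lessThan continuous_on_sum continuous_on_fourier)
  finally have T: "circle_mean (\<lambda>t. ?K t *\<^sub>R \<sigma> (cis t) a) =
      (1 / of_nat N) *\<^sub>R (\<Sum>j<N. \<Sum>k<N. spectral_proj \<sigma> (int k - int j) a)" .
  have "circle_mean (\<lambda>t. ?K t *\<^sub>R a) = circle_mean ?K *\<^sub>R a"
    by (rule circle_mean_linear) (auto intro: continuous_on_fejer_kernel bounded_linear_scaleR_left)
  then have A: "circle_mean (\<lambda>t. ?K t *\<^sub>R a) = a" by (simp add: circle_mean_fejer_kernel N)
  define g where "g t = c * ((e / 2) * ?K t + 18 / (e * of_nat N))" for t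
  have "norm (circle_mean (\<lambda>t. ?K t *\<^sub>R a - ?K t *\<^sub>R \<sigma> (cis t) a)) \<le> circle_mean g"
  proof (rule norm_circle_mean_le)
    fix t
    let ?l = "ell (cis t)"
    have l: "?l \<le> e / 2 + ?l\<^sup>2 / (2 * e)"
    proof -
      have "0 \<le> (?l - e)\<^sup>2 / (2 * e)" using e by simp
      also have "\<dots> = e / 2 + ?l\<^sup>2 / (2 * e) - ?l"
        using e by (simp add: power2_eq_square field_simps)
      finally show ?thesis by simp
    qed
    have "?K t * ?l \<le> ?K t * (e / 2 + ?l\<^sup>2 / (2 * e))"
      by (rule mult_left_mono[OF l fejer_kernel_nonneg])
    also have "\<dots> \<le> ?K t * (e / 2 + 18 * (1 - cos t) / (2 * e))"
      using e ell_square_le[of t]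
      by (intro mult_left_mono add_left_mono divide_right_mono fejer_kernel_nonneg) auto
    also have "\<dots> = (e / 2) * ?K t + 9 / e * (?K t * (1 - cos t))"
      using e by (simp add: field_simps)
    also have "\<dots> \<le> (e / 2) * ?K t + 9 / e * (2 / of_nat N)"
      using e by (intro add_left_mono mult_left_mono fejer_kernel_decay) auto
    finally have *: "?K t * ?l \<le> (e / 2) * ?K t + 18 / (e * of_nat N)" by simp
    have "norm (?K t *\<^sub>R a - ?K t *\<^sub>R \<sigma> (cis t) a) = ?K t * norm (\<sigma> (cis t) a - a)"
      by (simp add: fejer_kernel_nonneg norm_minus_commute flip: scaleR_diff_right)
    also have "\<dots> \<le> ?K t * (c * ?l)"
      using a[of "cis t"] by (intro mult_left_mono fejer_kernel_nonneg) auto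
    also have "\<dots> = c * (?K t * ?l)" by simp
    also have "\<dots> \<le> g t" unfolding g_def by (rule mult_left_mono[OF * c])
    finally show "norm (?K t *\<^sub>R a - ?K t *\<^sub>R \<sigma> (cis t) a) \<le> g t" .
  qed (auto simp: g_def intro!: continuous_intros continuous_on_fejer_kernel)
  also have "circle_mean g = c * (e / 2 + 18 / (e * of_nat N))"
  proof -
    have "circle_mean (\<lambda>t. c * ((e / 2) * ?K t - (- 18 / (e * of_nat N)))) =
        c * circle_mean (\<lambda>t. (e / 2) * ?K t - (- 18 / (e * of_nat N)))"
      by (rule circle_mean_linear) (auto intro!: continuous_intros continuous_on_fejer_kernel bounded_linear_mult_right)
    also have "circle_mean (\<lambda>t. (e / 2) * ?K t - (- 18 / (e * of_nat N))) =
        circle_mean (\<lambda>t. (e / 2) * ?K t) + 18 / (e * of_nat N)"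
      by (subst circle_mean_diff) (auto simp: circle_mean_const intro!: continuous_intros continuous_on_fejer_kernel)
    also have "circle_mean (\<lambda>t. (e / 2) * ?K t) = (e / 2) * circle_mean ?K"
      by (rule circle_mean_linear) (rule continuous_on_fejer_kernel bounded_linear_mult_right)+
    finally show ?thesis by (simp add: g_def[abs_def] circle_mean_fejer_kernel N)
  qed
  also have "circle_mean (\<lambda>t. ?K t *\<^sub>R a - ?K t *\<^sub>R \<sigma> (cis t) a) =
      a - (1 / of_nat N) *\<^sub>R (\<Sum>j<N. \<Sum>k<N. spectral_proj \<sigma> (int k - int j) a)"
    unfolding T[symmetric] by (subst circle_mean_diff) (auto simp: A intro!: continuous_intros continuous_on_fejer_kernel)
  finally show ?thesis .
qed

end

section \<open>Averaging a lower semicontinuous seminorm\<close>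

lemma slip_norm_sum_le:
  fixes x :: "'i \<Rightarrow> 'a::cstar_algebra"
  assumes E: "operator_system E" and L: "slip_norm E L" and S: "finite S"
    and x: "\<And>i. i \<in> S \<Longrightarrow> x i \<in> E" and c: "\<And>i. i \<in> S \<Longrightarrow> 0 \<le> c i"
  shows "(\<Sum>i\<in>S. c i *\<^sub>R x i) \<in> E \<and> L (\<Sum>i\<in>S. c i *\<^sub>R x i) \<le> (\<Sum>i\<in>S. c i * L (x i))"
  using S x c
proof (induction S rule: finite_induct)
  case empty
  have "L (0 *\<^sub>C 1) = 0" using L operator_systemD(1)[OF E] unfolding slip_norm_def by (metis mult_zero_left norm_zero)
  then show ?case using operator_systemD(9)[OF E] by simp
next
  case (insert i S)
  then have IH: "(\<Sum>i\<in>S. c i *\<^sub>R x i) \<in> E" "L (\<Sum>i\<in>S. c i *\<^sub>R x i) \<le> (\<Sum>i\<in>S. c i * L (x i))" by auto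
  have i: "c i *\<^sub>R x i \<in> E" using insert operator_systemD(5)[OF E] by simp
  have "L (complex_of_real (c i) *\<^sub>C x i) = cmod (complex_of_real (c i)) * L (x i)"
    using L insert.prems(1)[of i] by (simp add: slip_norm_def)
  then have "L (c i *\<^sub>R x i) = c i * L (x i)"
    unfolding scaleC_of_real using insert.prems(2)[of i] by simp
  moreover have "L (c i *\<^sub>R x i + (\<Sum>i\<in>S. c i *\<^sub>R x i)) \<le> L (c i *\<^sub>R x i) + L (\<Sum>i\<in>S. c i *\<^sub>R x i)"
    using L i IH(1) by (simp add: slip_norm_def)
  ultimately show ?case
    using insert.hyps operator_systemD(2)[OF E i IH(1)] IH(2) by simp
qed

text \<open>Riemann sums are convex combinations, so a lower semicontinuous seminorm does not increase
  under averaging.\<close>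

lemma slip_norm_circle_mean_le:
  fixes f :: "real \<Rightarrow> 'a::cstar_algebra"
  assumes E: "operator_system E" and L: "slip_norm E L" and lsc: "lsc_on E L"
    and f: "continuous_on UNIV f" "\<And>t. f t \<in> E" "\<And>t. L (f t) \<le> M" and mean: "circle_mean f \<in> E"
  shows "L (circle_mean f) \<le> M"
proof (rule ccontr)
  assume "\<not> ?thesis"
  then have gt: "L (circle_mean f) > M" by simp
  \<comment> \<open>\<open>lsc_on\<close> provides open sets at nonnegative levels only.\<close>
  have "0 \<le> L (f 0)" using L f(2) by (simp add: slip_norm_def)
  then have "0 \<le> M" using f(3)[of 0] by simp
  then have op: "openin (top_of_set E) {x \<in> E. L x > M}" using lsc by (simp add: lsc_on_def)
  have "circle_mean f \<in> {x \<in> E. L x > M}" using mean gt by simp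
  then have "\<exists>e>0. \<forall>x\<in>E. dist x (circle_mean f) < e \<longrightarrow> x \<in> {x \<in> E. L x > M}"
    by (rule op[unfolded openin_euclidean_subtopology_iff, THEN conjunct2, THEN bspec])
  then obtain e where e: "e > 0" "\<And>x. x \<in> E \<Longrightarrow> dist x (circle_mean f) < e \<Longrightarrow> L x > M"
    by (elim exE conjE) simp
  have int: "(f has_integral integral {0..2*pi} f) {0..2*pi}"
    by (rule integrable_integral[OF integrable_on_circle[OF f(1)]])
  \<comment> \<open>The factor \<open>2 * pi\<close> compensates the division in
    \<open>circle_mean\<close>.\<close>
  have "e * (2 * pi) > 0" using e(1) by simp
  then have "\<exists>\<gamma>. gauge \<gamma> \<and> (\<forall>\<D>. \<D> tagged_division_of {0..2*pi} \<and> \<gamma> fine \<D> \<longrightarrow>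
      norm ((\<Sum>(x,k)\<in>\<D>. measure lborel k *\<^sub>R f x) - integral {0..2*pi} f) < e * (2 * pi))"
    by (rule int[unfolded has_integral_real, rule_format])
  then obtain \<gamma> where \<gamma>: "gauge \<gamma>" "\<And>\<D>. \<D> tagged_division_of {0..2*pi} \<Longrightarrow> \<gamma> fine \<D> \<Longrightarrow>
      norm ((\<Sum>(x,k)\<in>\<D>. measure lborel k *\<^sub>R f x) - integral {0..2*pi} f) < e * (2 * pi)"
    by (elim exE conjE) simp
  obtain \<D> where D: "\<D> tagged_division_of {0..2*pi}" "\<gamma> fine \<D>"
    using fine_division_exists_real[OF \<gamma>(1)] by blast
  let ?c = "\<lambda>p. measure lborel (snd p) / (2 * pi)"
  define y where "y = (\<Sum>p\<in>\<D>. ?c p *\<^sub>R f (fst p))"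
  have fin: "finite \<D>" using D(1) by blast
  have y_eq: "y = (1 / (2 * pi)) *\<^sub>R (\<Sum>(x,k)\<in>\<D>. measure lborel k *\<^sub>R f x)"
    by (simp add: y_def scaleR_sum_right case_prod_beta)
  have "y \<in> E \<and> L y \<le> (\<Sum>p\<in>\<D>. ?c p * L (f (fst p)))"
    unfolding y_def by (rule slip_norm_sum_le[OF E L fin]) (auto simp: f(2))
  moreover have "(\<Sum>p\<in>\<D>. ?c p * L (f (fst p))) \<le> (\<Sum>p\<in>\<D>. ?c p * M)"
    using f(3) by (intro sum_mono mult_left_mono) auto
  moreover have "(\<Sum>p\<in>\<D>. ?c p * M) = M"
  proof -
    have "(\<Sum>p\<in>\<D>. measure lborel (snd p)) = 2 * pi"
      using additive_content_tagged_division[of \<D> 0 "2*pi"] D(1) by (simp add: case_prod_beta)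
    then have c: "(\<Sum>p\<in>\<D>. ?c p) = 1" by (simp flip: sum_divide_distrib)
    show ?thesis unfolding sum_distrib_right[symmetric] c by simp
  qed
  moreover have "dist y (circle_mean f) < e"
  proof -
    have "y - circle_mean f = (1 / (2 * pi)) *\<^sub>R ((\<Sum>(x,k)\<in>\<D>. measure lborel k *\<^sub>R f x) - integral {0..2*pi} f)"
      by (simp add: y_eq circle_mean_def scaleR_diff_right)
    then have "norm (y - circle_mean f) =
        norm ((\<Sum>(x,k)\<in>\<D>. measure lborel k *\<^sub>R f x) - integral {0..2*pi} f) / (2 * pi)" by simp
    also have "\<dots> < e" using \<gamma>(2)[OF D] by (simp add: pos_divide_less_eq)
    finally show ?thesis by (simp add: dist_norm)
  qed
  ultimately show False using e(2)[of y] by fastforce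
qed

section \<open>Total boundedness modulo a subspace\<close>

lemma totally_bounded_modE:
  assumes "totally_bounded_mod V X" "e > 0"
  obtains F where "finite F" "\<forall>x\<in>X. \<exists>y\<in>F. \<exists>v\<in>V. norm (x - y - v) < e"
  using assms unfolding totally_bounded_mod_def by blast

lemma totally_bounded_mod_mono:
  assumes "totally_bounded_mod V X" "V \<subseteq> W" "Y \<subseteq> X"
  shows "totally_bounded_mod W Y"
  unfolding totally_bounded_mod_def
proof (intro allI impI)
  fix e :: real assume "e > 0"
  with assms(1) obtain F where F: "finite F" "\<forall>x\<in>X. \<exists>y\<in>F. \<exists>v\<in>V. norm (x - y - v) < e"
    by (rule totally_bounded_modE)
  show "\<exists>F. finite F \<and> (\<forall>x\<in>Y. \<exists>y\<in>F. \<exists>v\<in>W. norm (x - y - v) < e)"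
  proof (intro exI[of _ F] conjI ballI F(1))
    fix x assume "x \<in> Y"
    then have "\<exists>y\<in>F. \<exists>v\<in>V. norm (x - y - v) < e" using F(2) assms(3) by blast
    then show "\<exists>y\<in>F. \<exists>v\<in>W. norm (x - y - v) < e" using assms(2) by blast
  qed
qed

lemma totally_bounded_mod_image:
  assumes X: "totally_bounded_mod V X" and h: "bounded_linear h" and V: "h ` V \<subseteq> W"
  shows "totally_bounded_mod W (h ` X)"
  unfolding totally_bounded_mod_def
proof (intro allI impI)
  fix e :: real assume e: "e > 0"
  obtain K where K: "K > 0" "\<And>x. norm (h x) \<le> norm x * K"
    using bounded_linear.pos_bounded[OF h] by auto
  have "e / K > 0" using e K by simp
  with X obtain F where F: "finite F" "\<forall>x\<in>X. \<exists>y\<in>F. \<exists>v\<in>V. norm (x - y - v) < e / K"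
    by (rule totally_bounded_modE)
  have "\<exists>y\<in>h ` F. \<exists>v\<in>W. norm (h x - y - v) < e" if x: "x \<in> X" for x
  proof -
    obtain y v where yv: "y \<in> F" "v \<in> V" "norm (x - y - v) < e / K" using bspec[OF F(2) x] by auto
    have "h x - h y - h v = h (x - y - v)" by (simp add: linear_diff[OF bounded_linear.linear[OF h]])
    then have "norm (h x - h y - h v) \<le> norm (x - y - v) * K" using K(2) by simp
    also have "\<dots> < e" using yv(3) K(1) by (simp add: pos_less_divide_eq)
    finally have "norm (h x - h y - h v) < e" .
    moreover have "h v \<in> W" using V yv(2) by auto
    ultimately show ?thesis using yv(1) by (intro bexI[of _ "h y"] bexI[of _ "h v"]) auto
  qed
  then show "\<exists>F. finite F \<and> (\<forall>x\<in>h ` X. \<exists>y\<in>F. \<exists>v\<in>W. norm (x - y - v) < e)"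
    using F(1) by (intro exI[of _ "h ` F"]) auto
qed

lemma totally_bounded_mod_add:
  assumes f: "totally_bounded_mod V (f ` D)" and g: "totally_bounded_mod V (g ` D)"
    and V: "\<And>u v. u \<in> V \<Longrightarrow> v \<in> V \<Longrightarrow> u + v \<in> V"
  shows "totally_bounded_mod V ((\<lambda>x. f x + g x) ` D)"
  unfolding totally_bounded_mod_def
proof (intro allI impI)
  fix e :: real assume e: "e > 0"
  then have e2: "e / 2 > 0" by simp
  obtain F where F: "finite F" "\<forall>x\<in>f ` D. \<exists>y\<in>F. \<exists>v\<in>V. norm (x - y - v) < e / 2"
    using f e2 by (rule totally_bounded_modE)
  obtain G where G: "finite G" "\<forall>x\<in>g ` D. \<exists>y\<in>G. \<exists>v\<in>V. norm (x - y - v) < e / 2"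
    using g e2 by (rule totally_bounded_modE)
  let ?H = "(\<lambda>(y, z). y + z) ` (F \<times> G)"
  have "\<exists>y\<in>?H. \<exists>v\<in>V. norm (f x + g x - y - v) < e" if x: "x \<in> D" for x
  proof -
    obtain y v where yv: "y \<in> F" "v \<in> V" "norm (f x - y - v) < e / 2"
      using bspec[OF F(2) imageI[OF x]] by auto
    obtain z w where zw: "z \<in> G" "w \<in> V" "norm (g x - z - w) < e / 2"
      using bspec[OF G(2) imageI[OF x]] by auto
    have eq: "f x + g x - (y + z) - (v + w) = (f x - y - v) + (g x - z - w)" by simp
    have "norm (f x + g x - (y + z) - (v + w)) \<le> norm (f x - y - v) + norm (g x - z - w)"
      unfolding eq by (rule norm_triangle_ineq)
    then have "norm (f x + g x - (y + z) - (v + w)) < e" using yv(3) zw(3) by simp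
    moreover have "y + z \<in> ?H" using yv(1) zw(1) by force
    ultimately show ?thesis using V[OF yv(2) zw(2)] by blast
  qed
  then show "\<exists>H. finite H \<and> (\<forall>x\<in>(\<lambda>x. f x + g x) ` D. \<exists>y\<in>H. \<exists>v\<in>V. norm (x - y - v) < e)"
    using F(1) G(1) by (intro exI[of _ ?H]) auto
qed

lemma totally_bounded_mod_sum:
  assumes "finite I" and f: "\<And>i. i \<in> I \<Longrightarrow> totally_bounded_mod V (f i ` D)"
    and V: "0 \<in> V" "\<And>u v. u \<in> V \<Longrightarrow> v \<in> V \<Longrightarrow> u + v \<in> V"
  shows "totally_bounded_mod V ((\<lambda>x. \<Sum>i\<in>I. f i x) ` D)"
  using assms(1) f
proof (induction I rule: finite_induct)
  case empty
  then show ?case using V(1) by (auto simp: totally_bounded_mod_def intro!: exI[of _ "{0}"] bexI[of _ 0])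
next
  case (insert i I)
  then have "totally_bounded_mod V ((\<lambda>x. f i x + (\<Sum>i\<in>I. f i x)) ` D)"
    by (intro totally_bounded_mod_add V(2)) auto
  then show ?case using insert by simp
qed

lemma totally_bounded_mod_approx:
  assumes "\<And>e. e > 0 \<Longrightarrow> \<exists>g. totally_bounded_mod V (g ` D) \<and> (\<forall>x\<in>D. norm (x - g x) < e)"
  shows "totally_bounded_mod V D"
  unfolding totally_bounded_mod_def
proof (intro allI impI)
  fix e :: real assume "e > 0"
  then have e2: "e / 2 > 0" by simp
  then obtain g where g: "totally_bounded_mod V (g ` D)" "\<And>x. x \<in> D \<Longrightarrow> norm (x - g x) < e / 2"
    using assms by blast
  obtain F where F: "finite F" "\<forall>x\<in>g ` D. \<exists>y\<in>F. \<exists>v\<in>V. norm (x - y - v) < e / 2"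
    using g(1) e2 by (rule totally_bounded_modE)
  have "\<exists>y\<in>F. \<exists>v\<in>V. norm (x - y - v) < e" if x: "x \<in> D" for x
  proof -
    obtain y v where yv: "y \<in> F" "v \<in> V" "norm (g x - y - v) < e / 2"
      using bspec[OF F(2) imageI[OF x]] by auto
    have eq: "x - y - v = (x - g x) + (g x - y - v)" by simp
    have "norm (x - y - v) \<le> norm (x - g x) + norm (g x - y - v)"
      by (subst eq) (rule norm_triangle_ineq)
    then have "norm (x - y - v) < e" using yv(3) g(2)[OF x] by simp
    then show ?thesis using yv by blast
  qed
  then show "\<exists>F. finite F \<and> (\<forall>x\<in>D. \<exists>y\<in>F. \<exists>v\<in>V. norm (x - y - v) < e)" using F(1) by blast
qed

lemma scalars_add: "u \<in> scalars \<Longrightarrow> v \<in> scalars \<Longrightarrow> u + v \<in> scalars"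
  unfolding scalars_def by (auto simp flip: scaleC_add_left)

lemma zero_in_scalars: "0 \<in> scalars"
  unfolding scalars_def by (rule image_eqI[of _ _ 0]) simp_all

text \<open>The norm bound confines the scalars that occur to a disc, which finitely many small
  balls cover. This prepares for multiplication by elements that do not preserve
  \<open>scalars\<close>.\<close>

lemma totally_bounded_if_mod_scalars_bounded:
  fixes X :: "'a::cstar_algebra set"
  assumes X: "totally_bounded_mod scalars X" and M: "\<And>x. x \<in> X \<Longrightarrow> norm x \<le> M"
  shows "totally_bounded_mod {0} X"
  unfolding totally_bounded_mod_def
proof (intro allI impI)
  fix e :: real assume "e > 0"
  then have e2: "e / 2 > 0" by simp
  obtain F where F: "finite F" "\<forall>x\<in>X. \<exists>y\<in>F. \<exists>v\<in>scalars. norm (x - y - v) < e / 2"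
    using X e2 by (rule totally_bounded_modE)
  define R where "R = M + (\<Sum>y\<in>F. norm y) + e / 2"
  have cover: "cball (0::complex) R \<subseteq> (\<Union>c\<in>cball 0 R. ball c (e / 2))" using e2 by force
  obtain G where G: "G \<subseteq> cball 0 R" "finite G" "cball (0::complex) R \<subseteq> (\<Union>c\<in>G. ball c (e / 2))"
    by (rule compactE_image[OF compact_cball _ cover]) (rule open_ball)
  let ?H = "(\<lambda>(y, c). y + c *\<^sub>C 1) ` (F \<times> G)"
  have "\<exists>y\<in>?H. norm (x - y) < e" if x: "x \<in> X" for x
  proof -
    obtain y c where yc: "y \<in> F" "norm (x - y - c *\<^sub>C 1) < e / 2"
      using bspec[OF F(2) x] by (auto simp: scalars_def)
    have "norm (c *\<^sub>C (1::'a)) \<le> norm (x - y) + norm (x - y - c *\<^sub>C 1)"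
      using norm_triangle_ineq4[of "x - y" "x - y - c *\<^sub>C 1"] by simp
    also have "norm (x - y) \<le> norm x + norm y" by (rule norm_triangle_ineq4)
    also have "norm y \<le> (\<Sum>y\<in>F. norm y)" using F(1) yc(1) by (intro member_le_sum) auto
    finally have "cmod c \<le> R" using M[OF x] yc(2) by (simp add: R_def norm_scaleC)
    then obtain d where d: "d \<in> G" "cmod (d - c) < e / 2" using G(3) by (auto simp: dist_norm norm_minus_commute subset_iff)
    have eq: "x - (y + d *\<^sub>C 1) = (x - y - c *\<^sub>C 1) - (d - c) *\<^sub>C 1" by (simp add: scaleC_diff_left)
    have "norm (x - (y + d *\<^sub>C 1)) \<le> norm (x - y - c *\<^sub>C 1) + norm ((d - c) *\<^sub>C (1::'a))"
      unfolding eq by (rule norm_triangle_ineq4)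
    then have "norm (x - (y + d *\<^sub>C 1)) < e" using yc(2) d(2) by (simp add: norm_scaleC)
    then show ?thesis using yc(1) d(1) by force
  qed
  then show "\<exists>H. finite H \<and> (\<forall>x\<in>X. \<exists>y\<in>H. \<exists>v\<in>{0}. norm (x - y - v) < e)"
    using F(1) G(2) by (intro exI[of _ ?H]) auto
qed

lemma totally_bounded_mod_sublevel:
  assumes E: "operator_system E" and L: "slip_norm E L"
    and tb: "totally_bounded_mod scalars {x \<in> E. L x \<le> 1}"
  shows "totally_bounded_mod scalars {x \<in> E. L x \<le> K}"
proof -
  \<comment> \<open>Keeps the scaling factor positive when \<open>K \<le> 0\<close>.\<close>
  define k where "k = max K 1"
  have k: "k > 0" "K \<le> k" by (auto simp: k_def)
  have "totally_bounded_mod scalars ((\<lambda>x. k *\<^sub>R x) ` {x \<in> E. L x \<le> 1})"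
  proof (rule totally_bounded_mod_image[OF tb bounded_linear_scaleR_right])
    show "(*\<^sub>R) k ` scalars \<subseteq> scalars"
      unfolding scalars_def by (auto simp: scaleC_scaleC simp flip: scaleC_of_real)
  qed
  moreover have "{x \<in> E. L x \<le> K} \<subseteq> (\<lambda>x. k *\<^sub>R x) ` {x \<in> E. L x \<le> 1}"
  proof
    fix x assume "x \<in> {x \<in> E. L x \<le> K}"
    then have x: "x \<in> E" "L x \<le> k" using k by auto
    have "L (complex_of_real (1 / k) *\<^sub>C x) = cmod (complex_of_real (1 / k)) * L x"
      using L x(1) by (simp only: slip_norm_def)
    then have "L ((1 / k) *\<^sub>R x) = (1 / k) * L x"
      using k unfolding scaleC_of_real norm_of_real by simp
    then have "L ((1 / k) *\<^sub>R x) \<le> 1" using x k by simp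
    then show "x \<in> (\<lambda>x. k *\<^sub>R x) ` {x \<in> E. L x \<le> 1}"
      using operator_systemD(5)[OF E x(1)] k by (intro image_eqI[of _ _ "(1 / k) *\<^sub>R x"]) auto
  qed
  ultimately show ?thesis using totally_bounded_mod_mono by blast
qed

section \<open>Fixed points and frames of higher degree\<close>

context circle_action
begin

lemma spectral_subspace_mult:
  assumes "a \<in> spectral_subspace \<sigma> m" "b \<in> spectral_subspace \<sigma> n"
  shows "a * b \<in> spectral_subspace \<sigma> (m + n)"
  unfolding spectral_subspace_def
proof (intro CollectI ballI)
  fix z :: complex assume z: "z \<in> circle"
  then have "z \<noteq> 0" by auto
  then show "\<sigma> z (a * b) = z powi (m + n) *\<^sub>C (a * b)"
    using assms z
    by (simp add: spectral_subspace_def action_mult scaleC_left_mult scaleC_right_mult scaleC_scaleC power_int_add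
        mult.commute[of "z powi n"])
qed

lemma closed_subalgebra_fixed_points: "closed_subalgebra (spectral_subspace \<sigma> 0)"
proof -
  have eq: "spectral_subspace \<sigma> 0 = (\<Inter>z\<in>circle. {a. \<sigma> z a = a})"
    by (auto simp: spectral_subspace_def)
  have "closed {a. \<sigma> z a = a}" if "z \<in> circle" for z
    by (intro closed_Collect_eq linear_continuous_on bounded_linear_action that continuous_intros)
  then have "closed (spectral_subspace \<sigma> 0)" unfolding eq by blast
  moreover have "\<sigma> z (r *\<^sub>R a) = r *\<^sub>R \<sigma> z a" if "z \<in> circle" for z r a
    by (rule linear_scale[OF bounded_linear.linear[OF bounded_linear_action[OF that]]])
  ultimately show ?thesis
    unfolding closed_subalgebra_def by (simp add: spectral_subspace_def action_one action_add action_mult)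
qed

lemma fixed_points_adj: "a \<in> spectral_subspace \<sigma> 0 \<Longrightarrow> adj a \<in> spectral_subspace \<sigma> 0"
  by (simp add: spectral_subspace_def action_adj)

lemma fixed_points_operator_system:
  "operator_system E \<Longrightarrow> operator_system (E \<inter> spectral_subspace \<sigma> 0)"
  unfolding operator_system_def
  by (simp add: spectral_subspace_def action_one action_add action_scaleC action_adj)

text \<open>Products collapse from the inside: summing \<open>adj (z * w) * (z * w)\<close> over
  \<open>z\<close> gives \<open>adj w * w\<close>. Lists keep coinciding products as separate
  summands.\<close>

lemma spectral_frame:
  assumes A: "unital_star_subalgebra A" and zs: "set zs \<subseteq> A \<inter> spectral_subspace \<sigma> 1"
    and sum: "(\<Sum>z\<leftarrow>zs. adj z * z) = 1"
  shows "\<exists>ws. set ws \<subseteq> A \<inter> spectral_subspace \<sigma> (int n) \<and> (\<Sum>w\<leftarrow>ws. adj w * w) = 1"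
proof (induction n)
  case 0
  show ?case using A by (intro exI[of _ "[1]"]) (simp add: unital_star_subalgebra_def spectral_subspace_def action_one)
next
  case (Suc n)
  then obtain ws where ws: "set ws \<subseteq> A \<inter> spectral_subspace \<sigma> (int n)" "(\<Sum>w\<leftarrow>ws. adj w * w) = 1" by blast
  let ?ws = "concat (map (\<lambda>w. map (\<lambda>z. z * w) zs) ws)"
  have "z * w \<in> A \<inter> spectral_subspace \<sigma> (int (Suc n))" if "z \<in> set zs" "w \<in> set ws" for z w
  proof -
    have "z \<in> A" "w \<in> A" "z \<in> spectral_subspace \<sigma> 1" "w \<in> spectral_subspace \<sigma> (int n)"
      using that zs ws(1) by auto
    then show ?thesis using A spectral_subspace_mult[of z 1 w "int n"] by (simp add: unital_star_subalgebra_def)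
  qed
  then have "set ?ws \<subseteq> A \<inter> spectral_subspace \<sigma> (int (Suc n))" by auto
  moreover have "(\<Sum>w\<leftarrow>?ws. adj w * w) = 1"
  proof -
    have "(\<Sum>z\<leftarrow>zs. adj (z * w) * (z * w)) = adj w * (\<Sum>z\<leftarrow>zs. adj z * z) * w" for w
      by (simp add: adj_mult mult.assoc flip: sum_list_const_mult sum_list_mult_const)
    then have *: "(\<Sum>z\<leftarrow>zs. adj (z * w) * (z * w)) = adj w * w" for w by (simp add: sum)
    have "(\<Sum>w\<leftarrow>?ws. adj w * w) = (\<Sum>w\<leftarrow>ws. \<Sum>z\<leftarrow>zs. adj (z * w) * (z * w))"
      by (induction ws) (simp_all add: o_def)
    then show ?thesis by (simp only: * ws(2))
  qed
  ultimately show ?case by blast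
qed

end

lemma ell_pos: "z \<in> circle \<Longrightarrow> z \<noteq> 1 \<Longrightarrow> ell z > 0"
proof -
  assume z: "z \<in> circle" "z \<noteq> 1"
  then have "cis (Arg z) = z" by (cases "z = 0") (auto simp: cis_Arg sgn_eq)
  with z have "Arg z \<noteq> 0" by auto
  then show ?thesis by (simp add: ell_def)
qed

text \<open>\<open>L_ell\<close> is a supremum of reals, so membership in \<open>Lip_S1\<close> is
  what gives it meaning. The point \<open>z = 1\<close>, excluded from the quotients, is covered by
  \<open>\<sigma> 1 = id\<close>.\<close>

lemma L_ell_bound:
  assumes "a \<in> Lip_S1 \<sigma>" "z \<in> circle" "\<sigma> 1 = id" "L_ell \<sigma> a \<le> c" "0 \<le> c"
  shows "norm (\<sigma> z a - a) \<le> c * ell z"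
proof (cases "z = 1")
  case True
  then show ?thesis using assms by (simp add: ell_def)
next
  case False
  have "norm (\<sigma> z a - a) / ell z \<in> lip_quotients \<sigma> a"
    unfolding lip_quotients_def using assms(2) False by blast
  then have "norm (\<sigma> z a - a) / ell z \<le> L_ell \<sigma> a"
    unfolding L_ell_def using assms(1) by (intro cSup_upper) (auto simp: Lip_S1_def)
  then have "norm (\<sigma> z a - a) / ell z \<le> c" using assms(4) by simp
  then show ?thesis using ell_pos[OF assms(2) False] by (simp add: pos_divide_le_eq)
qed

section \<open>Spectral components of the Lipschitz ball\<close>

theorem theorem5p1:
  fixes \<sigma> :: "complex \<Rightarrow> 'a::cstar_algebra \<Rightarrow> 'a"
    and \<A> :: "'a set"
    and \<beta> :: "'a \<Rightarrow> 'b::cstar_algebra"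
    and L L\<beta> :: "'a \<Rightarrow> real"
  assumes action: "strongly_cont_circle_action \<sigma>"
    and subalg: "unital_star_subalgebra \<A>"
    and dense: "closure \<A> = UNIV"
    and beta_hom: "unital_alg_hom_on \<A> \<beta>"
    and L_slip: "slip_norm \<A> L"
    and Lb_slip: "slip_norm \<A> L\<beta>"
    and h1: "\<forall>z\<in>circle. \<sigma> z ` \<A> \<subseteq> \<A>" "\<A> \<subseteq> Lip_S1 \<sigma>"
    and h2: "spectral_proj \<sigma> 0 ` \<A> \<subseteq> \<A>"
      "\<exists>k (\<zeta>R :: nat \<Rightarrow> 'a) m (\<zeta>L :: nat \<Rightarrow> 'a).
          (\<forall>j<k. \<zeta>R j \<in> \<A> \<inter> spectral_subspace \<sigma> 1) \<and>
          (\<forall>j<m. \<zeta>L j \<in> \<A> \<inter> spectral_subspace \<sigma> 1) \<and>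
          (\<Sum>j<k. \<zeta>R j * adj (\<zeta>R j)) = 1 \<and>
          (\<Sum>j<m. adj (\<zeta>L j) * \<zeta>L j) = 1"
    and h3: "\<exists>C\<ge>0. \<forall>a\<in>\<A>. L_ell \<sigma> a \<le> C * L a \<and> L\<beta> a \<le> C * L a"
    and h4: "\<forall>a\<in>\<A>. \<forall>b\<in>\<A>.
               L\<beta> (a * b) \<le> L\<beta> a * norm (\<beta> b) + norm (adj (\<beta> (adj a))) * L\<beta> b"
      "\<exists>\<pi> :: 'a \<Rightarrow> 'b. star_hom_on (spectral_subspace \<sigma> 0) \<pi> \<and>
          (\<forall>a\<in>\<A> \<inter> spectral_subspace \<sigma> 0. \<pi> a = \<beta> a)"
    and h5: "lsc_on \<A> L\<beta>" "\<forall>a\<in>\<A>. \<forall>z\<in>circle. L\<beta> (\<sigma> z a) = L\<beta> a"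
    and h6: "compact_qms (\<A> \<inter> spectral_subspace \<sigma> 0) L\<beta>"
  shows "compact_qms \<A> L"
proof -
  interpret circle_action \<sigma> by (rule circle_action.intro[OF action])
  let ?P = "spectral_proj \<sigma>" and ?E = "\<A> \<inter> spectral_subspace \<sigma> 0"
  have OS: "operator_system \<A>" using subalg by (simp add: unital_star_subalgebra_def operator_system_def)
  note D = operator_systemD[OF OS]
  have A_mult: "x * y \<in> \<A>" if "x \<in> \<A>" "y \<in> \<A>" for x y
    using subalg that by (simp add: unital_star_subalgebra_def)
  have A_sum: "(\<Sum>x\<leftarrow>xs. g x) \<in> \<A>" if "\<And>x. x \<in> set xs \<Longrightarrow> g x \<in> \<A>" for g :: "'a \<Rightarrow> 'a" and xs
    using that by (induction xs) (auto intro: D)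
  have A_act: "\<sigma> z x \<in> \<A>" if "z \<in> circle" "x \<in> \<A>" for z x using h1(1) that by blast
  have EOS: "operator_system ?E" by (rule fixed_points_operator_system[OF OS])
  have slipE: "slip_norm ?E L\<beta>" using Lb_slip by (simp add: slip_norm_def)
  have tbE: "totally_bounded_mod scalars {x \<in> ?E. L\<beta> x \<le> K}" for K
    by (rule totally_bounded_mod_sublevel[OF EOS slipE totally_bounded_if_compact_qms[OF EOS h6]])
  obtain \<pi> :: "'a \<Rightarrow> 'b" where \<pi>: "star_hom_on (spectral_subspace \<sigma> 0) \<pi>" "\<forall>a\<in>?E. \<pi> a = \<beta> a"
    using h4(2) by (elim exE conjE)
  have beta_contr: "norm (\<beta> x) \<le> norm x" if "x \<in> ?E" for x
  proof -
    have "norm (\<pi> x) \<le> norm x"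
      by (rule star_hom_contractive[OF \<pi>(1) closed_subalgebra_fixed_points fixed_points_adj]) (use that in auto)
    then show ?thesis using bspec[OF \<pi>(2) that] by simp
  qed
  have beta_mult: "\<beta> (x * y) = \<beta> x * \<beta> y" and beta_add: "\<beta> (x + y) = \<beta> x + \<beta> y"
    if "x \<in> \<A>" "y \<in> \<A>" for x y
    using beta_hom that by (auto simp: unital_alg_hom_on_def)
  have beta_zero: "\<beta> 0 = 0" using beta_add[OF D(9) D(9)] by simp
  obtain zs where zs: "set zs \<subseteq> \<A> \<inter> spectral_subspace \<sigma> 1" "(\<Sum>z\<leftarrow>zs. adj z * z) = 1"
  proof -
    from h2(2) obtain m and \<zeta> :: "nat \<Rightarrow> 'a" where "\<forall>j<m. \<zeta> j \<in> \<A> \<inter> spectral_subspace \<sigma> 1"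
      "(\<Sum>j<m. adj (\<zeta> j) * \<zeta> j) = 1" by (elim exE conjE)
    then have "set (map \<zeta> [0..<m]) \<subseteq> \<A> \<inter> spectral_subspace \<sigma> 1" "(\<Sum>z\<leftarrow>map \<zeta> [0..<m]. adj z * z) = 1"
      by (auto simp: o_def interv_sum_list_conv_sum_set_nat atLeast0LessThan)
    then show thesis by (rule that)
  qed
  obtain C where C: "0 \<le> C" "\<And>a. a \<in> \<A> \<Longrightarrow> L_ell \<sigma> a \<le> C * L a" "\<And>a. a \<in> \<A> \<Longrightarrow> L\<beta> a \<le> C * L a"
    using h3 by auto
  \<comment> \<open>The Lipschitz condition is stated pointwise instead of through
    \<open>L_ell\<close>: invariance under \<open>adj\<close> and the Fourier estimates use it in
    this form.\<close>
  define X where "X = {a \<in> \<A>. (\<forall>z\<in>circle. norm (\<sigma> z a - a) \<le> C * ell z) \<and> L\<beta> a \<le> C}"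
  have X: "a \<in> \<A>" "L\<beta> a \<le> C" "z \<in> circle \<Longrightarrow> norm (\<sigma> z a - a) \<le> C * ell z" if "a \<in> X" for a z
    using that by (auto simp: X_def)
  have X_adj: "adj a \<in> X" if "a \<in> X" for a
  proof -
    have "norm (\<sigma> z (adj a) - adj a) = norm (\<sigma> z a - a)" if "z \<in> circle" for z
      using that by (simp add: action_adj flip: adj_diff)
    then show ?thesis using that D(4) Lb_slip by (auto simp: X_def slip_norm_def)
  qed
  have P_zero: "?P 0 a \<in> ?E" if "a \<in> \<A>" for a
    using h2(1) that spectral_proj_in_subspace by blast
  \<comment> \<open>Lower semicontinuity is relative to \<open>\<A>\<close>, so the mean itself must
    lie there; for \<open>n > 0\<close> this is supplied by \<open>PA\<close>.\<close>
  have L_P: "L\<beta> (?P n a) \<le> L\<beta> a" if "a \<in> \<A>" "?P n a \<in> \<A>" for n a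
    unfolding spectral_proj_eq
  proof (rule slip_norm_circle_mean_le[OF OS Lb_slip h5(1)])
    fix t
    have t: "\<sigma> (cis t) a \<in> \<A>" using A_act that(1) by simp
    then show "cis (- (t * of_int n)) *\<^sub>C \<sigma> (cis t) a \<in> \<A>" by (rule D(3))
    have "L\<beta> (cis (- (t * of_int n)) *\<^sub>C \<sigma> (cis t) a) = cmod (cis (- (t * of_int n))) * L\<beta> (\<sigma> (cis t) a)"
      using Lb_slip t by (simp only: slip_norm_def)
    also have "\<dots> = L\<beta> a" using h5(2) that(1) by simp
    finally show "L\<beta> (cis (- (t * of_int n)) *\<^sub>C \<sigma> (cis t) a) \<le> L\<beta> a" by simp
  qed (use that(2) in \<open>auto intro: continuous_on_fourier simp: spectral_proj_eq\<close>)
  have tb_zero: "totally_bounded_mod scalars (?P 0 ` X)"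
  proof (rule totally_bounded_mod_mono[OF tbE[of C] subset_refl], rule image_subsetI)
    fix a assume a: "a \<in> X"
    have "L\<beta> (?P 0 a) \<le> L\<beta> a" using L_P X(1)[OF a] P_zero by blast
    then show "?P 0 a \<in> {x \<in> ?E. L\<beta> x \<le> C}" using P_zero[OF X(1)[OF a]] X(2)[OF a] by simp
  qed
  have tb_pos: "totally_bounded_mod {0} (?P (int n) ` X)" if n: "n > 0" for n
  proof -
    obtain ws where ws: "set ws \<subseteq> \<A> \<inter> spectral_subspace \<sigma> (int n)" "(\<Sum>w\<leftarrow>ws. adj w * w) = 1"
      using spectral_frame[OF subalg zs] by blast
    have wA: "w \<in> \<A>" "adj w \<in> \<A>" if "w \<in> set ws" for w using ws(1) that D(4) by auto
    have PE: "?P (int n) a * adj w \<in> ?E" if "a \<in> \<A>" "w \<in> set ws" for a w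
    proof -
      have "w \<in> spectral_subspace \<sigma> (int n)" using ws(1) that(2) by blast
      then have "?P (int n) a * adj w = ?P 0 (a * adj w)" by (simp add: spectral_proj_zero_mult_adj)
      then show ?thesis using P_zero[of "a * adj w"] A_mult[OF that(1) wA(2)[OF that(2)]] by simp
    qed
    have P_frame: "?P (int n) a = (\<Sum>w\<leftarrow>ws. (?P (int n) a * adj w) * w)" for a
      using arg_cong[OF ws(2), of "\<lambda>x. ?P (int n) a * x"] by (simp add: mult.assoc flip: sum_list_const_mult)
    \<comment> \<open>The frame expansion writes the component as a combination of elements of the
      fixed point part with coefficients in \<open>\<A>\<close>.\<close>
    have PA: "?P (int n) a \<in> \<A>" if "a \<in> \<A>" for a
      by (subst P_frame) (use PE[OF that] wA A_mult in \<open>auto intro!: A_sum\<close>)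
    have P_norm: "norm (?P (int n) a) \<le> C * pi" if "a \<in> X" for a
      using norm_spectral_proj_le[of "int n" a C] n X(3)[OF that] C(1) by auto
    have PE_norm: "norm (?P (int n) a * adj w) \<le> C * pi * norm w" if "a \<in> X" for a w
      using norm_mult_ineq[of "?P (int n) a" "adj w"] mult_right_mono[OF P_norm[OF that], of "norm w"] by simp
    \<comment> \<open>\<open>L\<beta>\<close> of \<open>P\<^sub>n(a) w\<^sup>*\<close> involves the norm of \<open>\<beta>\<^sub>-\<^sub>i(P\<^sub>n(a))\<close>, although \<open>\<beta>\<close> is unbounded. Expanding
      \<open>P\<^sub>n(a)\<^sup>*\<close> along the frame leaves only values of \<open>\<beta>\<close> at the fixed \<open>w\<^sup>*\<close> and on \<open>A\<^sub>0\<close>, where it contracts.\<close>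
    define b where "b = (\<Sum>w\<leftarrow>ws. norm (\<beta> (adj w)) * (C * pi * norm w))"
    have beta_bound: "norm (\<beta> (adj (?P (int n) a))) \<le> b" if a: "a \<in> X" for a
    proof -
      let ?y = "\<lambda>w. adj (?P (int n) a * adj w)"
      have yE: "?y w \<in> ?E" if "w \<in> set ws" for w
        using PE[OF X(1)[OF a] that] operator_systemD(4)[OF EOS] by blast
      have summand: "norm (\<beta> (adj w * ?y w)) \<le> norm (\<beta> (adj w)) * (C * pi * norm w)" if w: "w \<in> set ws" for w
      proof -
        have "norm (\<beta> (adj w * ?y w)) \<le> norm (\<beta> (adj w)) * norm (\<beta> (?y w))"
          using beta_mult[of "adj w" "?y w"] wA(2)[OF w] yE[OF w] norm_mult_ineq by simp
        also have "norm (\<beta> (?y w)) \<le> C * pi * norm w"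
          using beta_contr[OF yE[OF w]] PE_norm[OF a, of w] by simp
        finally show ?thesis by (simp add: mult_left_mono)
      qed
      \<comment> \<open>Generalized to lists \<open>vs\<close> with entries from \<open>ws\<close>:
        \<open>\<beta>\<close> is additive only on \<open>\<A>\<close>, so every partial sum has to
        be seen to lie there.\<close>
      have *: "norm (\<beta> (\<Sum>w\<leftarrow>vs. adj w * ?y w)) \<le> (\<Sum>w\<leftarrow>vs. norm (\<beta> (adj w)) * (C * pi * norm w))"
        if "set vs \<subseteq> set ws" for vs
        using that
      proof (induction vs)
        case (Cons v vs)
        have "adj v * ?y v \<in> \<A>" using A_mult wA(2) yE Cons.prems by simp
        moreover have "(\<Sum>w\<leftarrow>vs. adj w * ?y w) \<in> \<A>"
          using Cons.prems A_mult wA(2) yE by (intro A_sum) auto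
        ultimately have "\<beta> (\<Sum>w\<leftarrow>v # vs. adj w * ?y w) = \<beta> (adj v * ?y v) + \<beta> (\<Sum>w\<leftarrow>vs. adj w * ?y w)"
          using beta_add by simp
        moreover have "norm (\<beta> (adj v * ?y v)) \<le> norm (\<beta> (adj v)) * (C * pi * norm v)"
          using Cons.prems by (intro summand) simp
        moreover have "norm (\<beta> (\<Sum>w\<leftarrow>vs. adj w * ?y w)) \<le> (\<Sum>w\<leftarrow>vs. norm (\<beta> (adj w)) * (C * pi * norm w))"
          using Cons by simp
        ultimately show ?case using norm_triangle_mono by simp
      qed (simp add: beta_zero)
      have "adj (?P (int n) a) = (\<Sum>w\<leftarrow>ws. adj w * ?y w)"
      proof -
        have "adj (\<Sum>w\<leftarrow>vs. (?P (int n) a * adj w) * w) = (\<Sum>w\<leftarrow>vs. adj w * ?y w)" for vs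
          by (induction vs) (simp_all add: adj_add adj_mult mult.assoc)
        from this[of ws] show ?thesis unfolding P_frame[of a, symmetric] .
      qed
      then show ?thesis using *[OF subset_refl] by (simp add: b_def)
    qed
    have tb_w: "totally_bounded_mod {0} ((\<lambda>a. (?P (int n) a * adj w) * w) ` X)" if w: "w \<in> set ws" for w
    proof -
      \<comment> \<open>The twisted Leibniz rule for the product with \<open>adj w\<close>:
        \<open>C\<close> bounds \<open>L\<beta>\<close> of the component, \<open>b\<close> the value
        of \<open>\<beta>\<close> in the other term.\<close>
      define K where "K = C * norm (\<beta> (adj w)) + b * L\<beta> (adj w)"
      have "(\<lambda>a. ?P (int n) a * adj w) ` X \<subseteq> {x \<in> ?E. L\<beta> x \<le> K}"
      proof (rule image_subsetI)
        fix a assume a: "a \<in> X"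
        let ?p = "?P (int n) a"
        have "L\<beta> (?p * adj w) \<le> L\<beta> ?p * norm (\<beta> (adj w)) + norm (adj (\<beta> (adj ?p))) * L\<beta> (adj w)"
          using h4(1) PA[OF X(1)[OF a]] wA(2)[OF w] by blast
        also have "\<dots> \<le> K"
        proof -
          have "L\<beta> ?p \<le> C" using L_P[OF X(1)[OF a] PA[OF X(1)[OF a]]] X(2)[OF a] by simp
          moreover have "0 \<le> L\<beta> (adj w)" using Lb_slip wA(2)[OF w] by (simp add: slip_norm_def)
          ultimately show ?thesis
            unfolding K_def using beta_bound[OF a] by (intro add_mono mult_right_mono) auto
        qed
        finally show "?p * adj w \<in> {x \<in> ?E. L\<beta> x \<le> K}" using PE[OF X(1)[OF a] w] by simp
      qed
      then have "totally_bounded_mod scalars ((\<lambda>a. ?P (int n) a * adj w) ` X)"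
        by (rule totally_bounded_mod_mono[OF tbE subset_refl])
      \<comment> \<open>Scalars must go at this point, since multiplication by \<open>w\<close>
        would carry them to multiples of \<open>w\<close>.\<close>
      then have "totally_bounded_mod {0} ((\<lambda>a. ?P (int n) a * adj w) ` X)"
        by (rule totally_bounded_if_mod_scalars_bounded[where M="C * pi * norm w"]) (use PE_norm in auto)
      then have "totally_bounded_mod {0} ((\<lambda>x. x * w) ` (\<lambda>a. ?P (int n) a * adj w) ` X)"
        by (rule totally_bounded_mod_image[OF _ bounded_linear_mult_left]) simp
      then show ?thesis by (simp add: image_image)
    qed
    \<comment> \<open>Indexed by positions, so that repetitions in \<open>ws\<close> are
      counted.\<close>
    have "totally_bounded_mod {0} ((\<lambda>a. \<Sum>i\<in>{0..<length ws}. (?P (int n) a * adj (ws ! i)) * ws ! i) ` X)"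
      by (rule totally_bounded_mod_sum) (auto intro: tb_w)
    moreover have "?P (int n) a = (\<Sum>i\<in>{0..<length ws}. (?P (int n) a * adj (ws ! i)) * ws ! i)" for a
      using P_frame[of a] by (simp add: sum_list_sum_nth)
    ultimately show ?thesis by simp
  qed
  have tb_all: "totally_bounded_mod scalars (?P m ` X)" for m
  proof -
    consider "m = 0" | n where "n > 0" "m = int n" | n where "n > 0" "m = - int n"
      by (metis int_cases4 neq0_conv of_nat_0 of_nat_0_less_iff)
    then show ?thesis
    proof cases
      case 1
      then show ?thesis using tb_zero by simp
    next
      case (2 n)
      then show ?thesis using tb_pos[of n] zero_in_scalars by (auto intro: totally_bounded_mod_mono)
    next
      case (3 n)
      have "totally_bounded_mod {0} (adj ` ?P (int n) ` X)"
        by (rule totally_bounded_mod_image[OF tb_pos[OF 3(1)] bounded_linear_adj]) simp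
      moreover have "?P m ` X \<subseteq> adj ` ?P (int n) ` X"
        using X_adj by (auto simp: 3(2) spectral_proj_adj)
      ultimately show ?thesis using zero_in_scalars totally_bounded_mod_mono[of "{0}"] by blast
    qed
  qed
  have "totally_bounded_mod scalars X"
  proof (rule totally_bounded_mod_approx)
    fix e :: real assume e: "e > 0"
    \<comment> \<open>\<open>C + 1\<close> avoids division by zero. The first error term is then at
      most \<open>e / 2\<close>, and \<open>N\<close> makes the second smaller than
      \<open>e / 2\<close>.\<close>
    define d where "d = e / (C + 1)"
    have d: "d > 0" using e C(1) by (simp add: d_def)
    obtain N :: nat where N: "36 * (C + 1) / (d * e) < real N" using reals_Archimedean2 by blast
    moreover have "0 < 36 * (C + 1) / (d * e)" using C(1) d e by simp
    ultimately have N0: "N > 0" by (metis of_nat_0_less_iff order_less_trans)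
    let ?T = "\<lambda>a. (1 / of_nat N) *\<^sub>R (\<Sum>j<N. \<Sum>k<N. ?P (int k - int j) a)"
    have "totally_bounded_mod scalars ((\<lambda>a. \<Sum>j<N. \<Sum>k<N. ?P (int k - int j) a) ` X)"
      by (intro totally_bounded_mod_sum tb_all zero_in_scalars scalars_add) auto
    then have "totally_bounded_mod scalars ((\<lambda>x. (1 / of_nat N) *\<^sub>R x) ` (\<lambda>a. \<Sum>j<N. \<Sum>k<N. ?P (int k - int j) a) ` X)"
    proof (rule totally_bounded_mod_image[OF _ bounded_linear_scaleR_right])
      show "(*\<^sub>R) (1 / of_nat N) ` scalars \<subseteq> scalars"
        unfolding scalars_def by (auto simp: scaleC_scaleC simp flip: scaleC_of_real)
    qed
    then have "totally_bounded_mod scalars (?T ` X)" by (simp add: image_image)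
    moreover have "norm (a - ?T a) < e" if "a \<in> X" for a
    proof -
      have "norm (a - ?T a) \<le> C * (d / 2 + 18 / (d * of_nat N))"
        by (rule fejer_approximation[OF N0 d C(1) X(3)[OF that]])
      also have "\<dots> \<le> (C + 1) * (d / 2 + 18 / (d * of_nat N))"
        using d by (intro mult_right_mono) auto
      also have "\<dots> = e / 2 + 18 * (C + 1) / (d * of_nat N)"
        using C(1) by (simp add: d_def field_simps)
      also have "18 * (C + 1) / (d * of_nat N) < e / 2"
      proof -
        have "36 * (C + 1) < real N * (d * e)" using N d e by (simp add: pos_divide_less_eq)
        then show ?thesis using d N0 by (simp add: pos_divide_less_eq algebra_simps)
      qed
      finally show ?thesis by simp
    qed
    ultimately show "\<exists>g. totally_bounded_mod scalars (g ` X) \<and> (\<forall>a\<in>X. norm (a - g a) < e)"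
      by (intro exI[of _ ?T]) auto
  qed
  moreover have "{a \<in> \<A>. L a \<le> 1} \<subseteq> X"
  proof
    fix a assume "a \<in> {a \<in> \<A>. L a \<le> 1}"
    then have a: "a \<in> \<A>" "C * L a \<le> C" using C(1) by (auto simp: mult_left_le)
    have "\<sigma> 1 = id" using action by (simp add: strongly_cont_circle_action_def)
    moreover have "L_ell \<sigma> a \<le> C" "L\<beta> a \<le> C" using C(2,3)[OF a(1)] a(2) by auto
    ultimately show "a \<in> X" using a(1) h1(2) C(1) by (auto simp: X_def intro!: L_ell_bound)
  qed
  ultimately have "totally_bounded_mod scalars {a \<in> \<A>. L a \<le> 1}"
    using totally_bounded_mod_mono[OF _ subset_refl] by blast
  then show ?thesis by (rule compact_qms_if_totally_bounded[OF OS L_slip])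
qed

end
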